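(* Let $(\mu,\sigma)\in\mathbb{R}^2$ be given, and consider the boundary value problem $$(\ast)\qquad \dot u=\tfrac12 u''+\mu u' \ \text{ on } (0,\infty)\times(0,1),\qquad \dot u(t,0)=-\sigma u'(t,0)\ \text{ and }\ \dot u(t,1)=\sigma u'(t,1)\ \text{ for } t\in(0,\infty).$$ (i) Suppose that $u\in U$ satisfies $(\ast)$. If, as $t\searrow 0$, $u(t,\cdot)$ converges uniformly on compact subsets of $(0,1)$, then both $u(t,0)$ and $u(t,1)$ converge as $t\searrow0$, and so $u(t,\cdot)$ converges in $F$. (ii) Given $f\in F$, there is a unique $u_f\in U$ which satisfies $(\ast)$ and the initial condition that, as $t\searrow0$, $u_f(t,\cdot)$ converges to $f$ in $F$. In particular, if $Q_tf\equiv u_f(t,\cdot)$ for $t>0$ (and $Q_0f=f$), then $\{Q_t:t\ge0\}$ is a semigroup of bounded, continuous operators on $F$.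
   Context: $F$ is the space of bounded functions $f:[0,1]\to\mathbb{R}$ which are continuous on $(0,1)$ but not necessarily continuous at the boundary $\{0,1\}$. Convergence of $\{f_n\}_{n\ge1}\subseteq F$ to $f$ in $F$ means that $\{\|f_n\|_{\mathrm u}\}$ is bounded ($\|\cdot\|_{\mathrm u}$ is the uniform, i.e. supremum, norm), $f_n(x)\to f(x)$ for each $x\in[0,1]$, and the convergence is uniform for $x$ in compact subsets of $(0,1)$; convergence as $t\searrow0$ is understood analogously. Continuity of operators on $F$ is with respect to this notion of convergence. Functions are written $u(t,x)$ with $t$ time and $x$ space; $\dot u=\partial u/\partial t$, $u'=\partial u/\partial x$, $u''=\partial^2u/\partial x^2$. $U$ is the space of functions $u\in C^{1,2}((0,\infty)\times[0,1];\mathbb{R})$ (that is, $C^{1,2}$ right up to and including the spatial boundary $(0,\infty)\times\{0,1\}$) such that $u$ is bounded on $(0,1]\times[0,1]$ and, for each $0<T_1<T_2<\infty$, $\dot u$, $u'$ and $u''$ are bounded on $[T_1,T_2]\times[0,1]$. *)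

theory Defs
  imports "HOL-Analysis.Analysis"
begin

text \<open>
  Functions on $[0,1]$ and on $(0,\infty)\times[0,1]$ are rendered as HOL functions that are
  \<open>undefined\<close> off their domain, so that equality of functions (hence \<open>\<exists>!\<close>) has its usual meaning.
\<close>

definition F_space :: "(real \<Rightarrow> real) set" where
  "F_space = {f \<in> extensional {0..1}. bounded (f ` {0..1}) \<and> continuous_on {0<..<1} f}"

definition unif_norm :: "(real \<Rightarrow> real) \<Rightarrow> real" where
  "unif_norm f = (SUP x\<in>{0..1}. \<bar>f x\<bar>)"

definition unif_conv_compacts :: "('i \<Rightarrow> real \<Rightarrow> real) \<Rightarrow> (real \<Rightarrow> real) \<Rightarrow> 'i filter \<Rightarrow> bool" where
  "unif_conv_compacts h g G \<longleftrightarrow>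
     (\<forall>K. compact K \<and> K \<subseteq> {0<..<1} \<longrightarrow> uniform_limit K h g G)"

definition F_seq_converges :: "(nat \<Rightarrow> real \<Rightarrow> real) \<Rightarrow> (real \<Rightarrow> real) \<Rightarrow> bool" where
  "F_seq_converges h f \<longleftrightarrow>
     (\<forall>n. h n \<in> F_space) \<and> f \<in> F_space \<and>
     bounded (range (\<lambda>n. unif_norm (h n))) \<and>
     (\<forall>x\<in>{0..1}. (\<lambda>n. h n x) \<longlonglongrightarrow> f x) \<and>
     unif_conv_compacts h f sequentially"

text \<open>
  Convergence as $t\searrow0$: the norms are only required to be bounded for small $t$.
\<close>

definition F_converges_at_0 :: "(real \<Rightarrow> real \<Rightarrow> real) \<Rightarrow> (real \<Rightarrow> real) \<Rightarrow> bool" where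
  "F_converges_at_0 h f \<longleftrightarrow>
     (\<forall>t>0. h t \<in> F_space) \<and> f \<in> F_space \<and>
     (\<exists>\<delta>>0. bounded ((\<lambda>t. unif_norm (h t)) ` {0<..<\<delta>})) \<and>
     (\<forall>x\<in>{0..1}. ((\<lambda>t. h t x) \<longlongrightarrow> f x) (at_right 0)) \<and>
     unif_conv_compacts h f (at_right 0)"

definition dt :: "(real \<Rightarrow> real \<Rightarrow> real) \<Rightarrow> real \<Rightarrow> real \<Rightarrow> real" where
  "dt u t x = deriv (\<lambda>s. u s x) t"

text \<open>Space derivatives are taken within $[0,1]$, so they are one-sided at $0$ and $1$.\<close>

definition dx :: "(real \<Rightarrow> real \<Rightarrow> real) \<Rightarrow> real \<Rightarrow> real \<Rightarrow> real" where
  "dx u t x = vector_derivative (u t) (at x within {0..1})"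

definition dxx :: "(real \<Rightarrow> real \<Rightarrow> real) \<Rightarrow> real \<Rightarrow> real \<Rightarrow> real" where
  "dxx u t x = vector_derivative (dx u t) (at x within {0..1})"

definition C12 :: "(real \<Rightarrow> real \<Rightarrow> real) \<Rightarrow> bool" where
  "C12 u \<longleftrightarrow>
     (\<forall>t>0. \<forall>x\<in>{0..1}.
        (\<lambda>s. u s x) differentiable (at t) \<and>
        u t differentiable (at x within {0..1}) \<and>
        dx u t differentiable (at x within {0..1})) \<and>
     (\<forall>v\<in>{u, dt u, dx u, dxx u}. continuous_on ({0<..} \<times> {0..1}) (\<lambda>(t, x). v t x))"

definition U_space :: "(real \<Rightarrow> real \<Rightarrow> real) set" where
  "U_space = {u \<in> {0<..} \<rightarrow>\<^sub>E extensional {0..1}.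
     C12 u \<and>
     bounded ((\<lambda>(t, x). u t x) ` ({0<..1} \<times> {0..1})) \<and>
     (\<forall>T1 T2. 0 < T1 \<and> T1 < T2 \<longrightarrow>
        (\<forall>v\<in>{dt u, dx u, dxx u}. bounded ((\<lambda>(t, x). v t x) ` ({T1..T2} \<times> {0..1}))))}"

definition solves_bvp :: "real \<Rightarrow> real \<Rightarrow> (real \<Rightarrow> real \<Rightarrow> real) \<Rightarrow> bool" where
  "solves_bvp \<mu> \<sigma> u \<longleftrightarrow>
     (\<forall>t>0. \<forall>x\<in>{0<..<1}. dt u t x = 1/2 * dxx u t x + \<mu> * dx u t x) \<and>
     (\<forall>t>0. dt u t 0 = - \<sigma> * dx u t 0) \<and>
     (\<forall>t>0. dt u t 1 = \<sigma> * dx u t 1)"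

definition solves_ivp :: "real \<Rightarrow> real \<Rightarrow> (real \<Rightarrow> real) \<Rightarrow> (real \<Rightarrow> real \<Rightarrow> real) \<Rightarrow> bool" where
  "solves_ivp \<mu> \<sigma> f u \<longleftrightarrow> u \<in> U_space \<and> solves_bvp \<mu> \<sigma> u \<and> F_converges_at_0 u f"

definition Q :: "real \<Rightarrow> real \<Rightarrow> real \<Rightarrow> (real \<Rightarrow> real) \<Rightarrow> real \<Rightarrow> real" where
  "Q \<mu> \<sigma> t f = (if t = 0 then f else (THE u. solves_ivp \<mu> \<sigma> f u) t)"

definition F_linear :: "((real \<Rightarrow> real) \<Rightarrow> real \<Rightarrow> real) \<Rightarrow> bool" where
  "F_linear A \<longleftrightarrow> A \<in> F_space \<rightarrow> F_space \<and>
     (\<forall>f\<in>F_space. \<forall>g\<in>F_space. \<forall>a b.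
        A (\<lambda>x\<in>{0..1}. a * f x + b * g x) = (\<lambda>x\<in>{0..1}. a * A f x + b * A g x))"

definition F_bounded_operator :: "((real \<Rightarrow> real) \<Rightarrow> real \<Rightarrow> real) \<Rightarrow> bool" where
  "F_bounded_operator A \<longleftrightarrow>
     F_linear A \<and> (\<exists>C. \<forall>f\<in>F_space. unif_norm (A f) \<le> C * unif_norm f)"

definition F_continuous_operator :: "((real \<Rightarrow> real) \<Rightarrow> real \<Rightarrow> real) \<Rightarrow> bool" where
  "F_continuous_operator A \<longleftrightarrow>
     (\<forall>h f. F_seq_converges h f \<longrightarrow> F_seq_converges (\<lambda>n. A (h n)) (A f))"

definition F_semigroup :: "(real \<Rightarrow> (real \<Rightarrow> real) \<Rightarrow> real \<Rightarrow> real) \<Rightarrow> bool" where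
  "F_semigroup P \<longleftrightarrow>
     (\<forall>t\<ge>0. P t \<in> F_space \<rightarrow> F_space) \<and>
     (\<forall>f\<in>F_space. P 0 f = f) \<and>
     (\<forall>s\<ge>0. \<forall>t\<ge>0. \<forall>f\<in>F_space. P (s + t) f = P s (P t f))"

end

theory Submission
  imports Defs "HOL-Probability.Distributions"
begin

text \<open>
  Multiplying by \<open>exp (\<mu> x + \<mu>\<^sup>2 t / 2)\<close> removes the drift and turns the boundary conditions into
  \<open>v'' / 2 \<plusminus> \<sigma> v' = const * v\<close> for a solution \<open>v\<close> of the heat equation.  On a half line the operator
  \<open>v'' / 2 + \<sigma> v'\<close> at 0 is solved by explicit Gaussian kernels, and the single layer potential built from
  them reproduces its density under this operator.  Superposing the kernels of the two ends leaves boundary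
  errors with bounded kernels, so the remaining conditions form a \<open>2 \<times> 2\<close> Volterra equation of the second
  kind; this gives existence, with a bound on \<open>u(t, x)\<close> by the \<open>L\<^sup>1\<close> size of the datum.  For two
  solutions \<open>u, v\<close> the quantity
  \<open>\<integral> e\<^bsup>2\<mu>x\<^esup> u(s, x) v(t - s, x) dx - (e\<^bsup>2\<mu>\<^esup> u(s, 1) v(t - s, 1) + u(s, 0) v(t - s, 0)) / (2\<sigma>)\<close>
  does not depend on \<open>s\<close>.  Testing with the solutions already constructed gives uniqueness,
      and the convergence
  of the boundary values in (i).  The \<open>L\<^sup>1\<close> bound and dominated convergence make each operator continuous on
      \<open>F\<close>.
\<close>

section \<open>The Gaussian tail\<close>

text \<open>For \<sigma> > 0 the boundary condition has the wrong sign for the maximum principle at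
  the ends, and the weights - 1 / (2 \<sigma>) make the conserved bilinear form indefinite. So
  solutions are built explicitly, and uniqueness does not rest on positivity of an energy. It rests
  on \<open>F_space\<close> admitting jumps at 0 and 1: a test datum that vanishes at both ends
  removes the boundary terms, whatever the sign of \<sigma>. The conserved form is Lagrange's
  identity for the weight exp (2 \<mu> x). The end terms in u' v - u v' become a time derivative
  once the boundary conditions express u' by the time derivative of u divided by \<sigma>. For
  \<sigma> = 0 this is impossible, but then the end values are constant in time. On the boundary the
  time derivative is v'' / 2 by the heat equation. Hence the layer must jump in its second
  derivative, one order higher than for a Neumann condition, and its kernel is an integrated
  Gaussian. The bound must be by the L1 size because convergence in F is uniform only away from the
  ends, but it does imply L1 convergence.\<close>

definition normal_tail :: "real \<Rightarrow> real" where
  "normal_tail y = (\<integral>z. indicator {y..} z * std_normal_density z \<partial>lborel)"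

lemma integrable_std_normal_density: "integrable lborel std_normal_density"
  by (rule integrable_normal_density) simp

lemma integrable_indicator_std_normal_density:
  "integrable lborel (\<lambda>z. indicator {y..} z * std_normal_density z)"
  by (rule integrable_mult_indicator[where 'b=real, simplified]) (auto intro: integrable_std_normal_density)

lemma normal_tail_diff:
  assumes "a \<le> b"
  shows "normal_tail a - normal_tail b = integral {a..b} std_normal_density"
proof -
  have "normal_tail a - normal_tail b =
      (\<integral>z. indicator {a..} z * std_normal_density z - indicator {b..} z * std_normal_density z \<partial>lborel)"
    unfolding normal_tail_def
    by (rule Bochner_Integration.integral_diff[symmetric]) (rule integrable_indicator_std_normal_density)+
  also have "\<dots> = (\<integral>z. indicator {a..b} z *\<^sub>R std_normal_density z \<partial>lborel)"
  proof (rule integral_cong_AE)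
    show "AE z in lborel. indicator {a..} z * std_normal_density z - indicator {b..} z * std_normal_density z
        = indicator {a..b} z *\<^sub>R std_normal_density z"
      \<comment> \<open>The two tails differ by the indicator of \<open>{a..<b}\<close>; the
        endpoint \<open>b\<close> is discarded as a null set.\<close>
      using AE_lborel_singleton[of b] by eventually_elim (use assms in \<open>auto simp: indicator_def\<close>)
  qed auto
  also have "\<dots> = integral {a..b} std_normal_density"
    by (subst set_borel_integral_eq_integral[unfolded set_lebesgue_integral_def set_integrable_def])
       (use integrable_mult_indicator[OF _ integrable_std_normal_density, of "{a..b}"] in auto)
  finally show ?thesis .
qed

text \<open>On \<open>{y - 1<..}\<close> the tail is a constant minus an integral with variable
  upper limit, so the fundamental theorem of calculus applies. The base point \<open>y - 1\<close>
  makes \<open>y\<close> an interior point.\<close>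

lemma has_real_derivative_normal_tail: "(normal_tail has_real_derivative - std_normal_density y) (at y)"
proof -
  have c: "continuous_on {y - 1..y + 1} std_normal_density"
    by (auto simp: std_normal_density_def intro!: continuous_intros)
  have "((\<lambda>u. integral {y - 1..u} std_normal_density) has_real_derivative std_normal_density y)
      (at y within {y - 1..y + 1})"
    by (rule integral_has_real_derivative[OF c]) auto
  then have "((\<lambda>u. normal_tail (y - 1) - integral {y - 1..u} std_normal_density)
      has_real_derivative 0 - std_normal_density y) (at y within {y - 1..y + 1})"
    by (intro DERIV_diff DERIV_const)
  then have "((\<lambda>u. normal_tail (y - 1) - integral {y - 1..u} std_normal_density)
      has_real_derivative - std_normal_density y) (at y)"
    by (subst (asm) at_within_Icc_at) auto
  moreover have "\<forall>\<^sub>F u in nhds y. normal_tail (y - 1) - integral {y - 1..u} std_normal_density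
      = normal_tail u"
    by (rule eventually_nhds_in_open[of "{y - 1<..}", THEN eventually_mono])
       (auto simp: normal_tail_diff[symmetric])
  ultimately show ?thesis
    by (subst DERIV_cong_ev[OF refl _ refl, of _ "\<lambda>u. normal_tail (y - 1) - integral {y
        - 1..u} std_normal_density"])
       (auto elim: eventually_mono)
qed

lemma normal_tail_nonneg: "0 \<le> normal_tail y"
  unfolding normal_tail_def by (rule integral_nonneg_AE) auto

lemma normal_tail_le_1: "normal_tail y \<le> 1"
proof -
  have "normal_tail y \<le> (\<integral>z. std_normal_density z \<partial>lborel)"
    unfolding normal_tail_def
    by (rule integral_mono_AE[OF integrable_indicator_std_normal_density integrable_std_normal_density])
       (auto simp: indicator_def)
  then show ?thesis by simp
qed

lemma tendsto_normal_tail_at_top: "(normal_tail \<longlongrightarrow> 0) at_top"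
proof -
  have "((\<lambda>y. \<integral>z. indicator {y..} z * std_normal_density z \<partial>lborel) \<longlongrightarrow> (\<integral>z. 0 \<partial>(lborel::real measure))) at_top"
  proof (rule integral_dominated_convergence_at_top[where w=std_normal_density])
    show "\<forall>\<^sub>F i in at_top. AE x in lborel. norm (indicator {i..} x * std_normal_density x)
        \<le> std_normal_density x"
      by (auto simp: indicator_def)
    show "AE x in lborel. ((\<lambda>i. indicator {i..} x * std_normal_density x) \<longlongrightarrow> 0) at_top"
    proof (rule AE_I2)
      fix x :: real
      have "\<forall>\<^sub>F i in at_top. indicator {i..} x * std_normal_density x = 0"
        using eventually_gt_at_top[of x] by eventually_elim auto
      then show "((\<lambda>i. indicator {i..} x * std_normal_density x) \<longlongrightarrow> 0) at_top"
        by (rule tendsto_eventually)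
    qed
  qed (auto intro: integrable_std_normal_density)
  then show ?thesis by (simp add: normal_tail_def[abs_def])
qed

text \<open>The half Gaussian moment after the substitution x / sqrt 2. Together with the factor 2
  in \<open>bk\<close> it gives the boundary kernel the value 1 at the origin as time tends to
  0.\<close>

lemma normal_tail_0: "normal_tail 0 = 1 / 2"
proof -
  have "has_bochner_integral lborel (\<lambda>x::real. indicator {0..} x *\<^sub>R exp (- x\<^sup>2)) (sqrt pi / 2)"
    by (rule gaussian_moment_0)
  then have "has_bochner_integral lborel (\<lambda>x::real. indicator {0..} (0 + (1 / sqrt 2) * x) *\<^sub>R exp (- (0
      + (1 / sqrt 2) * x)\<^sup>2))
     ((sqrt pi / 2) /\<^sub>R \<bar>1 / sqrt 2\<bar>)"
    by (subst (asm) lborel_has_bochner_integral_real_affine_iff[of "1 / sqrt 2" _ _ 0]) simp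
  then have "has_bochner_integral lborel (\<lambda>x::real. indicator {0..} x *\<^sub>R exp (- x\<^sup>2 / 2)) (sqrt pi / 2 * sqrt
      2)"
    by (simp add: power_divide indicator_def zero_le_divide_iff mult.commute)
  then have "has_bochner_integral lborel (\<lambda>x::real. (1 / sqrt (2 * pi)) * (indicator {0..} x *\<^sub>R exp (- x\<^sup>2 /
      2)))
      ((1 / sqrt (2 * pi)) * (sqrt pi / 2 * sqrt 2))"
    by (rule has_bochner_integral_mult_right)
  then have "normal_tail 0 = (1 / sqrt (2 * pi)) * (sqrt pi / 2 * sqrt 2)"
    unfolding normal_tail_def
    by (intro has_bochner_integral_integral_eq) (simp add: std_normal_density_def mult_ac)
  then show ?thesis by (simp add: real_sqrt_mult)
qed

lemma continuous_on_normal_tail [continuous_intros]: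
  "continuous_on S f \<Longrightarrow> continuous_on S (\<lambda>x. normal_tail (f x))"
  by (rule continuous_on_compose2[where g=normal_tail and t=UNIV])
     (auto intro!: continuous_at_imp_continuous_on DERIV_isCont has_real_derivative_normal_tail)

section \<open>Parameter integrals and solutions of the heat equation\<close>

text \<open>\<open>K\<close> is controlled only on \<open>{a..b}\<close>; since \<open>w\<close>
  vanishes elsewhere, \<open>K\<close> may be replaced by its restriction, which is measurable and
  bounded.\<close>

lemma integrable_bounded_mult:
  fixes K w :: "real \<Rightarrow> real"
  assumes "integrable lborel w" "\<And>s. s \<notin> {a..b} \<Longrightarrow> w s = 0" "continuous_on {a..b} K"
  shows "integrable lborel (\<lambda>s. K s * w s)"
proof -
  have m: "(\<lambda>s. indicator {a..b} s *\<^sub>R K s) \<in> borel_measurable borel"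
    by (rule borel_measurable_continuous_on_indicator) (use assms in auto)
  obtain B where B: "\<And>s. s \<in> {a..b} \<Longrightarrow> \<bar>K s\<bar> \<le> B"
    using compact_imp_bounded[OF compact_continuous_image[OF assms(3)]]
    by (fastforce simp: bounded_iff)
  have e: "(\<lambda>s. K s * w s) = (\<lambda>s. (indicator {a..b} s *\<^sub>R K s) * w s)"
    using assms(2) by (auto simp: indicator_def fun_eq_iff)
  have [measurable]: "w \<in> borel_measurable borel"
    using borel_measurable_integrable[OF assms(1)] by simp
  show ?thesis
  proof (rule Bochner_Integration.integrable_bound)
    show "integrable lborel (\<lambda>s. B * w s)" using assms(1) by simp
    show "(\<lambda>s. K s * w s) \<in> borel_measurable lborel" unfolding e using m by measurable
    show "AE s in lborel. norm (K s * w s) \<le> norm (B * w s)"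
    proof (rule AE_I2)
      fix s show "norm (K s * w s) \<le> norm (B * w s)"
      proof (cases "s \<in> {a..b}")
        case True
        then have "\<bar>K s\<bar> \<le> \<bar>B\<bar>" using B by force
        then show ?thesis by (simp add: abs_mult mult_right_mono)
      qed (simp add: assms(2))
    qed
  qed
qed

lemma param_integral_continuous:
  fixes K :: "'a::heine_borel \<Rightarrow> real \<Rightarrow> real"
  assumes K: "continuous_on (S \<times> {a..b}) (\<lambda>(p, s). K p s)"
    and w: "integrable lborel w" "\<And>s. s \<notin> {a..b} \<Longrightarrow> w s = 0"
  shows "continuous_on S (\<lambda>p. \<integral>s. K p s * w s \<partial>lborel)"
  unfolding continuous_on_sequentially
proof (intro allI ballI impI, elim conjE, unfold comp_def)
  fix x l assume l: "l \<in> S" and x: "\<forall>n::nat. x n \<in> S" and xl: "x \<longlonglongrightarrow> l"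
  \<comment> \<open>A convergent sequence together with its limit is compact, so \<open>K\<close> is
    bounded on \<open>C \<times> {a..b}\<close>. This supplies the dominating function for an
    arbitrary parameter set.\<close>
  define C where "C = insert l (range x)"
  have C: "compact C" "C \<subseteq> S"
    unfolding C_def using compact_sequence_with_limit[OF xl] l x by auto
  have cont: "continuous_on {a..b} (K p)" if "p \<in> S" for p
    by (rule continuous_on_compose2[OF K, of _ "\<lambda>s. (p, s)", simplified])
       (use that in \<open>auto intro!: continuous_intros\<close>)
  have "compact ((\<lambda>(p, s). K p s) ` (C \<times> {a..b}))"
    by (intro compact_continuous_image continuous_on_subset[OF K] compact_Times)
       (use C in auto)
  then obtain B where B: "\<And>p s. p \<in> C \<Longrightarrow> s \<in> {a..b} \<Longrightarrow> \<bar>K p s\<bar> \<le> B"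
    using compact_imp_bounded by (force simp: bounded_iff)
  show "(\<lambda>n. \<integral>s. K (x n) s * w s \<partial>lborel) \<longlonglongrightarrow> (\<integral>s. K l s * w s \<partial>lborel)"
  proof (rule integral_dominated_convergence[where w = "\<lambda>s. B * \<bar>w s\<bar>"])
    show "(\<lambda>s. K l s * w s) \<in> borel_measurable lborel"
      by (rule borel_measurable_integrable, rule integrable_bounded_mult[OF w]) (auto intro: cont l)
    show "(\<lambda>s. K (x n) s * w s) \<in> borel_measurable lborel" for n
      by (rule borel_measurable_integrable, rule integrable_bounded_mult[OF w]) (auto intro: cont simp: x)
    show "integrable lborel (\<lambda>s. B * \<bar>w s\<bar>)" using w by auto
    show "AE s in lborel. (\<lambda>n. K (x n) s * w s) \<longlonglongrightarrow> K l s * w s"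
    proof (rule AE_I2)
      fix s
      show "(\<lambda>n. K (x n) s * w s) \<longlonglongrightarrow> K l s * w s"
      proof (cases "s \<in> {a..b}")
        case True
        have "continuous_on S (\<lambda>p. K p s)"
          by (rule continuous_on_compose2[OF K, of _ "\<lambda>p. (p, s)", simplified])
             (use True in \<open>auto intro!: continuous_intros\<close>)
        then have "(\<lambda>n. K (x n) s) \<longlonglongrightarrow> K l s"
          using l x xl unfolding continuous_on_sequentially comp_def by blast
        then show ?thesis by (intro tendsto_intros)
      qed (simp add: w)
    qed
    show "AE s in lborel. norm (K (x n) s * w s) \<le> B * \<bar>w s\<bar>" for n
    proof (rule AE_I2)
      fix s show "norm (K (x n) s * w s) \<le> B * \<bar>w s\<bar>"
        by (cases "s \<in> {a..b}") (auto simp: abs_mult w C_def intro!: mult_right_mono B)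
    qed
  qed
qed

text \<open>Dominated convergence for difference quotients along sequences: on a closed ball around
  \<open>x\<close> they are bounded by a bound of \<open>K'\<close>, by the mean value
  inequality.\<close>

lemma param_integral_has_derivative:
  fixes K K' :: "real \<Rightarrow> real \<Rightarrow> real"
  assumes S: "open S" "x \<in> S"
    and d: "\<And>y s. y \<in> S \<Longrightarrow> s \<in> {a..b} \<Longrightarrow> ((\<lambda>y. K y s) has_real_derivative K' y s) (at y)"
    and K: "\<And>y. y \<in> S \<Longrightarrow> continuous_on {a..b} (K y)"
    and K': "continuous_on (S \<times> {a..b}) (\<lambda>(y, s). K' y s)"
    and w: "integrable lborel w" "\<And>s. s \<notin> {a..b} \<Longrightarrow> w s = 0"
  shows "((\<lambda>y. \<integral>s. K y s * w s \<partial>lborel) has_real_derivative (\<integral>s. K' x s * w s \<partial>lborel)) (at x)"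
proof -
  obtain e where e: "e > 0" "cball x e \<subseteq> S" using S open_contains_cball by blast
  have int: "integrable lborel (\<lambda>s. K y s * w s)" if "y \<in> S" for y
    by (rule integrable_bounded_mult[OF w]) (auto intro: K that)
  have cont': "continuous_on {a..b} (K' x)"
    by (rule continuous_on_compose2[OF K', of _ "\<lambda>s. (x, s)", simplified])
       (use S in \<open>auto intro!: continuous_intros\<close>)
  have "compact ((\<lambda>(p, s). K' p s) ` (cball x e \<times> {a..b}))"
    by (intro compact_continuous_image continuous_on_subset[OF K'] compact_Times)
       (use e in auto)
  then obtain B where B: "\<And>p s. p \<in> cball x e \<Longrightarrow> s \<in> {a..b} \<Longrightarrow> \<bar>K' p s\<bar> \<le> B"
    using compact_imp_bounded by (force simp: bounded_iff)
  have lip: "\<bar>(K y s - K x s) / (y - x)\<bar> \<le> B" if "y \<in> cball x e" "y \<noteq> x" "s \<in> {a..b}" for y s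
  proof -
    have "norm (K y s - K x s) \<le> B * norm (y - x)"
    proof (rule field_differentiable_bound)
      show "convex (cball x e)" by simp
      show "((\<lambda>y. K y s) has_real_derivative K' z s) (at z within cball x e)" if "z \<in> cball x e" for z
        by (rule has_field_derivative_at_within) (use d[of z s] that e \<open>s \<in> _\<close> in blast)
      show "norm (K' z s) \<le> B" if "z \<in> cball x e" for z using B that \<open>s \<in> _\<close> by simp
    qed (use that e in auto)
    then show ?thesis using that by (simp add: abs_divide divide_simps)
  qed
  show ?thesis
    unfolding has_field_derivative_iff tendsto_at_iff_sequentially comp_def
  proof (intro allI impI, goal_cases)
    case (1 X)
    then have X: "\<And>n. X n \<noteq> x" "X \<longlonglongrightarrow> x" by auto
    from metric_LIMSEQ_D[OF X(2) e(1)] obtain N where N: "\<And>n. n \<ge> N \<Longrightarrow> dist (X n) x < e" by auto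
    define Y where "Y n = X (n + N)" for n
    have Y: "Y n \<noteq> x" "Y n \<in> cball x e" "Y n \<in> S" "Y \<longlonglongrightarrow> x" for n
      using X N[of "n + N"] e LIMSEQ_ignore_initial_segment[OF X(2), of N]
      by (auto simp: Y_def[abs_def] dist_commute subset_iff less_imp_le)
    have "(\<lambda>n. \<integral>s. (K (Y n) s - K x s) / (Y n - x) * w s \<partial>lborel) \<longlonglongrightarrow> (\<integral>s. K' x s * w s \<partial>lborel)"
    proof (rule integral_dominated_convergence[where w = "\<lambda>s. B * \<bar>w s\<bar>"])
      show "(\<lambda>s. K' x s * w s) \<in> borel_measurable lborel"
        by (rule borel_measurable_integrable, rule integrable_bounded_mult[OF w cont'])
      show "(\<lambda>s. (K (Y n) s - K x s) / (Y n - x) * w s) \<in> borel_measurable lborel" for n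
        by (rule borel_measurable_integrable, rule integrable_bounded_mult[OF w])
           (use Y S in \<open>auto intro!: continuous_intros K\<close>)
      show "integrable lborel (\<lambda>s. B * \<bar>w s\<bar>)" using w by auto
      show "AE s in lborel. norm ((K (Y n) s - K x s) / (Y n - x) * w s) \<le> B * \<bar>w s\<bar>" for n
      proof (rule AE_I2)
        fix s show "norm ((K (Y n) s - K x s) / (Y n - x) * w s) \<le> B * \<bar>w s\<bar>"
        proof (cases "s \<in> {a..b}")
          case True
          then show ?thesis
            unfolding real_norm_def abs_mult[of _ "w s"] by (intro mult_right_mono lip Y) auto
        qed (simp add: w)
      qed
      show "AE s in lborel. (\<lambda>n. (K (Y n) s - K x s) / (Y n - x) * w s) \<longlonglongrightarrow> K' x s * w s"
      proof (rule AE_I2)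
        fix s
        show "(\<lambda>n. (K (Y n) s - K x s) / (Y n - x) * w s) \<longlonglongrightarrow> K' x s * w s"
        proof (cases "s \<in> {a..b}")
          case True
          have "((\<lambda>y. (K y s - K x s) / (y - x)) \<longlongrightarrow> K' x s) (at x)"
            using d[OF S(2) True] by (simp add: has_field_derivative_iff)
          then have "(\<lambda>n. (K (Y n) s - K x s) / (Y n - x)) \<longlonglongrightarrow> K' x s"
            using Y unfolding tendsto_at_iff_sequentially comp_def by auto
          then show ?thesis by (intro tendsto_intros)
        qed (simp add: w)
      qed
    qed
    also have "(\<lambda>n. \<integral>s. (K (Y n) s - K x s) / (Y n - x) * w s \<partial>lborel) =
        (\<lambda>n. ((\<integral>s. K (Y n) s * w s \<partial>lborel) - (\<integral>s. K x s * w s \<partial>lborel)) / (Y n - x))"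
    proof
      fix n
      have "(\<integral>s. (K (Y n) s - K x s) / (Y n - x) * w s \<partial>lborel) =
          (\<integral>s. (K (Y n) s * w s - K x s * w s) / (Y n - x) \<partial>lborel)"
        by (rule Bochner_Integration.integral_cong) (auto simp: field_simps)
      also have "\<dots> = ((\<integral>s. K (Y n) s * w s \<partial>lborel) - (\<integral>s. K x s * w s \<partial>lborel)) / (Y n - x)"
        using int[OF Y(3)] int[OF S(2)] by simp
      finally show "(\<integral>s. (K (Y n) s - K x s) / (Y n - x) * w s \<partial>lborel) =
          ((\<integral>s. K (Y n) s * w s \<partial>lborel) - (\<integral>s. K x s * w s \<partial>lborel)) / (Y n - x)" .
    qed
    finally show ?case unfolding Y_def by (rule LIMSEQ_offset)
  qed
qed

text \<open>A function and its first two space derivatives travel as one family indexed by the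
  order, so each operation on solutions is treated once and carries the derivatives along. The
  derivatives are two-sided; the closed spatial interval is reached later, by continuity.\<close>

definition heat_on :: "(real \<times> real) set \<Rightarrow> (nat \<Rightarrow> real \<Rightarrow> real \<Rightarrow> real) \<Rightarrow> bool" where
  "heat_on D k \<longleftrightarrow>
     (\<forall>(t, x)\<in>D. (k 0 t has_real_derivative k 1 t x) (at x) \<and>
        (k 1 t has_real_derivative k 2 t x) (at x) \<and>
        ((\<lambda>s. k 0 s x) has_real_derivative k 2 t x / 2) (at t)) \<and>
     (\<forall>i\<le>2. continuous_on D (\<lambda>(t, x). k i t x))"

lemma heat_onD:
  assumes "heat_on D k" "(t, x) \<in> D"
  shows "(k 0 t has_real_derivative k 1 t x) (at x)"
    "(k 1 t has_real_derivative k 2 t x) (at x)"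
    "((\<lambda>s. k 0 s x) has_real_derivative k 2 t x / 2) (at t)"
  using assms by (auto simp: heat_on_def)

lemma heat_on_continuous: "heat_on D k \<Longrightarrow> i \<le> 2 \<Longrightarrow> continuous_on D (\<lambda>(t, x). k i t x)"
  by (auto simp: heat_on_def)

lemma heat_on_subset: "heat_on D k \<Longrightarrow> E \<subseteq> D \<Longrightarrow> heat_on E k"
  by (fastforce simp: heat_on_def intro: continuous_on_subset)

lemma heat_on_add:
  assumes "heat_on D k" "heat_on D l"
  shows "heat_on D (\<lambda>i t x. k i t x + l i t x)"
  unfolding heat_on_def
proof (intro conjI ballI allI impI)
  fix p assume p: "p \<in> D"
  obtain t x where [simp]: "p = (t, x)" by (cases p)
  show "case p of (t, x) \<Rightarrow>
        ((\<lambda>x. k 0 t x + l 0 t x) has_real_derivative k 1 t x + l 1 t x) (at x) \<and>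
        ((\<lambda>x. k 1 t x + l 1 t x) has_real_derivative k 2 t x + l 2 t x) (at x) \<and>
        ((\<lambda>s. k 0 s x + l 0 s x) has_real_derivative (k 2 t x + l 2 t x) / 2) (at t)"
    using heat_onD[OF assms(1), of t x] heat_onD[OF assms(2), of t x] p
    by (auto simp: add_divide_distrib intro!: DERIV_add)
next
  fix i :: nat assume "i \<le> 2"
  then show "continuous_on D (\<lambda>(t, x). k i t x + l i t x)"
    using heat_on_continuous[OF assms(1), of i] heat_on_continuous[OF assms(2), of i]
    unfolding case_prod_beta by (intro continuous_intros)
qed

lemma heat_on_cmult:
  assumes "heat_on D k"
  shows "heat_on D (\<lambda>i t x. c * k i t x)"
  unfolding heat_on_def
proof (intro conjI ballI allI impI)
  fix p assume p: "p \<in> D"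
  obtain t x where [simp]: "p = (t, x)" by (cases p)
  show "case p of (t, x) \<Rightarrow>
        ((\<lambda>x. c * k 0 t x) has_real_derivative c * k 1 t x) (at x) \<and>
        ((\<lambda>x. c * k 1 t x) has_real_derivative c * k 2 t x) (at x) \<and>
        ((\<lambda>s. c * k 0 s x) has_real_derivative (c * k 2 t x) / 2) (at t)"
    using heat_onD[OF assms(1), of t x] p DERIV_cmult[of "\<lambda>s. k 0 s x" "k 2 t x / 2" t UNIV c]
    by (auto intro!: DERIV_cmult)
next
  fix i :: nat assume "i \<le> 2"
  then show "continuous_on D (\<lambda>(t, x). c * k i t x)"
    using heat_on_continuous[OF assms(1), of i] unfolding case_prod_beta by (intro continuous_intros)
qed

lemma heat_on_shift:
  assumes "heat_on D k" "\<And>t x. (t, x) \<in> E \<Longrightarrow> (t - r, x + y) \<in> D"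
  shows "heat_on E (\<lambda>i t x. k i (t - r) (x + y))"
  unfolding heat_on_def
proof (intro conjI ballI allI impI)
  fix p assume p: "p \<in> E"
  obtain t x where [simp]: "p = (t, x)" by (cases p)
  note d = heat_onD[OF assms(1), of "t - r" "x + y"]
  show "case p of (t, x) \<Rightarrow>
        ((\<lambda>x. k 0 (t - r) (x + y)) has_real_derivative k 1 (t - r) (x + y)) (at x) \<and>
        ((\<lambda>x. k 1 (t - r) (x + y)) has_real_derivative k 2 (t - r) (x + y)) (at x) \<and>
        ((\<lambda>s. k 0 (s - r) (x + y)) has_real_derivative k 2 (t - r) (x + y) / 2) (at t)"
    using d assms(2)[of t x] p DERIV_shift[of "k 0 (t - r)" _ x y] DERIV_shift[of "k 1 (t - r)" _ x y]
      DERIV_shift[of "\<lambda>s. k 0 s (x + y)" _ t "- r"] by (auto simp: add.commute)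
next
  fix i :: nat assume "i \<le> 2"
  then show "continuous_on E (\<lambda>(t, x). k i (t - r) (x + y))"
    unfolding case_prod_beta
    by (intro continuous_on_compose2[OF heat_on_continuous[OF assms(1), of i], of E "\<lambda>p. (fst p - r, snd p
        + y)", simplified])
       (use assms(2) in \<open>auto intro!: continuous_intros\<close>)
qed

text \<open>Each space derivative picks up a factor -1 from the chain rule. This carries the
  construction at the left end over to the right end.\<close>

lemma heat_on_reflect:
  assumes "heat_on D k" "\<And>t x. (t, x) \<in> E \<Longrightarrow> (t, c - x) \<in> D"
  shows "heat_on E (\<lambda>i t x. (-1) ^ i * k i t (c - x))"
  unfolding heat_on_def
proof (intro conjI ballI allI impI)
  fix p assume p: "p \<in> E"
  obtain t x where [simp]: "p = (t, x)" by (cases p)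
  note d = heat_onD[OF assms(1), of "t" "c - x"]
  have l: "((\<lambda>x. c - x) has_real_derivative - 1) (at x)"
    by (auto intro!: derivative_eq_intros)
  show "case p of (t, x) \<Rightarrow>
        ((\<lambda>x. (-1) ^ 0 * k 0 t (c - x)) has_real_derivative (-1) ^ 1 * k 1 t (c - x)) (at x) \<and>
        ((\<lambda>x. (-1) ^ 1 * k 1 t (c - x)) has_real_derivative (-1) ^ 2 * k 2 t (c - x)) (at x) \<and>
        ((\<lambda>s. (-1) ^ 0 * k 0 s (c - x)) has_real_derivative (-1) ^ 2 * k 2 t (c - x) / 2) (at t)"
    using d assms(2)[of t x] p DERIV_chain2[OF _ l, of "k 0 t"] DERIV_minus[OF DERIV_chain2[OF _ l, of
        "k 1 t"]] by auto
next
  fix i :: nat assume "i \<le> 2"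
  then show "continuous_on E (\<lambda>(t, x). (-1) ^ i * k i t (c - x))"
    unfolding case_prod_beta
    by (intro continuous_on_mult continuous_on_const continuous_on_compose2[OF heat_on_continuous[OF assms(1),
        of i], of E "\<lambda>p. (fst p, c - snd p)", simplified])
       (use assms(2) in \<open>auto intro!: continuous_intros\<close>)
qed

text \<open>Differentiation under the integral along the slices of \<open>D\<close> with one
  variable frozen, which are open because \<open>D\<close> is. All irregularity sits in the weight
  \<open>w\<close>, so the same fact serves potentials of a datum (s is a space variable) and layers
  with a density (s is time).\<close>

lemma heat_on_integral:
  fixes a b :: real
  assumes D: "open D" and k: "\<And>s. s \<in> {a..b} \<Longrightarrow> heat_on D (k s)"
    and c: "\<And>i. i \<le> 2 \<Longrightarrow> continuous_on (D \<times> {a..b}) (\<lambda>(p, s). k s i (fst p) (snd p))"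
    and w: "integrable lborel w" "\<And>s. s \<notin> {a..b} \<Longrightarrow> w s = 0"
  shows "heat_on D (\<lambda>i t x. \<integral>s. k s i t x * w s \<partial>lborel)"
  unfolding heat_on_def
proof (intro conjI ballI allI impI)
  fix p assume p: "p \<in> D"
  obtain t x where [simp]: "p = (t, x)" by (cases p)
  define Sx where "Sx = {y. (t, y) \<in> D}"
  define St where "St = {s. (s, x) \<in> D}"
  have ox: "open Sx" unfolding Sx_def
    using open_vimage[OF D, of "\<lambda>y. (t, y)"] by (simp add: vimage_def continuous_on_Pair)
  have ot: "open St" unfolding St_def
    using open_vimage[OF D, of "\<lambda>y. (y, x)"] by (simp add: vimage_def continuous_on_Pair)
  have cx: "continuous_on (Sx \<times> {a..b}) (\<lambda>(y, s). k s i t y)" if "i \<le> 2" for i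
    unfolding case_prod_beta
    by (rule continuous_on_compose2[OF c[OF that], of _ "\<lambda>q. ((t, fst q), snd q)", simplified])
       (auto simp: Sx_def intro!: continuous_intros)
  have ct: "continuous_on (St \<times> {a..b}) (\<lambda>(y, s). k s i y x)" if "i \<le> 2" for i
    unfolding case_prod_beta
    by (rule continuous_on_compose2[OF c[OF that], of _ "\<lambda>q. ((fst q, x), snd q)", simplified])
       (auto simp: St_def intro!: continuous_intros)
  have cs: "continuous_on {a..b} (\<lambda>s. k s i u y)" if "i \<le> 2" "(u, y) \<in> D" for i u y
    by (rule continuous_on_compose2[OF c[OF that(1)], of _ "\<lambda>s. ((u, y), s)", simplified])
       (use that in \<open>auto intro!: continuous_intros\<close>)
  have "((\<lambda>y. \<integral>s. k s 0 t y * w s \<partial>lborel) has_real_derivative (\<integral>s. k s 1 t x * w s \<partial>lborel)) (at x)"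
    by (rule param_integral_has_derivative[where S = Sx and a = a and b = b])
       (use p cx[of 1] w in \<open>auto simp: Sx_def simp del: One_nat_def intro!: heat_onD(1)[OF k] cs ox[unfolded
           Sx_def]\<close>)
  moreover have "((\<lambda>y. \<integral>s. k s 1 t y * w s \<partial>lborel) has_real_derivative (\<integral>s. k s 2 t x * w s \<partial>lborel)) (at x)"
    by (rule param_integral_has_derivative[where S = Sx and a = a and b = b])
       (use p cx[of 2] w in \<open>auto simp: Sx_def simp del: One_nat_def intro!: heat_onD(2)[OF k] cs ox[unfolded
           Sx_def]\<close>)
  moreover have "((\<lambda>y. \<integral>s. k s 0 y x * w s \<partial>lborel) has_real_derivative (\<integral>s. (k s 2 t x / 2) * w s \<partial>lborel))
      (at t)"
  proof (rule param_integral_has_derivative[where S = St and a = a and b = b, OF ot])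
    have "continuous_on (St \<times> {a..b}) (\<lambda>q. (case q of (y, s) \<Rightarrow> k s 2 y x) / 2)"
      by (intro continuous_intros ct) auto
    then show "continuous_on (St \<times> {a..b}) (\<lambda>(y, s). k s 2 y x / 2)"
      by (simp add: case_prod_beta)
  qed (use p w in \<open>auto simp: St_def intro!: heat_onD(3)[OF k] cs\<close>)
  ultimately show "case p of (t, x) \<Rightarrow>
        ((\<lambda>y. \<integral>s. k s 0 t y * w s \<partial>lborel) has_real_derivative (\<integral>s. k s 1 t x * w s \<partial>lborel)) (at x) \<and>
        ((\<lambda>y. \<integral>s. k s 1 t y * w s \<partial>lborel) has_real_derivative (\<integral>s. k s 2 t x * w s \<partial>lborel)) (at x) \<and>
        ((\<lambda>u. \<integral>s. k s 0 u x * w s \<partial>lborel) has_real_derivative (\<integral>s. k s 2 t x * w s \<partial>lborel) / 2) (at t)"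
    by simp
next
  fix i :: nat assume i: "i \<le> 2"
  have "continuous_on D (\<lambda>p. \<integral>s. k s i (fst p) (snd p) * w s \<partial>lborel)"
    by (rule param_integral_continuous[OF c[OF i] w])
  then show "continuous_on D (\<lambda>(t, x). \<integral>s. k s i t x * w s \<partial>lborel)"
    by (simp add: case_prod_beta)
qed

section \<open>Gaussian kernels\<close>

text \<open>Kernels are indexed by the order of the space derivative; the index 1 must not become
  \<open>Suc 0\<close>.\<close>

declare One_nat_def [simp del]

fun hk :: "nat \<Rightarrow> real \<Rightarrow> real \<Rightarrow> real" where
  "hk 0 t x = (if t > 0 then exp (- x\<^sup>2 / (2 * t)) / sqrt (2 * pi * t) else 0)"
| "hk (Suc 0) t x = - (x / t) * hk 0 t x"
| "hk (Suc (Suc _)) t x = (x\<^sup>2 / t\<^sup>2 - 1 / t) * hk 0 t x"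

lemma hk_nonpos [simp]: "t \<le> 0 \<Longrightarrow> hk i t x = 0"
  by (cases "(i, t, x)" rule: hk.cases) auto

lemma hk_nonpos_fun: "t \<le> 0 \<Longrightarrow> hk i t = (\<lambda>_. 0)"
  by auto

lemma hk_1: "hk 1 t x = - (x / t) * hk 0 t x"
  and hk_2: "hk 2 t x = (x\<^sup>2 / t\<^sup>2 - 1 / t) * hk 0 t x"
  by (simp_all add: numeral_2_eq_2 One_nat_def)

declare hk.simps [simp del]
lemmas hk_0 = hk.simps(1)

lemma le_2_cases: "(i::nat) \<le> 2 \<Longrightarrow> (i = 0 \<Longrightarrow> P) \<Longrightarrow> (i = 1 \<Longrightarrow> P) \<Longrightarrow> (i = 2 \<Longrightarrow> P) \<Longrightarrow> P"
  by linarith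

lemma hk_nonneg: "0 \<le> hk 0 t x"
  by (simp add: hk_0)

lemma hk_minus: "i \<le> 2 \<Longrightarrow> hk i t (- x) = (- 1) ^ i * hk i t x"
  by (erule le_2_cases) (auto simp: hk_0 hk_1 hk_2)

lemma hk_antimono:
  assumes "\<bar>x\<bar> \<le> \<bar>y\<bar>"
  shows "hk 0 t y \<le> hk 0 t x"
proof -
  have "x\<^sup>2 \<le> y\<^sup>2" using assms abs_le_square_iff by blast
  then show ?thesis by (auto simp: hk_0 intro!: divide_right_mono)
qed

lemma hk_le: "t > 0 \<Longrightarrow> hk 0 t x \<le> 1 / sqrt (2 * pi * t)"
  by (auto simp: hk_0 intro!: divide_right_mono)

lemma hk_0_has_derivative_x: "(hk 0 t has_real_derivative hk 1 t x) (at x)"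
proof (cases "t > 0")
  case True
  have "((\<lambda>x. exp (- x\<^sup>2 / (2 * t)) / sqrt (2 * pi * t)) has_real_derivative hk 1 t x) (at x)"
    unfolding hk_1 hk_0 using True by (auto intro!: derivative_eq_intros simp: field_simps)
  moreover have "hk 0 t = (\<lambda>x. exp (- x\<^sup>2 / (2 * t)) / sqrt (2 * pi * t))" using True by (auto simp: hk_0)
  ultimately show ?thesis by simp
qed (simp add: hk_nonpos_fun)

lemma hk_1_has_derivative_x: "(hk 1 t has_real_derivative hk 2 t x) (at x)"
proof (cases "t > 0")
  case True
  have "hk 1 t = (\<lambda>x. - (x / t) * hk 0 t x)" by (auto simp: hk_1)
  moreover have "((\<lambda>x. - (x / t) * hk 0 t x) has_real_derivative hk 2 t x) (at x)"
    using True unfolding hk_2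
    by (auto intro!: derivative_eq_intros hk_0_has_derivative_x simp: hk_1 field_simps power2_eq_square)
  ultimately show ?thesis by simp
qed (simp add: hk_nonpos_fun)

lemma hk_0_has_derivative_t:
  assumes t: "t > 0"
  shows "((\<lambda>s. hk 0 s x) has_real_derivative hk 2 t x / 2) (at t)"
proof -
  define r where "r = sqrt (2 * pi * t)"
  have r: "r > 0" "pi = r * r / (2 * t)" using t by (simp_all add: r_def)
  have "((\<lambda>s. exp (- x\<^sup>2 / (2 * s)) / sqrt (2 * pi * s)) has_real_derivative
      (exp (- x\<^sup>2 / (2 * t)) * (x\<^sup>2 / (2 * t\<^sup>2)) * r - exp (- x\<^sup>2 / (2 * t)) * (pi / r)) / (r * r)) (at t)"
    unfolding r_def using t pi_gt_zero by (auto intro!: derivative_eq_intros simp: field_simps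
        power2_eq_square mult_less_0_iff)
  also have "(exp (- x\<^sup>2 / (2 * t)) * (x\<^sup>2 / (2 * t\<^sup>2)) * r - exp (- x\<^sup>2 / (2 * t)) * (pi / r)) / (r * r)
      = hk 2 t x / 2"
    unfolding hk_2 hk_0 r_def[symmetric] r(2) using t r(1) by (simp add: field_simps power2_eq_square)
  finally have "((\<lambda>s. exp (- x\<^sup>2 / (2 * s)) / sqrt (2 * pi * s)) has_real_derivative hk 2 t x / 2) (at t)" .
  then show ?thesis
    by (rule has_field_derivative_transform_within_open[of _ _ _ "{0<..}"]) (use t in \<open>auto simp: hk_0\<close>)
qed

lemma hk_continuous_pos: "i \<le> 2 \<Longrightarrow> continuous_on ({0<..} \<times> UNIV) (\<lambda>(t, x). hk i t x)"
proof -
  assume i: "i \<le> 2"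
  have 0: "continuous_on ({0<..} \<times> UNIV) (\<lambda>p. hk 0 (fst p) (snd p))"
  proof (rule continuous_on_eq)
    show "continuous_on ({0<..} \<times> UNIV) (\<lambda>p::real \<times> real. exp (- (snd p)\<^sup>2 / (2 * fst p)) / sqrt (2 * pi * fst
        p))"
      by (auto intro!: continuous_intros)
  qed (auto simp: hk_0)
  show ?thesis using i unfolding case_prod_beta
    by (elim le_2_cases) (auto simp: hk_1 hk_2 intro!: continuous_intros 0)
qed

lemma heat_on_hk: "heat_on ({0<..} \<times> UNIV) hk"
  unfolding heat_on_def using hk_continuous_pos
  by (auto intro: hk_0_has_derivative_x hk_1_has_derivative_x hk_0_has_derivative_t)

text \<open>With z = x^2 / (2 t), one term of the exponential series gives exp (- z) <= 4! / z^4 =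
  384 t^4 / x^8, and t <= sqrt (2 pi t) takes away one power of t. The remaining t^3 outweighs the
  factor x^2 / t^2 in \<open>hk 2\<close>.\<close>

lemma hk_le_power:
  assumes "t > 0" "t \<le> 1" "x \<noteq> 0"
  shows "hk 0 t x \<le> 384 / x ^ 8 * t ^ 3"
proof -
  define z where "z = x\<^sup>2 / (2 * t)"
  have z: "z > 0" using assms by (simp add: z_def)
  have "z ^ 4 / fact 4 \<le> exp z"
  proof -
    have "(\<Sum>n\<in>{4::nat}. inverse (fact n) * z ^ n) \<le> (\<Sum>n. inverse (fact n) * z ^ n)"
      by (rule sum_le_suminf) (use z summable_exp in \<open>auto intro!: summable_exp\<close>)
    then show ?thesis by (simp add: exp_def divide_inverse mult_ac)
  qed
  then have "exp (- z) \<le> fact 4 / z ^ 4"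
    using z by (simp add: exp_minus field_simps)
  also have "\<dots> = 384 / x ^ 8 * t ^ 4"
    using assms by (simp add: z_def field_simps fact_numeral flip: power_mult)
  finally have e: "exp (- x\<^sup>2 / (2 * t)) \<le> 384 / x ^ 8 * t ^ 4" by (simp add: z_def)
  have "t \<le> sqrt (2 * pi * t)"
  proof (rule real_le_rsqrt)
    have "t * t \<le> 1 * t" using assms by (intro mult_right_mono) auto
    also have "\<dots> \<le> (2 * pi) * t" using assms pi_gt3 by (intro mult_right_mono) auto
    finally show "t\<^sup>2 \<le> 2 * pi * t" by (simp add: power2_eq_square)
  qed
  then have "hk 0 t x \<le> (384 / x ^ 8 * t ^ 4) / t"
    unfolding hk_0 if_P[OF assms(1)] using assms e by (intro frac_le) auto
  then show ?thesis using assms by (simp add: field_simps power_eq_if)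
qed

text \<open>Time and space move together, so the power bound is used at the moving point.
  \<open>B\<close> adds up the bounds for the three orders, each a positive power of t with a
  coefficient continuous near x > 0, so that it serves every \<open>i\<close>.\<close>

lemma hk_tendsto_0:
  assumes x: "x > 0" and i: "i \<le> 2"
  shows "((\<lambda>(t, x). hk i t x) \<longlongrightarrow> 0) (at (0, x))"
proof -
  define B where "B p = (384 / snd p ^ 8) * \<bar>fst p\<bar> ^ 3 + (\<bar>snd p\<bar> * 384 / snd p ^ 8) * \<bar>fst p\<bar> ^ 2
      + ((snd p)\<^sup>2 * 384 / snd p ^ 8) * \<bar>fst p\<bar> + (384 / snd p ^ 8) * \<bar>fst p\<bar>\<^sup>2" for p :: "real \<times> real"
  have "(B \<longlongrightarrow> B (0, x)) (at (0, x))"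
    unfolding B_def using x by (auto intro!: tendsto_eq_intros)
  then have B0: "(B \<longlongrightarrow> 0) (at (0, x))" by (simp add: B_def)
  have bd: "norm (case p of (t, x) \<Rightarrow> hk i t x) \<le> B p" if "snd p > 0" "fst p < 1" for p
  proof (cases "fst p > 0")
    case True
    obtain t y where p: "p = (t, y)" by (cases p)
    have t: "0 < t" "t \<le> 1" "y > 0" using that True by (auto simp: p)
    note h = hk_le_power[of t y]
    have h0: "hk 0 t y \<le> 384 / y ^ 8 * t ^ 3" using h t by simp
    have h1: "\<bar>hk 1 t y\<bar> \<le> (y * 384 / y ^ 8) * t ^ 2"
    proof -
      have "\<bar>hk 1 t y\<bar> = (y / t) * hk 0 t y" using t hk_nonneg[of t y] by (simp add: hk_1 abs_mult)
      also have "\<dots> \<le> (y / t) * (384 / y ^ 8 * t ^ 3)" using t by (intro mult_left_mono h0) auto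
      also have "\<dots> = (y * 384 / y ^ 8) * t ^ 2" using t by (simp add: field_simps power_eq_if)
      finally show ?thesis .
    qed
    have h2: "\<bar>hk 2 t y\<bar> \<le> (y\<^sup>2 * 384 / y ^ 8) * t + (384 / y ^ 8) * t\<^sup>2"
    proof -
      have "\<bar>hk 2 t y\<bar> = \<bar>y\<^sup>2 / t\<^sup>2 - 1 / t\<bar> * hk 0 t y" using hk_nonneg[of t y] by (simp add: hk_2 abs_mult)
      also have "\<dots> \<le> (y\<^sup>2 / t\<^sup>2 + 1 / t) * hk 0 t y"
        by (intro mult_right_mono hk_nonneg abs_leI) (use t in auto)
      also have "\<dots> \<le> (y\<^sup>2 / t\<^sup>2 + 1 / t) * (384 / y ^ 8 * t ^ 3)" using t by (intro mult_left_mono h0) auto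
      also have "\<dots> = (y\<^sup>2 * 384 / y ^ 8) * t + (384 / y ^ 8) * t\<^sup>2" using t
          by (simp add: field_simps power_eq_if)
      finally show ?thesis .
    qed
    have nn: "0 \<le> 384 / y ^ 8 * t ^ 3" "0 \<le> (y * 384 / y ^ 8) * t ^ 2" "0 \<le> (y\<^sup>2 * 384 / y ^ 8) * t"
       "0 \<le> (384 / y ^ 8) * t\<^sup>2" using t by simp_all
    have Bp: "B p = 384 / y ^ 8 * t ^ 3 + (y * 384 / y ^ 8) * t ^ 2 + (y\<^sup>2 * 384 / y ^ 8) * t
        + (384 / y ^ 8) * t\<^sup>2"
      using t by (simp add: p B_def)
    show ?thesis using i
    proof (elim le_2_cases)
      assume "i = 0"
      then have "norm (case p of (t, x) \<Rightarrow> hk i t x) \<le> 384 / y ^ 8 * t ^ 3" using h0 hk_nonneg[of t y]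
          by (simp add: p)
      then show ?thesis unfolding Bp using nn by linarith
    next
      assume "i = 1"
      then have "norm (case p of (t, x) \<Rightarrow> hk i t x) \<le> (y * 384 / y ^ 8) * t ^ 2" using h1 by (simp add: p)
      then show ?thesis unfolding Bp using nn by linarith
    next
      assume "i = 2"
      then have "norm (case p of (t, x) \<Rightarrow> hk i t x) \<le> (y\<^sup>2 * 384 / y ^ 8) * t + (384 / y ^ 8) * t\<^sup>2" using h2
          by (simp add: p)
      then show ?thesis unfolding Bp using nn by linarith
    qed
  next
    case False
    have "0 \<le> B p" unfolding B_def using that by (intro add_nonneg_nonneg mult_nonneg_nonneg) auto
    then show ?thesis using False by (auto simp: case_prod_beta)
  qed
  have "open {p :: real \<times> real. snd p > 0 \<and> fst p < 1}"
    by (intro open_Collect_conj open_Collect_less continuous_intros)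
  then have "\<forall>\<^sub>F p in nhds (0, x). p \<in> {p :: real \<times> real. snd p > 0 \<and> fst p < 1}"
    by (intro eventually_nhds_in_open) (use x in auto)
  then have "\<forall>\<^sub>F p in at (0, x). p \<in> {p :: real \<times> real. snd p > 0 \<and> fst p < 1}"
    unfolding eventually_at_filter by eventually_elim auto
  then have ev: "\<forall>\<^sub>F p in at (0, x). norm (case p of (t, x) \<Rightarrow> hk i t x) \<le> B p"
    by (rule eventually_mono) (use bd in blast)
  show ?thesis by (rule Lim_null_comparison[OF ev B0])
qed

text \<open>All points except those with both t <= 0 and x <= 0. The kernels are extended by 0 to t
  <= 0 and stay regular across t = 0 as long as x > 0. Hence for x > 0 a time convolution can be
  differentiated under the integral sign through s = t.\<close>

definition kernel_dom :: "(real \<times> real) set" where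
  "kernel_dom = {0<..} \<times> UNIV \<union> UNIV \<times> {0<..}"

lemma continuous_on_kernel_dom:
  fixes k :: "real \<Rightarrow> real \<Rightarrow> real"
  assumes c: "continuous_on ({0<..} \<times> UNIV) (\<lambda>(t, x). k t x)"
    and z: "\<And>t x. t \<le> 0 \<Longrightarrow> k t x = 0"
    and l: "\<And>x. x > 0 \<Longrightarrow> ((\<lambda>(t, x). k t x) \<longlongrightarrow> 0) (at (0, x))"
  shows "continuous_on kernel_dom (\<lambda>(t, x). k t x)"
proof (rule continuous_at_imp_continuous_on, rule ballI)
  fix p assume p: "p \<in> kernel_dom"
  obtain t x where [simp]: "p = (t, x)" by (cases p)
  consider "t > 0" | "t = 0" "x > 0" | "t < 0" using p by (fastforce simp: kernel_dom_def)
  then show "isCont (\<lambda>(t, x). k t x) p"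
  proof cases
    case 1
    have "open ({0::real<..} \<times> (UNIV :: real set))" by (intro open_Times) auto
    then show ?thesis using c 1 continuous_on_eq_continuous_at by fastforce
  next
    case 2
    then show ?thesis using l[of x] z by (simp add: isCont_def)
  next
    case 3
    have "open ({..<0::real} \<times> (UNIV :: real set))" by (intro open_Times) auto
    moreover have "continuous_on ({..<0::real} \<times> (UNIV :: real set)) (\<lambda>(t, x). k t x)"
      by (rule continuous_on_eq[where f = "\<lambda>_. 0"]) (auto simp: z)
    ultimately show ?thesis using 3 continuous_on_eq_continuous_at by fastforce
  qed
qed

lemma hk_continuous: "i \<le> 2 \<Longrightarrow> continuous_on kernel_dom (\<lambda>(t, x). hk i t x)"
  by (rule continuous_on_kernel_dom) (auto intro: hk_continuous_pos hk_tendsto_0)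

text \<open>
  \<open>bk \<sigma> 0 t x = 2 \<integral> exp (2 \<sigma> z) hk 0 t (x + z) dz\<close> over \<open>z \<ge> 0\<close>: it solves the heat equation, starts from the
  indicator of 0 on the half line, and satisfies \<open>(bk \<sigma>)'' / 2 + \<sigma> (bk \<sigma>)' = - hk'\<close>.
\<close>

fun bk :: "real \<Rightarrow> nat \<Rightarrow> real \<Rightarrow> real \<Rightarrow> real" where
  "bk \<sigma> 0 t x = (if t > 0 then 2 * exp (2 * \<sigma>\<^sup>2 * t - 2 * \<sigma> * x) * normal_tail ((x
      - 2 * \<sigma> * t) / sqrt t) else 0)"
| "bk \<sigma> (Suc 0) t x = - 2 * \<sigma> * bk \<sigma> 0 t x - 2 * hk 0 t x"
| "bk \<sigma> (Suc (Suc _)) t x = 4 * \<sigma>\<^sup>2 * bk \<sigma> 0 t x + 4 * \<sigma> * hk 0 t x - 2 * hk 1 t x"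

lemma bk_nonpos [simp]: "t \<le> 0 \<Longrightarrow> bk \<sigma> i t x = 0"
  by (cases "(\<sigma>, i, t, x)" rule: bk.cases) auto

lemma bk_nonpos_fun: "t \<le> 0 \<Longrightarrow> bk \<sigma> i t = (\<lambda>_. 0)"
  by auto

lemma bk_1: "bk \<sigma> 1 t x = - 2 * \<sigma> * bk \<sigma> 0 t x - 2 * hk 0 t x"
  and bk_2: "bk \<sigma> 2 t x = 4 * \<sigma>\<^sup>2 * bk \<sigma> 0 t x + 4 * \<sigma> * hk 0 t x - 2 * hk 1 t x"
  by (simp_all add: numeral_2_eq_2 One_nat_def)

declare bk.simps [simp del]
lemmas bk_0 = bk.simps(1)

text \<open>Completing the square. It turns the derivative of \<open>normal_tail\<close> inside
  \<open>bk\<close> into the Gaussian \<open>hk 0\<close>.\<close>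

lemma exp_times_std_normal_density:
  assumes "t > 0"
  shows "exp (2 * \<sigma>\<^sup>2 * t - 2 * \<sigma> * x) * std_normal_density ((x - 2 * \<sigma> * t) / sqrt t) = sqrt t * hk 0 t x"
proof -
  have "2 * \<sigma>\<^sup>2 * t - 2 * \<sigma> * x - ((x - 2 * \<sigma> * t) / sqrt t)\<^sup>2 / 2 = - x\<^sup>2 / (2 * t)"
    using assms by (simp add: power_divide field_simps power2_eq_square)
  then show ?thesis using assms
    by (simp add: hk_0 std_normal_density_def real_sqrt_mult flip: exp_add)
qed

lemma bk_0_has_derivative_x: "(bk \<sigma> 0 t has_real_derivative bk \<sigma> 1 t x) (at x)"
proof (cases "t > 0")
  case True
  let ?E = "exp (2 * \<sigma>\<^sup>2 * t - 2 * \<sigma> * x)" and ?z = "(x - 2 * \<sigma> * t) / sqrt t"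
  have "((\<lambda>x. 2 * exp (2 * \<sigma>\<^sup>2 * t - 2 * \<sigma> * x) * normal_tail ((x - 2 * \<sigma> * t) / sqrt t))
      has_real_derivative (- 2 * \<sigma> * (2 * ?E * normal_tail ?z) - 2 * (?E * std_normal_density ?z) / sqrt t))
          (at x)"
    using True
    by (auto intro!: derivative_eq_intros DERIV_chain2[OF has_real_derivative_normal_tail] simp: field_simps)
  then show ?thesis unfolding exp_times_std_normal_density[OF True]
    using True by (simp add: bk_1 bk_0[abs_def])
qed (simp add: bk_nonpos_fun)

lemma bk_1_has_derivative_x: "(bk \<sigma> 1 t has_real_derivative bk \<sigma> 2 t x) (at x)"
proof -
  have "bk \<sigma> 1 t = (\<lambda>x. - 2 * \<sigma> * bk \<sigma> 0 t x - 2 * hk 0 t x)" by (auto simp: bk_1)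
  moreover have "((\<lambda>x. - 2 * \<sigma> * bk \<sigma> 0 t x - 2 * hk 0 t x) has_real_derivative bk \<sigma> 2 t x) (at x)"
    unfolding bk_2
    by (auto intro!: derivative_eq_intros hk_0_has_derivative_x bk_0_has_derivative_x
        simp: bk_1 algebra_simps power2_eq_square)
  ultimately show ?thesis by simp
qed

lemma bk_0_has_derivative_t_pos:
  assumes t: "t > 0"
  shows "((\<lambda>s. bk \<sigma> 0 s x) has_real_derivative bk \<sigma> 2 t x / 2) (at t)"
proof -
  let ?E = "exp (2 * \<sigma>\<^sup>2 * t - 2 * \<sigma> * x)" and ?z = "(x - 2 * \<sigma> * t) / sqrt t"
  have z: "((\<lambda>s. (x - 2 * \<sigma> * s) / sqrt s) has_real_derivative (- x / (2 * t) - \<sigma>) / sqrt t) (at t)"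
    using t by (auto intro!: derivative_eq_intros simp: field_simps)
  have "((\<lambda>s. 2 * exp (2 * \<sigma>\<^sup>2 * s - 2 * \<sigma> * x) * normal_tail ((x - 2 * \<sigma> * s) / sqrt s))
      has_real_derivative (2 * \<sigma>\<^sup>2 * (2 * ?E * normal_tail ?z)
         + 2 * (?E * std_normal_density ?z) * ((x / (2 * t) + \<sigma>) / sqrt t))) (at t)"
    by (rule DERIV_cong[OF DERIV_mult[OF _ DERIV_chain2[OF has_real_derivative_normal_tail z]]])
       (auto intro!: derivative_eq_intros simp: algebra_simps add_divide_distrib diff_divide_distrib)
  also have "(2 * \<sigma>\<^sup>2 * (2 * ?E * normal_tail ?z) + 2 * (?E * std_normal_density ?z) * ((x / (2 * t)
      + \<sigma>) / sqrt t))
      = bk \<sigma> 2 t x / 2"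
    unfolding exp_times_std_normal_density[OF t] bk_2 hk_1 bk_0
    using t by (simp add: field_simps)
  finally have "((\<lambda>s. 2 * exp (2 * \<sigma>\<^sup>2 * s - 2 * \<sigma> * x) * normal_tail ((x - 2 * \<sigma> * s) / sqrt s))
      has_real_derivative bk \<sigma> 2 t x / 2) (at t)" .
  then show ?thesis
    by (rule has_field_derivative_transform_within_open[of _ _ _ "{0<..}"]) (use t in \<open>auto simp: hk_0 bk_0\<close>)
qed

lemma bk_continuous_pos: "i \<le> 2 \<Longrightarrow> continuous_on ({0<..} \<times> UNIV) (\<lambda>(t, x). bk \<sigma> i t x)"
proof -
  assume i: "i \<le> 2"
  have 0: "continuous_on ({0<..} \<times> UNIV) (\<lambda>p. bk \<sigma> 0 (fst p) (snd p))"
  proof (rule continuous_on_eq)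
    show "continuous_on ({0<..} \<times> UNIV) (\<lambda>p::real \<times> real. 2 * exp (2 * \<sigma>\<^sup>2 * fst p - 2 * \<sigma> * snd p)
        * normal_tail ((snd p - 2 * \<sigma> * fst p) / sqrt (fst p)))"
      by (auto intro!: continuous_intros)
  qed (auto simp: bk_0)
  have h: "continuous_on ({0<..} \<times> UNIV) (\<lambda>p. hk i (fst p) (snd p))" if "i \<le> 2" for i
    using hk_continuous_pos[OF that] by (simp add: case_prod_beta)
  show ?thesis using i unfolding case_prod_beta
    by (elim le_2_cases) (auto simp: bk_1 bk_2 intro!: continuous_intros 0 h)
qed

text \<open>From the side t > 0 the argument of \<open>normal_tail\<close> tends to infinity,
  because x > 0, while the exponential factor converges. From the side t <= 0 the kernel is 0. The
  two partial limits are glued.\<close>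

lemma bk_0_tendsto_0:
  assumes x: "x > 0"
  shows "((\<lambda>(t, x). bk \<sigma> 0 t x) \<longlongrightarrow> 0) (at (0, x))"
proof -
  let ?W = "{p :: real \<times> real. fst p > 0}"
  have "((\<lambda>p. 2 * exp (2 * \<sigma>\<^sup>2 * fst p - 2 * \<sigma> * snd p)
        * normal_tail ((snd p - 2 * \<sigma> * fst p) / sqrt (fst p))) \<longlongrightarrow> 2 * exp (2 * \<sigma>\<^sup>2 * 0 - 2 * \<sigma> * x) * 0)
        (at (0, x) within ?W)"
  proof (intro tendsto_mult tendsto_const)
    show "((\<lambda>p. exp (2 * \<sigma>\<^sup>2 * fst p - 2 * \<sigma> * snd p)) \<longlongrightarrow> exp (2 * \<sigma>\<^sup>2 * 0 - 2 * \<sigma> * x)) (at (0, x) within ?W)"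
      by (auto intro!: tendsto_eq_intros)
    have a: "filterlim (\<lambda>p::real \<times> real. sqrt (fst p)) (at_right 0) (at (0, x) within ?W)"
      unfolding filterlim_at
    proof
      show "((\<lambda>p::real \<times> real. sqrt (fst p)) \<longlongrightarrow> 0) (at (0, x) within ?W)"
        by (auto intro!: tendsto_eq_intros)
    qed (auto simp: eventually_at_filter)
    have "filterlim (\<lambda>p::real \<times> real. (snd p - 2 * \<sigma> * fst p) / sqrt (fst p)) at_top (at (0, x) within ?W)"
      unfolding divide_inverse
    proof (rule filterlim_tendsto_pos_mult_at_top[where c = x])
      show "((\<lambda>p. snd p - 2 * \<sigma> * fst p) \<longlongrightarrow> x) (at (0, x) within ?W)"
        by (auto intro!: tendsto_eq_intros)
      show "filterlim (\<lambda>p::real \<times> real. inverse (sqrt (fst p))) at_top (at (0, x) within ?W)"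
        by (rule filterlim_compose[OF filterlim_inverse_at_top_right a])
    qed (rule x)
    then show "((\<lambda>p. normal_tail ((snd p - 2 * \<sigma> * fst p) / sqrt (fst p))) \<longlongrightarrow> 0) (at (0, x) within ?W)"
      by (rule filterlim_compose[OF tendsto_normal_tail_at_top])
  qed
  then have "((\<lambda>(t, x). bk \<sigma> 0 t x) \<longlongrightarrow> 2 * exp (2 * \<sigma>\<^sup>2 * 0 - 2 * \<sigma> * x) * 0) (at (0, x) within ?W)"
    by (rule Lim_transform_eventually) (auto simp: bk_0 eventually_at_filter case_prod_beta intro!:
        always_eventually)
  then have "((\<lambda>(t, x). bk \<sigma> 0 t x) \<longlongrightarrow> 0) (at (0, x) within ?W)" by simp
  moreover have "((\<lambda>(t, x). bk \<sigma> 0 t x) \<longlongrightarrow> 0) (at (0, x) within - ?W)"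
    by (rule tendsto_eventually) (auto simp: eventually_at_filter intro!: always_eventually)
  ultimately have "((\<lambda>(t, x). bk \<sigma> 0 t x) \<longlongrightarrow> 0) (at (0, x) within (?W \<union> - ?W))"
    unfolding at_within_union by (rule filterlim_sup)
  then show ?thesis by simp
qed

lemma bk_continuous:
  assumes "i \<le> 2"
  shows "continuous_on kernel_dom (\<lambda>(t, x). bk \<sigma> i t x)"
proof -
  have 0: "continuous_on kernel_dom (\<lambda>p. bk \<sigma> 0 (fst p) (snd p))"
    using continuous_on_kernel_dom[of "bk \<sigma> 0"] bk_continuous_pos[of 0] bk_0_tendsto_0
    by (simp add: case_prod_beta)
  have h: "continuous_on kernel_dom (\<lambda>p. hk i (fst p) (snd p))" if "i \<le> 2" for i
    using hk_continuous[OF that] by (simp add: case_prod_beta)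
  show ?thesis using assms unfolding case_prod_beta
    by (elim le_2_cases) (auto simp: bk_1 bk_2 intro!: continuous_intros 0 h)
qed

text \<open>The mean value theorem writes each right difference quotient as a value of
  \<open>f'\<close> at an intermediate point, and these values tend to 0; the left difference
  quotients are 0.\<close>

lemma DERIV_0_from_right:
  fixes f f' :: "real \<Rightarrow> real"
  assumes z: "\<And>t. t \<le> 0 \<Longrightarrow> f t = 0" and c: "isCont f 0" and c': "isCont f' 0" "f' 0 = 0"
    and d: "\<And>t. t > 0 \<Longrightarrow> (f has_real_derivative f' t) (at t)"
  shows "(f has_real_derivative 0) (at 0)"
  unfolding has_field_derivative_iff
proof (rule LIM_I)
  fix r :: real assume r: "r > 0"
  from LIM_D[OF c'(1)[unfolded isCont_def] r] obtain s where s: "s > 0" "\<And>x. x \<noteq> 0 \<Longrightarrow> \<bar>x\<bar> < s \<Longrightarrow> \<bar>f' x\<bar> < r"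
    using c'(2) by auto
  show "\<exists>s>0. \<forall>x. x \<noteq> 0 \<and> norm (x - 0) < s \<longrightarrow> norm ((f x - f 0) / (x - 0) - 0) < r"
  proof (intro exI[of _ s] conjI allI impI s(1))
    fix x :: real assume x: "x \<noteq> 0 \<and> norm (x - 0) < s"
    show "norm ((f x - f 0) / (x - 0) - 0) < r"
    proof (cases "x > 0")
      case True
      have "continuous_on {0..x} f"
        by (rule continuous_at_imp_continuous_on) (use DERIV_isCont[OF d] c in \<open>force simp: order_le_less\<close>)
      from MVT[OF True this] obtain l y where y: "0 < y" "y < x" "(f has_real_derivative l) (at y)" "f x - f 0
          = (x - 0) * l"
        using d by (auto simp: real_differentiable_def)
      then have "l = f' y" using d DERIV_unique by blast
      then show ?thesis using s(2)[of y] x y True by simp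
    next
      case False
      then show ?thesis using z x r by simp
    qed
  qed
qed

text \<open>The delicate points are t = 0 with x > 0, where the extension by 0 must be
  differentiable in time: the second space derivative is continuous there with value 0, so
  \<open>DERIV_0_from_right\<close> applies.\<close>

lemma heat_on_bk: "heat_on kernel_dom (bk \<sigma>)"
  unfolding heat_on_def
proof (intro conjI ballI allI impI)
  fix p assume p: "p \<in> kernel_dom"
  obtain t x where px [simp]: "p = (t, x)" by (cases p)
  have "((\<lambda>s. bk \<sigma> 0 s x) has_real_derivative bk \<sigma> 2 t x / 2) (at t)"
  proof -
    consider "t > 0" | "t = 0" "x > 0" | "t < 0" using p by (fastforce simp: kernel_dom_def)
    then show ?thesis
    proof cases
      case 1 then show ?thesis by (rule bk_0_has_derivative_t_pos)
    next
      case 2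
      have c: "isCont (\<lambda>s. bk \<sigma> i s x) 0" if "i \<le> 2" for i
      proof -
        have "continuous_on UNIV (\<lambda>s. bk \<sigma> i s x)"
          by (rule continuous_on_compose2[OF bk_continuous[OF that], of _ "\<lambda>s. (s, x)", simplified])
             (use 2 in \<open>auto simp: kernel_dom_def intro!: continuous_intros\<close>)
        then show ?thesis by (simp add: continuous_on_eq_continuous_at)
      qed
      have c2: "isCont (\<lambda>s. bk \<sigma> 2 s x / 2) 0" using c[of 2] by (intro continuous_intros) auto
      have "((\<lambda>s. bk \<sigma> 0 s x) has_real_derivative 0) (at 0)"
        by (rule DERIV_0_from_right[OF _ c c2]) (auto intro: bk_0_has_derivative_t_pos)
      then show ?thesis using 2 by simp
    next
      case 3
      have "((\<lambda>s. 0) has_real_derivative 0) (at t)" by simp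
      then have "((\<lambda>s. bk \<sigma> 0 s x) has_real_derivative 0) (at t)"
        by (rule has_field_derivative_transform_within_open[of _ _ _ "{..<0}"]) (use 3 in auto)
      then show ?thesis using 3 by simp
    qed
  qed
  then show "case p of (t, x) \<Rightarrow> (bk \<sigma> 0 t has_real_derivative bk \<sigma> 1 t x) (at x) \<and>
        (bk \<sigma> 1 t has_real_derivative bk \<sigma> 2 t x) (at x) \<and>
        ((\<lambda>s. bk \<sigma> 0 s x) has_real_derivative bk \<sigma> 2 t x / 2) (at t)"
    by (auto intro: bk_0_has_derivative_x bk_1_has_derivative_x)
qed (rule bk_continuous)

section \<open>Layer potentials\<close>

lemma heat_on_cong_open:
  assumes k: "heat_on D k" and D: "open D"
    and eq: "\<And>i t x. i \<le> 2 \<Longrightarrow> (t, x) \<in> D \<Longrightarrow> l i t x = k i t x"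
  shows "heat_on D l"
  unfolding heat_on_def
proof (intro conjI ballI allI impI)
  fix p assume p: "p \<in> D"
  obtain t x where px [simp]: "p = (t, x)" by (cases p)
  have ox: "open {y. (t, y) \<in> D}"
    using open_vimage[OF D, of "\<lambda>y. (t, y)"] by (simp add: vimage_def continuous_on_Pair)
  have ot: "open {s. (s, x) \<in> D}"
    using open_vimage[OF D, of "\<lambda>y. (y, x)"] by (simp add: vimage_def continuous_on_Pair)
  note d = heat_onD[OF k, of t x]
  have "(l 0 t has_real_derivative l 1 t x) (at x)" "(l 1 t has_real_derivative l 2 t x) (at x)"
    "((\<lambda>s. l 0 s x) has_real_derivative l 2 t x / 2) (at t)"
    using has_field_derivative_transform_within_open[OF d(1) ox, of "l 0 t"]
      has_field_derivative_transform_within_open[OF d(2) ox, of "l 1 t"]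
      has_field_derivative_transform_within_open[OF d(3) ot, of "\<lambda>s. l 0 s x"] p eq
    by auto
  then show "case p of (t, x) \<Rightarrow> (l 0 t has_real_derivative l 1 t x) (at x) \<and>
        (l 1 t has_real_derivative l 2 t x) (at x) \<and>
        ((\<lambda>s. l 0 s x) has_real_derivative l 2 t x / 2) (at t)" by simp
next
  fix i :: nat assume i: "i \<le> 2"
  show "continuous_on D (\<lambda>(t, x). l i t x)"
    by (rule continuous_on_eq[OF heat_on_continuous[OF k i]]) (use eq[OF i] in auto)
qed

text \<open>Lets the range of integration be chosen separately near each point: a layer is an
  integral over a time window that must exceed the time at which it is evaluated.\<close>

lemma heat_on_local:
  assumes "\<And>p. p \<in> D \<Longrightarrow> \<exists>E. open E \<and> p \<in> E \<and> heat_on E k"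
  shows "heat_on D k"
  unfolding heat_on_def
proof (intro conjI ballI allI impI)
  fix p assume p: "p \<in> D"
  then obtain E where E: "p \<in> E" "heat_on E k" using assms by blast
  obtain t x where px [simp]: "p = (t, x)" by (cases p)
  show "case p of (t, x) \<Rightarrow> (k 0 t has_real_derivative k 1 t x) (at x) \<and>
        (k 1 t has_real_derivative k 2 t x) (at x) \<and>
        ((\<lambda>s. k 0 s x) has_real_derivative k 2 t x / 2) (at t)"
    using heat_onD[OF E(2), of t x] E(1) by simp
next
  fix i :: nat assume i: "i \<le> 2"
  show "continuous_on D (\<lambda>(t, x). k i t x)"
    by (rule continuous_at_imp_continuous_on)
       (use assms heat_on_continuous[OF _ i] in \<open>meson continuous_on_eq_continuous_at\<close>)
qed

text \<open>A density may have a nonzero limit at time 0+, so continuity is asked on positive times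
  and boundedness up to each \<open>T\<close> takes its place at 0. The value 0 for s <= 0 lets
  convolutions run over the whole line. The target is a general normed space because the system for
  the two ends is solved for pairs.\<close>

definition admissible :: "(real \<Rightarrow> 'a::real_normed_vector) \<Rightarrow> bool" where
  "admissible \<psi> \<longleftrightarrow> (\<forall>s\<le>0. \<psi> s = 0) \<and> continuous_on {0<..} \<psi> \<and> (\<forall>T. \<exists>B. \<forall>s\<le>T. norm (\<psi> s) \<le> B)"

lemma admissible_nonpos: "admissible \<psi> \<Longrightarrow> s \<le> 0 \<Longrightarrow> \<psi> s = 0"
  and admissible_continuous: "admissible \<psi> \<Longrightarrow> continuous_on {0<..} \<psi>"
  by (auto simp: admissible_def)

lemma admissible_bound:
  assumes "admissible \<psi>"
  obtains B where "B \<ge> 0" "\<And>s. s \<le> T \<Longrightarrow> norm (\<psi> s) \<le> B"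
proof -
  obtain B where "\<forall>s\<le>T. norm (\<psi> s) \<le> B" using assms unfolding admissible_def by blast
  moreover from this have "B \<ge> 0" by (meson norm_ge_zero order_trans order_refl)
  ultimately show ?thesis using that by blast
qed

lemma admissible_measurable:
  fixes \<psi> :: "real \<Rightarrow> real"
  assumes "admissible \<psi>"
  shows "\<psi> \<in> borel_measurable borel"
proof -
  have "(\<lambda>s. indicator {0<..} s *\<^sub>R \<psi> s) \<in> borel_measurable borel"
    by (rule borel_measurable_continuous_on_indicator) (auto intro: admissible_continuous assms)
  also have "(\<lambda>s. indicator {0<..} s *\<^sub>R \<psi> s) = \<psi>"
    using admissible_nonpos[OF assms] by (auto simp: indicator_def fun_eq_iff)
  finally show ?thesis .
qed

lemma integrable_bounded_Icc:
  fixes f :: "real \<Rightarrow> real"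
  assumes "f \<in> borel_measurable borel" "\<And>s. s \<in> {a..b} \<Longrightarrow> \<bar>f s\<bar> \<le> B"
  shows "integrable lborel (\<lambda>s. f s * indicator {a..b} s)"
proof (rule Bochner_Integration.integrable_bound)
  show "integrable lborel (\<lambda>s. B * indicator {a..b} s :: real)"
    by (intro integrable_mult_right integrable_real_indicator) (auto simp: emeasure_lborel_Icc_eq)
  show "AE s in lborel. norm (f s * indicator {a..b} s) \<le> norm (B * indicator {a..b} s)"
    using assms(2) by (intro AE_I2) (force simp: indicator_def)
qed (use assms(1) in measurable)

lemma integrable_admissible_Icc:
  fixes \<psi> :: "real \<Rightarrow> real"
  assumes "admissible \<psi>"
  shows "integrable lborel (\<lambda>s. \<psi> s * indicator {a..b} s)"
proof -
  obtain B where "\<And>s. s \<le> b \<Longrightarrow> norm (\<psi> s) \<le> B" using admissible_bound[OF assms] by metis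
  then show ?thesis by (intro integrable_bounded_Icc[of _ _ _ B]) (use assms admissible_measurable in auto)
qed

lemma norm_integral_le_AE:
  fixes f :: "'a \<Rightarrow> 'b::{banach, second_countable_topology}"
  assumes g: "integrable M g" and le: "AE x in M. norm (f x) \<le> g x"
  shows "norm (integral\<^sup>L M f) \<le> integral\<^sup>L M g"
proof (cases "integrable M f")
  case True
  have "norm (integral\<^sup>L M f) \<le> (\<integral>x. norm (f x) \<partial>M)" by (rule integral_norm_bound)
  also have "\<dots> \<le> integral\<^sup>L M g"
    by (rule integral_mono_AE[OF integrable_norm[OF True] g le])
  finally show ?thesis .
next
  \<comment> \<open>A function that is not integrable has Bochner integral 0, so it remains to see
    that the majorant has a nonnegative integral.\<close>
  case False
  have "0 \<le> integral\<^sup>L M g"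
    by (rule integral_nonneg_AE) (use le in \<open>eventually_elim, metis norm_ge_zero order_trans\<close>)
  then show ?thesis using False by (simp add: not_integrable_integral_eq)
qed

section \<open>Convolution of a kernel with a density in time\<close>

definition time_conv :: "(real \<Rightarrow> real \<Rightarrow> real) \<Rightarrow> (real \<Rightarrow> real) \<Rightarrow> real \<Rightarrow> real \<Rightarrow> real" where
  "time_conv k \<psi> t x = (\<integral>s. k (t - s) x * \<psi> s \<partial>lborel)"

lemma time_conv_flip: "time_conv k \<psi> t x = (\<integral>r. k r x * \<psi> (t - r) \<partial>lborel)"
  unfolding time_conv_def
  using lborel_integral_real_affine[of "-1" "\<lambda>s. k (t - s) x * \<psi> s" t] by simp

lemma heat_on_time_conv_bk:
  assumes "admissible \<psi>"
  shows "heat_on (UNIV \<times> {0<..}) (\<lambda>i. time_conv (bk \<sigma> i) \<psi>)"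
proof (rule heat_on_local)
  fix p :: "real \<times> real" assume p: "p \<in> UNIV \<times> {0<..}"
  \<comment> \<open>For times below \<open>T\<close> only the density on \<open>{0..T}\<close>
    matters: it vanishes before 0, and the kernel vanishes for s > t. The cut makes the weight
    integrable.\<close>
  define T where "T = fst p + 1"
  define D where "D = {..<T} \<times> {0::real<..}"
  have D: "open D" "p \<in> D" using p by (auto simp: D_def T_def mem_Times_iff intro!: open_Times)
  have "heat_on D (\<lambda>i t x. \<integral>s. bk \<sigma> i (t - s) x * (\<psi> s * indicator {0..T} s) \<partial>lborel)"
  proof (rule heat_on_integral[OF D(1)])
    show "heat_on D (\<lambda>i t x. bk \<sigma> i (t - s) x)" for s
      using heat_on_shift[OF heat_on_bk, of D s 0 \<sigma>] by (auto simp: kernel_dom_def D_def)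
    show "continuous_on (D \<times> {0..T}) (\<lambda>(p, s). bk \<sigma> i (fst p - s) (snd p))" if "i \<le> 2" for i
      unfolding case_prod_beta
      by (rule continuous_on_compose2[OF bk_continuous[OF that], of _ "\<lambda>q. (fst (fst q)
          - snd q, snd (fst q))", simplified])
         (auto simp: kernel_dom_def D_def intro!: continuous_intros)
  qed (auto intro: integrable_admissible_Icc assms)
  then have "heat_on D (\<lambda>i. time_conv (bk \<sigma> i) \<psi>)"
  proof (rule heat_on_cong_open[OF _ D(1)])
    fix i :: nat and t x assume "(t, x) \<in> D"
    then show "time_conv (bk \<sigma> i) \<psi> t x = (\<integral>s. bk \<sigma> i (t - s) x * (\<psi> s * indicator {0..T} s) \<partial>lborel)"
      unfolding time_conv_def
      by (intro Bochner_Integration.integral_cong)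
         (auto simp: indicator_def D_def not_le intro: admissible_nonpos[OF assms] bk_nonpos)
  qed
  with D show "\<exists>E. open E \<and> p \<in> E \<and> heat_on E (\<lambda>i. time_conv (bk \<sigma> i) \<psi>)" by blast
qed

text \<open>This is the order of \<open>hk 0\<close> at x = 0 as r tends to 0. It is integrable in
  time, so the layer and its first derivative are continuous up to the boundary and only the second
  derivative jumps.\<close>

lemma integrable_inverse_sqrt: "integrable lborel (\<lambda>r::real. indicator {0<..T} r / sqrt r)"
proof (cases "T \<ge> 0")
  case True
  have "(\<lambda>x. x powr (- 1 / 2)) integrable_on {0<..T}"
    by (rule integrable_on_powr_from_0') (use True in auto)
  then have "(\<lambda>x. x powr (- 1 / 2)) absolutely_integrable_on {0<..T}"
    by (rule nonnegative_absolutely_integrable_1) simp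
  \<comment> \<open>Absolute gauge integrability is integrability for the completed measure; Borel
    measurability brings it back to \<open>lborel\<close>.\<close>
  then have 1: "integrable lebesgue (\<lambda>x. indicator {0<..T} x *\<^sub>R x powr (- 1 / 2))"
    unfolding set_integrable_def .
  have "(\<lambda>x::real. indicator {0<..T} x *\<^sub>R x powr (- 1 / 2)) \<in> borel_measurable lborel"
    by (intro borel_measurable_scaleR borel_measurable_indicator powr_real_measurable) auto
  from iffD1[OF integrable_completion[OF this] 1]
  have "integrable lborel (\<lambda>x. indicator {0<..T} x *\<^sub>R x powr (- 1 / 2))" .
  moreover have "indicator {0<..T} x *\<^sub>R x powr (- 1 / 2) = indicator {0<..T} x / sqrt x" for x :: real
  proof (cases "x \<in> {0<..T}")
    case True
    then have "x \<ge> 0" by simp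
    have "x powr (- 1 / 2) = 1 / sqrt x"
      unfolding minus_divide_left[symmetric] powr_minus powr_half_sqrt[OF \<open>x \<ge> 0\<close>] inverse_eq_divide ..
    then show ?thesis using True by (simp only: indicator_simps scaleR_one)
  next
    case False
    then have "indicator {0<..T} x = (0::real)" by (simp only: indicator_simps not_False_eq_True)
    then show ?thesis by (simp only: scaleR_zero_left div_0)
  qed
  ultimately show ?thesis by (simp only:)
next
  case False
  then have "(\<lambda>r::real. indicator {0<..T} r / sqrt r) = (\<lambda>_. 0)" by (auto simp: indicator_def)
  then show ?thesis by (simp only: integrable_zero)
qed

lemma time_conv_integrable:
  fixes \<psi> :: "real \<Rightarrow> real"
  assumes \<psi>: "admissible \<psi>" and m: "(\<lambda>r. k r x) \<in> borel_measurable borel"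
    and z: "\<And>r. r \<le> 0 \<Longrightarrow> k r x = 0" and b: "\<And>r. 0 < r \<Longrightarrow> r \<le> t \<Longrightarrow> \<bar>k r x\<bar> \<le> A / sqrt r"
  shows "integrable lborel (\<lambda>s. k (t - s) x * \<psi> s)"
proof -
  obtain B where B: "B \<ge> 0" "\<And>s. s \<le> t \<Longrightarrow> norm (\<psi> s) \<le> B" using admissible_bound[OF \<psi>] by metis
  have "integrable lborel (\<lambda>r. k r x * \<psi> (t - r))"
  proof (rule Bochner_Integration.integrable_bound)
    show "integrable lborel (\<lambda>r. A * B * (indicator {0<..t} r / sqrt r))"
      by (intro integrable_mult_right integrable_inverse_sqrt)
    show "(\<lambda>r. k r x * \<psi> (t - r)) \<in> borel_measurable lborel" using m admissible_measurable[OF \<psi>] by measurable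
    show "AE r in lborel. norm (k r x * \<psi> (t - r)) \<le> norm (A * B * (indicator {0<..t} r / sqrt r))"
    proof (rule AE_I2)
      fix r show "norm (k r x * \<psi> (t - r)) \<le> norm (A * B * (indicator {0<..t} r / sqrt r))"
      proof (cases "r \<in> {0<..t}")
        case True
        then have "\<bar>k r x\<bar> * \<bar>\<psi> (t - r)\<bar> \<le> A / sqrt r * B"
          using b[of r] B(2)[of "t - r"] by (intro mult_mono) auto
        also have "\<dots> \<le> norm (A * B * (indicator {0<..t} r / sqrt r))"
          using True by (simp add: field_simps)
        finally show ?thesis by (simp add: abs_mult)
      next
        case False
        then show ?thesis using z admissible_nonpos[OF \<psi>, of "t - r"] by (cases "r \<le> 0") auto
      qed
    qed
  qed
  then show ?thesis
    using lborel_integrable_real_affine[of "\<lambda>r. k r x * \<psi> (t - r)" "-1" t] by simp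
qed

text \<open>In the form with \<open>\<psi> (t - r)\<close> the singularity of the kernel stays at r
  = 0 while t varies, so A B / sqrt r dominates for all nearby points at once.\<close>

lemma time_conv_continuous:
  fixes \<psi> :: "real \<Rightarrow> real"
  assumes \<psi>: "admissible \<psi>" and k: "continuous_on ({0<..} \<times> S) (\<lambda>(r, x). k r x)"
    and z: "\<And>r x. r \<le> 0 \<Longrightarrow> k r x = 0"
    and b: "\<And>T. \<exists>A. \<forall>r\<in>{0<..T}. \<forall>x\<in>S. \<bar>k r x\<bar> \<le> A / sqrt r"
  shows "continuous_on (UNIV \<times> S) (\<lambda>(t, x). time_conv k \<psi> t x)"
  unfolding continuous_on_sequentially
proof (intro allI ballI impI, elim conjE, unfold comp_def)
  fix q :: "nat \<Rightarrow> real \<times> real" and l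
  assume l: "l \<in> UNIV \<times> S" and q: "\<forall>n. q n \<in> UNIV \<times> S" and ql: "q \<longlonglongrightarrow> l"
  define t where "t n = fst (q n)" for n
  define x where "x n = snd (q n)" for n
  have x: "x n \<in> S" "snd l \<in> S" for n using q l by (auto simp: x_def mem_Times_iff)
  have tl: "t \<longlonglongrightarrow> fst l" and xl: "x \<longlonglongrightarrow> snd l"
    unfolding t_def[abs_def] x_def[abs_def] by (intro tendsto_fst tendsto_snd ql)+
  from convergent_imp_Bseq[OF convergentI[OF tl]] obtain T where T: "\<And>n. \<bar>t n\<bar> \<le> T"
    by (auto simp: Bseq_def)
  from b[of T] obtain A where "\<forall>r\<in>{0<..T}. \<forall>x\<in>S. \<bar>k r x\<bar> \<le> A / sqrt r" by blast
  then have A: "\<bar>k r x\<bar> \<le> A / sqrt r" if "0 < r" "r \<le> T" "x \<in> S" for r x using that by simp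
  obtain B where B: "B \<ge> 0" "\<And>s. s \<le> T \<Longrightarrow> norm (\<psi> s) \<le> B" using admissible_bound[OF \<psi>] by metis
  have m: "(\<lambda>r. k r y) \<in> borel_measurable borel" if "y \<in> S" for y
  proof -
    have "(\<lambda>r. indicator {0<..} r *\<^sub>R k r y) \<in> borel_measurable borel"
    proof (rule borel_measurable_continuous_on_indicator)
      show "continuous_on {0<..} (\<lambda>r. k r y)"
        by (rule continuous_on_compose2[OF k, of _ "\<lambda>r. (r, y)", simplified])
           (use that in \<open>auto intro!: continuous_intros\<close>)
    qed simp
    also have "(\<lambda>r. indicator {0<..} r *\<^sub>R k r y) = (\<lambda>r. k r y)"
      using z by (auto simp: indicator_def fun_eq_iff)
    finally show ?thesis .
  qed
  have m\<psi>: "(\<lambda>r. \<psi> (c - r)) \<in> borel_measurable borel" for c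
    using admissible_measurable[OF \<psi>] by measurable
  have mm: "(\<lambda>r. k r y * \<psi> (c - r)) \<in> borel_measurable lborel" if "y \<in> S" for y c
    using borel_measurable_times[OF m[OF that] m\<psi>[of c]] by simp
  have "(\<lambda>n. \<integral>r. k r (x n) * \<psi> (t n - r) \<partial>lborel) \<longlonglongrightarrow> (\<integral>r. k r (snd l) * \<psi> (fst l - r) \<partial>lborel)"
  proof (rule integral_dominated_convergence[where w = "\<lambda>r. A * B * (indicator {0<..T} r / sqrt r)"])
    show "(\<lambda>r. k r (snd l) * \<psi> (fst l - r)) \<in> borel_measurable lborel" by (rule mm[OF x(2)])
    show "(\<lambda>r. k r (x n) * \<psi> (t n - r)) \<in> borel_measurable lborel" for n by (rule mm[OF x(1)])
    show "integrable lborel (\<lambda>r. A * B * (indicator {0<..T} r / sqrt r))"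
      by (intro integrable_mult_right integrable_inverse_sqrt)
    show "AE r in lborel. (\<lambda>n. k r (x n) * \<psi> (t n - r)) \<longlonglongrightarrow> k r (snd l) * \<psi> (fst l - r)"
      \<comment> \<open>At r = \<open>fst l\<close> the limiting argument of \<open>\<psi>\<close>
        is 0, where the density may jump; this single point is a null set.\<close>
      using AE_lborel_singleton[of "fst l"]
    proof eventually_elim
      fix r assume r: "r \<noteq> fst l"
      show "(\<lambda>n. k r (x n) * \<psi> (t n - r)) \<longlonglongrightarrow> k r (snd l) * \<psi> (fst l - r)"
      proof (cases "r > 0")
        case True
        have "continuous_on S (k r)"
          by (rule continuous_on_compose2[OF k, of _ "\<lambda>x. (r, x)", simplified])
             (use True in \<open>auto intro!: continuous_intros\<close>)
        then have 1: "(\<lambda>n. k r (x n)) \<longlonglongrightarrow> k r (snd l)"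
          by (rule continuous_on_tendsto_compose[OF _ xl x(2)]) (simp add: x(1))
        have 3: "(\<lambda>n. t n - r) \<longlonglongrightarrow> fst l - r" by (intro tendsto_intros tl)
        have 2: "(\<lambda>n. \<psi> (t n - r)) \<longlonglongrightarrow> \<psi> (fst l - r)"
        proof (cases "fst l - r > 0")
          case True
          then have "isCont \<psi> (fst l - r)"
            using admissible_continuous[OF \<psi>] continuous_on_eq_continuous_at[of "{0<..}" \<psi>] by simp
          then show ?thesis using 3 by (rule isCont_tendsto_compose)
        next
          case False
          then have "\<forall>\<^sub>F n in sequentially. t n - r < 0" using r by (intro order_tendstoD(2)[OF 3]) auto
          then have "\<forall>\<^sub>F n in sequentially. \<psi> (t n - r) = \<psi> (fst l - r)"
            by eventually_elim (use False in \<open>simp add: admissible_nonpos[OF \<psi>]\<close>)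
          then show ?thesis by (rule tendsto_eventually)
        qed
        show ?thesis by (intro tendsto_mult 1 2)
      qed (simp add: z)
    qed
    show "AE r in lborel. norm (k r (x n) * \<psi> (t n - r)) \<le> A * B * (indicator {0<..T} r / sqrt r)" for n
    proof (rule AE_I2)
      fix r
      show "norm (k r (x n) * \<psi> (t n - r)) \<le> A * B * (indicator {0<..T} r / sqrt r)"
      proof (cases "r \<in> {0<..T}")
        case True
        then have "\<bar>k r (x n)\<bar> * \<bar>\<psi> (t n - r)\<bar> \<le> A / sqrt r * B"
          using A[of r "x n", OF _ _ x(1)] B(2)[of "t n - r"] B(1) T[of n]
          by (intro mult_mono) (auto simp del: times_divide_eq_left)
        then show ?thesis using True by (simp add: abs_mult)
      next
        case False
        then have "r \<le> 0 \<or> t n - r \<le> 0" using T[of n] by auto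
        then show ?thesis using False z[of r "x n"] admissible_nonpos[OF \<psi>, of "t n - r"] by auto
      qed
    qed
  qed
  then show "(\<lambda>n. case q n of (t, x) \<Rightarrow> time_conv k \<psi> t x) \<longlonglongrightarrow> (case l of (t, x) \<Rightarrow> time_conv k \<psi> t x)"
    by (simp add: time_conv_flip t_def x_def case_prod_beta)
qed

text \<open>The power of t rises by one and is divided by n + 1. Iterated, this produces the
  factorials in the Picard series.\<close>

lemma time_conv_bound:
  fixes \<psi> :: "real \<Rightarrow> real"
  assumes \<psi>: "admissible \<psi>" and k: "\<And>r. 0 < r \<Longrightarrow> r \<le> t \<Longrightarrow> \<bar>k r x\<bar> \<le> M" and z: "\<And>r. r \<le> 0 \<Longrightarrow> k r x = 0"
    and B: "\<And>s. 0 < s \<Longrightarrow> s \<le> t \<Longrightarrow> \<bar>\<psi> s\<bar> \<le> B * s ^ n" and t: "0 < t"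
  shows "\<bar>time_conv k \<psi> t x\<bar> \<le> M * B * t ^ (n + 1) / (n + 1)"
proof -
  have M: "M \<ge> 0" using k[of t] t by (meson abs_ge_zero order_refl order_trans)
  have "norm (time_conv k \<psi> t x) \<le> (\<integral>s. M * B * (s ^ n * indicator {0..t} s) \<partial>lborel)"
    unfolding time_conv_def
  proof (rule norm_integral_le_AE)
    show "integrable lborel (\<lambda>s. M * B * (s ^ n * indicator {0..t} s))"
      by (intro integrable_mult_right) (rule integrable_bounded_Icc[of _ _ _ "t ^ n"], auto intro: power_mono
          simp: power_abs)
    show "AE s in lborel. norm (k (t - s) x * \<psi> s) \<le> M * B * (s ^ n * indicator {0..t} s)"
    proof (rule AE_I2)
      fix s show "norm (k (t - s) x * \<psi> s) \<le> M * B * (s ^ n * indicator {0..t} s)"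
      proof (cases "s > 0 \<and> s < t")
        case True
        then have "\<bar>k (t - s) x\<bar> * \<bar>\<psi> s\<bar> \<le> M * (B * s ^ n)" using k[of "t - s"] B[of s] M
            by (intro mult_mono) auto
        then show ?thesis using True by (simp add: abs_mult mult_ac)
      next
        case False
        have "0 \<le> B * t ^ n" using B[of t] t by force
        then have "0 \<le> B" using zero_less_power[OF t, of n] by (simp add: zero_le_mult_iff)
        then have "0 \<le> M * B * (s ^ n * indicator {0..t} s)" using M by (auto simp: indicator_def)
        then show ?thesis using False z[of "t - s"] admissible_nonpos[OF \<psi>, of s] by (cases "s \<le> 0") auto
      qed
    qed
  qed
  also have "\<dots> = M * B * (t ^ (n + 1) / (n + 1))"
  proof -
    have "(\<integral>s. s ^ n * indicator {0..t} s \<partial>lborel) = t ^ (n + 1) / (n + 1)"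
      using integral_power[of 0 t n] t by (simp only: Suc_eq_plus1) simp
    then show ?thesis by simp
  qed
  finally show ?thesis by (simp only: times_divide_eq_right real_norm_def)
qed

text \<open>An approximate identity in quantitative form, with the mass of \<open>k\<close> kept
  instead of normalised to 1: near \<open>c\<close> the oscillation of \<open>f\<close> counts, far
  from \<open>c\<close> the size of \<open>k\<close>. It serves twice, in time for the jump of the
  layer and in space for the attainment of the initial datum.\<close>

lemma approx_identity_bound:
  fixes k f :: "real \<Rightarrow> real"
  assumes k: "integrable lborel k" "\<And>r. 0 \<le> k r" "\<And>r. r \<notin> {a..b} \<Longrightarrow> k r = 0"
    and f: "f \<in> borel_measurable borel" "\<And>r. r \<in> {a..b} \<Longrightarrow> \<bar>f r\<bar> \<le> M" "\<bar>L\<bar> \<le> M"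
    and near: "\<And>r. r \<in> {a..b} \<Longrightarrow> \<bar>r - c\<bar> < \<eta> \<Longrightarrow> \<bar>f r - L\<bar> \<le> \<epsilon>"
    and far: "\<And>r. r \<in> {a..b} \<Longrightarrow> \<eta> \<le> \<bar>r - c\<bar> \<Longrightarrow> k r \<le> \<kappa>"
    and pos: "a \<le> b" "0 \<le> \<epsilon>" "0 \<le> \<kappa>"
  shows "\<bar>(\<integral>r. k r * f r \<partial>lborel) - L * (\<integral>r. k r \<partial>lborel)\<bar> \<le> \<epsilon> * (\<integral>r. k r \<partial>lborel) + 2 * M * \<kappa> * (b - a)"
proof -
  have m: "k \<in> borel_measurable borel" using borel_measurable_integrable[OF k(1)] by simp
  have M: "0 \<le> M" using f(3) by linarith
  have kf: "integrable lborel (\<lambda>r. k r * f r)"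
  proof (rule Bochner_Integration.integrable_bound)
    show "integrable lborel (\<lambda>r. M * k r)" using k by simp
    show "(\<lambda>r. k r * f r) \<in> borel_measurable lborel" using m f by measurable
    show "AE r in lborel. norm (k r * f r) \<le> norm (M * k r)"
    proof (rule AE_I2)
      fix r show "norm (k r * f r) \<le> norm (M * k r)"
      proof (cases "r \<in> {a..b}")
        case True
        then have "k r * \<bar>f r\<bar> \<le> k r * M" using f k by (intro mult_left_mono) auto
        then show ?thesis using k(2)[of r] M by (simp add: abs_mult mult.commute)
      qed (simp add: k)
    qed
  qed
  have ind: "integrable lborel (\<lambda>r. indicator {a..b} r :: real)"
    by (intro integrable_real_indicator) (auto simp: emeasure_lborel_Icc_eq)
  have "(\<integral>r. k r * f r \<partial>lborel) - L * (\<integral>r. k r \<partial>lborel) = (\<integral>r. k r * f r - L * k r \<partial>lborel)"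
    using kf k by simp
  also have "norm \<dots> \<le> (\<integral>r. \<epsilon> * k r + 2 * M * \<kappa> * indicator {a..b} r \<partial>lborel)"
  proof (rule norm_integral_le_AE)
    show "integrable lborel (\<lambda>r. \<epsilon> * k r + 2 * M * \<kappa> * indicator {a..b} r)"
      using k ind by simp
    show "AE r in lborel. norm (k r * f r - L * k r) \<le> \<epsilon> * k r + 2 * M * \<kappa> * indicator {a..b} r"
    proof (rule AE_I2)
      fix r show "norm (k r * f r - L * k r) \<le> \<epsilon> * k r + 2 * M * \<kappa> * indicator {a..b} r"
      proof (cases "r \<in> {a..b}")
        case True
        have e: "norm (k r * f r - L * k r) = k r * \<bar>f r - L\<bar>"
          using k(2)[of r] by (simp add: abs_mult flip: right_diff_distrib left_diff_distrib mult.commute[of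
              "k r" L])
        show ?thesis
        proof (cases "\<bar>r - c\<bar> < \<eta>")
          case 1: True
          have "k r * \<bar>f r - L\<bar> \<le> k r * \<epsilon>" using near[OF True 1] k(2)[of r] by (intro mult_left_mono)
          moreover have "0 \<le> 2 * M * \<kappa> * indicator {a..b} r" using M pos by simp
          ultimately show ?thesis unfolding e by (simp only: mult.commute[of "k r" \<epsilon>])
        next
          case 2: False
          have "\<bar>f r - L\<bar> \<le> 2 * M" using f(2)[OF True] f(3) by linarith
          then have "k r * \<bar>f r - L\<bar> \<le> \<kappa> * (2 * M)"
            using far[OF True] 2 k(2)[of r] pos by (intro mult_mono) auto
          moreover have "0 \<le> \<epsilon> * k r" using pos k by simp
          ultimately show ?thesis unfolding e using True by (simp add: mult_ac)
        qed
      qed (simp add: k)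
    qed
  qed
  also have "\<dots> = \<epsilon> * (\<integral>r. k r \<partial>lborel) + 2 * M * \<kappa> * (b - a)"
    using k ind pos(1) by simp
  finally show ?thesis by simp
qed

lemma bk_0_0: "t > 0 \<Longrightarrow> bk 0 0 t x = 2 * normal_tail (x / sqrt t)"
  by (simp add: bk_0)

text \<open>By the heat equation \<open>bk 0 0\<close> has time derivative \<open>- hk 1\<close>, so
  this is the fundamental theorem of calculus. In probabilistic terms \<open>- hk 1 r x\<close> is
  the density of the first passage time of Brownian motion over the distance x.\<close>

lemma hk_1_time_integral:
  assumes "x > 0" "T \<ge> 0"
  shows "has_bochner_integral lborel (\<lambda>r. - hk 1 r x * indicator {0..T} r) (bk 0 0 T x)"
proof -
  have k: "continuous_on UNIV (\<lambda>r. hk 1 r x)"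
    by (rule continuous_on_compose2[OF hk_continuous[of 1], of _ "\<lambda>r. (r, x)", simplified])
       (use assms in \<open>auto simp: kernel_dom_def intro!: continuous_intros\<close>)
  have "has_bochner_integral lborel (\<lambda>r. - hk 1 r x * indicator {0..T} r) (bk 0 0 T x - bk 0 0 0 x)"
  proof (rule has_bochner_integral_FTC_Icc_nonneg)
    show "(\<lambda>r. - hk 1 r x) \<in> borel_measurable borel"
      by (intro borel_measurable_continuous_onI continuous_intros k)
    show "((\<lambda>r. bk 0 0 r x) has_real_derivative - hk 1 r x) (at r)" for r
      using heat_onD(3)[OF heat_on_bk, of r x 0] assms by (simp add: kernel_dom_def bk_2)
    show "0 \<le> - hk 1 r x" if "r \<in> {0..T}" for r
      using that assms hk_nonneg[of r x] by (simp add: hk_1)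
  qed (use assms in auto)
  then show ?thesis by simp
qed

text \<open>The jump relation. As x decreases to 0, the kernel \<open>- hk 1\<close> in time has
  mass \<open>m x\<close> tending to 1 and is small away from r = 0, because it carries the factor x
  / r; so it concentrates at r = 0. The error bound \<open>R\<close> depends on x alone for all t
  near \<open>t0\<close>, which allows both variables to move.\<close>

lemma time_conv_hk_1_tendsto:
  assumes \<psi>: "admissible \<psi>" and t0: "t0 > 0"
  shows "((\<lambda>(t, x). time_conv (hk 1) \<psi> t x) \<longlongrightarrow> - \<psi> t0) (at (t0, 0) within {0<..} \<times> {0<..})"
    (is "(_ \<longlongrightarrow> _) ?F")
proof (rule tendstoI)
  fix e :: real assume e: "e > 0"
  define T where "T = t0 + 1"
  obtain B where B: "B \<ge> 0" "\<And>s. s \<le> T \<Longrightarrow> norm (\<psi> s) \<le> B" using admissible_bound[OF \<psi>] by metis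
  have "isCont \<psi> t0"
    using admissible_continuous[OF \<psi>] continuous_on_eq_continuous_at[of "{0<..}" \<psi>] t0 by simp
  then obtain d where d: "d > 0" "\<And>s. \<bar>s - t0\<bar> < d \<Longrightarrow> \<bar>\<psi> s - \<psi> t0\<bar> < e / 4"
    using e unfolding continuous_at_eps_delta dist_real_def by (metis divide_pos_pos zero_less_numeral)
  \<comment> \<open>Both |t - t0| and r are below \<open>\<eta>\<close>, so t - r is within 2
    \<open>\<eta>\<close> <= d of \<open>t0\<close>. The bound 1 keeps t below
    \<open>T\<close>.\<close>
  define \<eta> where "\<eta> = min (d / 2) 1"
  have \<eta>: "\<eta> > 0" "\<eta> \<le> 1" "2 * \<eta> \<le> d" using d by (auto simp: \<eta>_def)
  define m where "m x = bk 0 0 T x" for x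
  \<comment> \<open>The three terms are the oscillation of the density, the kernel away from r = 0,
    and the defect of the mass from 1. Only the first survives at x = 0.\<close>
  define R where "R x = e / 4 * m x + 2 * B * (x / \<eta> * (1 / sqrt (2 * pi * \<eta>))) * (T - 0) + B * \<bar>m x - 1\<bar>"
      for x
  have T: "T > 0" using t0 by (simp add: T_def)
  have main: "dist (time_conv (hk 1) \<psi> t x) (- \<psi> t0) \<le> R x" if t: "\<bar>t - t0\<bar> < \<eta>" and x: "x > 0" for t x
  proof -
    define k where "k r = - hk 1 r x * indicator {0..T} r" for r
    have hb: "has_bochner_integral lborel k (m x)"
      unfolding k_def[abs_def] m_def using hk_1_time_integral x T by simp
    have "\<bar>(\<integral>r. k r * \<psi> (t - r) \<partial>lborel) - \<psi> t0 * (\<integral>r. k r \<partial>lborel)\<bar>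
        \<le> e / 4 * (\<integral>r. k r \<partial>lborel) + 2 * B * (x / \<eta> * (1 / sqrt (2 * pi * \<eta>))) * (T - 0)"
    proof (rule approx_identity_bound[where c = 0 and \<eta> = \<eta>])
      show "integrable lborel k" using hb by (simp add: has_bochner_integral_iff)
      show nn: "0 \<le> k r" for r
        using x hk_nonneg[of r x] by (auto simp: k_def hk_1 indicator_def)
      show "(\<lambda>r. \<psi> (t - r)) \<in> borel_measurable borel" using admissible_measurable[OF \<psi>] by measurable
      show "\<bar>\<psi> (t - r)\<bar> \<le> B" if "r \<in> {0..T}" for r
        using B(2)[of "t - r"] t that \<eta> by (auto simp: T_def abs_if split: if_splits)
      show "\<bar>\<psi> t0\<bar> \<le> B" using B(2)[of t0] by (simp add: T_def)
      show "\<bar>\<psi> (t - r) - \<psi> t0\<bar> \<le> e / 4" if "\<bar>r - 0\<bar> < \<eta>" for r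
      proof -
        have "\<bar>t - r - t0\<bar> < d" using that t \<eta> by linarith
        then show ?thesis using d(2) by (simp add: less_imp_le)
      qed
      show "k r \<le> x / \<eta> * (1 / sqrt (2 * pi * \<eta>))" if "r \<in> {0..T}" "\<eta> \<le> \<bar>r - 0\<bar>" for r
      proof -
        have r: "r > 0" "\<eta> \<le> r" using that \<eta> by auto
        have "hk 0 r x \<le> 1 / sqrt (2 * pi * r)" by (rule hk_le[OF r(1)])
        also have "\<dots> \<le> 1 / sqrt (2 * pi * \<eta>)" using r \<eta> by (intro divide_left_mono) auto
        finally have h: "hk 0 r x \<le> 1 / sqrt (2 * pi * \<eta>)" .
        have "k r = x / r * hk 0 r x" using that by (simp add: k_def hk_1)
        also have "\<dots> \<le> x / \<eta> * (1 / sqrt (2 * pi * \<eta>))"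
          using x r \<eta> h hk_nonneg[of r x] by (intro mult_mono divide_left_mono) auto
        finally show ?thesis .
      qed
    qed (use e T x \<eta> in \<open>auto simp: k_def\<close>)
    moreover have "(\<integral>r. k r \<partial>lborel) = m x" using hb by (simp add: has_bochner_integral_iff)
    moreover have "(\<integral>r. k r * \<psi> (t - r) \<partial>lborel) = - time_conv (hk 1) \<psi> t x"
    proof -
      have "(\<integral>r. k r * \<psi> (t - r) \<partial>lborel) = (\<integral>r. - (hk 1 r x * \<psi> (t - r)) \<partial>lborel)"
      proof (rule Bochner_Integration.integral_cong[OF refl])
        fix r
        consider "r < 0" | "r \<in> {0..T}" | "r > T" by fastforce
        then show "k r * \<psi> (t - r) = - (hk 1 r x * \<psi> (t - r))"
        proof cases
          case 3
          then have "\<psi> (t - r) = 0" using t \<eta> by (intro admissible_nonpos[OF \<psi>]) (simp add: T_def)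
          then show ?thesis by simp
        qed (simp_all add: k_def)
      qed
      then show ?thesis by (simp add: time_conv_flip)
    qed
    moreover have "\<bar>\<psi> t0 * (m x - 1)\<bar> \<le> B * \<bar>m x - 1\<bar>"
      unfolding abs_mult using B(2)[of t0] by (intro mult_right_mono) (auto simp: T_def)
    ultimately show ?thesis
      unfolding dist_real_def R_def by (simp add: right_diff_distrib)
  qed
  have m_cont: "continuous_on UNIV m"
    unfolding m_def using bk_0_has_derivative_x by (intro DERIV_continuous_on) (auto intro:
        has_field_derivative_at_within)
  then have R_cont: "continuous_on UNIV R"
    unfolding R_def by (intro continuous_intros) (use \<eta> in auto)
  have "m 0 = 1" using T by (simp add: m_def bk_0_0 normal_tail_0)
  then have "R 0 = e / 4" by (simp add: R_def)
  have "((\<lambda>p::real \<times> real. R (snd p)) \<longlongrightarrow> R 0) ?F"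
  proof (rule isCont_tendsto_compose[where g = R])
    show "isCont R 0" using R_cont by (simp add: continuous_on_eq_continuous_at)
    show "(snd \<longlongrightarrow> (0::real)) ?F" by (auto intro!: tendsto_eq_intros)
  qed
  then have "\<forall>\<^sub>F p::real \<times> real in ?F. R (snd p) < e"
    by (rule order_tendstoD(2)) (use \<open>R 0 = e / 4\<close> e in simp)
  moreover have "\<forall>\<^sub>F p::real \<times> real in ?F. dist (fst p) t0 < \<eta>"
    by (rule tendstoD[OF _ \<eta>(1)]) (auto intro!: tendsto_eq_intros)
  moreover have "\<forall>\<^sub>F p::real \<times> real in ?F. p \<in> {0<..} \<times> {0<..}"
    by (auto simp: eventually_at_filter)
  ultimately show "\<forall>\<^sub>F p in ?F. dist (case p of (t, x) \<Rightarrow> time_conv (hk 1) \<psi> t x) (- \<psi> t0) < e"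
  proof eventually_elim
    case (elim p)
    then show ?case using main[of "fst p" "snd p"] by (auto simp: dist_real_def case_prod_beta mem_Times_iff)
  qed
qed

section \<open>Volterra equations of the second kind\<close>

lemma admissible_diff:
  assumes a: "admissible a" and b: "admissible b"
  shows "admissible (\<lambda>t. a t - b t)"
  unfolding admissible_def
proof (intro conjI allI impI)
  fix R :: real
  obtain B where B: "\<And>s. s \<le> R \<Longrightarrow> norm (a s) \<le> B" using admissible_bound[OF a] by metis
  obtain C where C: "\<And>s. s \<le> R \<Longrightarrow> norm (b s) \<le> C" using admissible_bound[OF b] by metis
  have "norm (a s - b s) \<le> B + C" if "s \<le> R" for s
    using norm_triangle_ineq4[of "a s" "b s"] B[OF that] C[OF that] by linarith
  then show "\<exists>B. \<forall>s\<le>R. norm (a s - b s) \<le> B" by blast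
qed (auto intro!: continuous_on_diff admissible_continuous[OF a] admissible_continuous[OF b] simp:
    admissible_nonpos[OF a] admissible_nonpos[OF b])

text \<open>Neumann series: the n-th iterate of \<open>T\<close> on \<open>F\<close> is at most B (M
  R t)^n / n! for t <= R, so the series converges uniformly on bounded times and sums to at most B
  exp (M R R). The bound is proportional to the size of \<open>F\<close>, with a factor that depends
  only on the horizon \<open>R\<close>; this is what turns the size of the datum into a bound on the
  densities.\<close>

lemma volterra_exists:
  fixes T :: "(real \<Rightarrow> 'a::banach) \<Rightarrow> real \<Rightarrow> 'a" and F :: "real \<Rightarrow> 'a" and M :: "real \<Rightarrow> real"
  assumes T: "\<And>\<phi>. admissible \<phi> \<Longrightarrow> admissible (T \<phi>)"
    and add: "\<And>\<phi> \<xi>. admissible \<phi> \<Longrightarrow> admissible \<xi> \<Longrightarrow> T (\<lambda>t. \<phi> t + \<xi> t) = (\<lambda>t. T \<phi> t + T \<xi> t)"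
    and bound: "\<And>\<phi> R n B t. admissible \<phi> \<Longrightarrow> (\<And>s. 0 < s \<Longrightarrow> s \<le> R \<Longrightarrow> norm (\<phi> s) \<le> B * s ^ n) \<Longrightarrow> 0 < t \<Longrightarrow> t \<le> R
        \<Longrightarrow> norm (T \<phi> t) \<le> M R * B * t ^ (n + 1) / (n + 1)"
    and M: "\<And>R. 0 \<le> M R" and F: "admissible F"
  shows "\<exists>\<psi>. admissible \<psi> \<and> (\<forall>t. \<psi> t = F t + T \<psi> t) \<and>
    (\<forall>R B. (\<forall>s\<in>{0<..R}. norm (F s) \<le> B) \<longrightarrow> (\<forall>t\<in>{0<..R}. norm (\<psi> t) \<le> B * exp (M R * R)))"
proof -
  define d where "d = rec_nat F (\<lambda>_. T)"
  have d0: "d 0 = F" and dS: "d (Suc n) = T (d n)" for n by (simp_all add: d_def)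
  have admissible_d: "admissible (d n)" for n by (induction n) (simp_all add: d0 dS F T)
  have bd: "norm (d n t) \<le> B * (M R * t) ^ n / fact n"
    if "\<forall>s\<in>{0<..R}. norm (F s) \<le> B" "0 < t" "t \<le> R" for n t R B
    using that(2,3)
  proof (induction n arbitrary: t)
    case 0
    then show ?case using that(1) by (simp add: d0)
  next
    case (Suc n)
    have "norm (T (d n) t) \<le> M R * (B * M R ^ n / fact n) * t ^ (n + 1) / (n + 1)"
      by (rule bound[OF admissible_d _ Suc.prems]) (use Suc.IH in \<open>simp add: power_mult_distrib mult_ac\<close>)
    also have "\<dots> = B * (M R * t) ^ Suc n / fact (Suc n)"
      unfolding Suc_eq_plus1[symmetric] by (simp add: power_mult_distrib field_simps)
    finally show ?case by (simp add: dS)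
  qed
  define \<psi> where "\<psi> t = (\<Sum>n. d n t)" for t
  have bd': "norm (d n t) \<le> B * (M R * R) ^ n / fact n"
    if B: "\<forall>s\<in>{0<..R}. norm (F s) \<le> B" and t: "0 < t" "t \<le> R" for n t R B
  proof -
    have "0 \<le> B" using B t by (meson greaterThanAtMost_iff norm_ge_zero order_trans)
    have "B * (M R * t) ^ n / fact n \<le> B * (M R * R) ^ n / fact n"
      using t M[of R] \<open>0 \<le> B\<close> by (intro divide_right_mono mult_left_mono power_mono) auto
    then show ?thesis using bd[OF B t, of n] by linarith
  qed
  have summ: "summable (\<lambda>n. B * (M R * R) ^ n / fact n)" for R B
    using summable_mult[OF summable_exp[of "M R * R"], of B] by (simp add: divide_inverse mult_ac)
  have sumexp: "(\<Sum>n. B * (M R * R) ^ n / fact n) = B * exp (M R * R)" for R B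
    using suminf_mult[OF summable_exp[of "M R * R"], of B] by (simp add: exp_def divide_inverse mult_ac)
  have obtB: "\<exists>B\<ge>0. \<forall>s\<in>{0<..R}. norm (F s) \<le> B" for R
    using admissible_bound[OF F, of R] by (metis greaterThanAtMost_iff)
  have sd: "summable (\<lambda>n. d n t)" for t
  proof (cases "t > 0")
    case True
    obtain B where B: "\<forall>s\<in>{0<..t}. norm (F s) \<le> B" using obtB[of t] by blast
    show ?thesis
      by (rule summable_comparison_test'[OF summ[of B t], of 0]) (use bd'[OF B True] in simp)
  next
    case False
    then have "(\<lambda>n. d n t) = (\<lambda>_. 0)" using admissible_nonpos[OF admissible_d] by auto
    then show ?thesis by simp
  qed
  have tail: "norm (\<psi> t - (\<Sum>n<N. d n t)) \<le> (\<Sum>n. B * (M R * R) ^ (n + N) / fact (n + N))"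
    if B: "\<forall>s\<in>{0<..R}. norm (F s) \<le> B" and t: "0 < t" "t \<le> R" for N t R B
  proof -
    have "\<psi> t - (\<Sum>n<N. d n t) = (\<Sum>n. d (n + N) t)"
      unfolding \<psi>_def using suminf_minus_initial_segment[OF sd[of t], of N] by simp
    also have "norm \<dots> \<le> (\<Sum>n. B * (M R * R) ^ (n + N) / fact (n + N))"
      by (rule norm_suminf_le[OF _ summable_ignore_initial_segment[OF summ]]) (rule bd'[OF B t])
    finally show ?thesis .
  qed
  have psi_bound: "norm (\<psi> t) \<le> B * exp (M R * R)"
    if B: "\<forall>s\<in>{0<..R}. norm (F s) \<le> B" and t: "0 < t" "t \<le> R" for t R B
    using tail[OF B t, of 0] sumexp by simp
  have cont: "continuous_on {0<..<R} \<psi>" for R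
  proof -
    obtain B where B: "\<forall>s\<in>{0<..R}. norm (F s) \<le> B" using obtB[of R] by blast
    have "uniform_limit {0<..<R} (\<lambda>n t. \<Sum>i<n. d i t) (\<lambda>t. \<Sum>i. d i t) sequentially"
      by (rule Weierstrass_m_test[OF _ summ[of B R]]) (use bd'[OF B] in auto)
    moreover have "continuous_on {0<..<R} (\<lambda>t. \<Sum>i<n. d i t)" for n
      by (intro continuous_on_sum continuous_on_subset[OF admissible_continuous[OF admissible_d]]) auto
    ultimately show ?thesis
      unfolding \<psi>_def[abs_def] by (intro uniform_limit_theorem) auto
  qed
  have psi_nonpos: "\<psi> t = 0" if "t \<le> 0" for t
    using admissible_nonpos[OF admissible_d that] by (simp add: \<psi>_def)
  have "continuous_on {0<..} \<psi>"
  proof (rule continuous_at_imp_continuous_on, rule ballI)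
    fix t :: real assume "t \<in> {0<..}"
    then show "isCont \<psi> t" using cont[of "t + 1"] continuous_on_eq_continuous_at[of "{0<..<t+1}" \<psi>] by simp
  qed
  moreover have "\<exists>B. \<forall>s\<le>R. norm (\<psi> s) \<le> B" for R
  proof -
    obtain B where B: "B \<ge> 0" "\<forall>s\<in>{0<..R}. norm (F s) \<le> B" using obtB[of R] by blast
    have "norm (\<psi> s) \<le> B * exp (M R * R)" if "s \<le> R" for s
      using psi_bound[OF B(2), of s] psi_nonpos[of s] that B(1) by (cases "s > 0") auto
    then show ?thesis by blast
  qed
  ultimately have admissible_psi: "admissible \<psi>" using psi_nonpos by (auto simp: admissible_def)
  have admissible_sum: "admissible (\<lambda>t. \<Sum>n<N. d n t)" for N
    unfolding admissible_def
  proof (intro conjI allI impI)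
    show "continuous_on {0<..} (\<lambda>t. \<Sum>n<N. d n t)"
      by (intro continuous_on_sum admissible_continuous admissible_d)
    fix R :: real
    have "\<exists>b. \<forall>s\<le>R. norm (d n s) \<le> b" for n using admissible_d[of n] by (auto simp: admissible_def)
    then obtain b where b: "\<And>n s. s \<le> R \<Longrightarrow> norm (d n s) \<le> b n" by metis
    have "norm (\<Sum>n<N. d n s) \<le> (\<Sum>n<N. b n)" if "s \<le> R" for s
      by (rule sum_norm_le) (use b that in auto)
    then show "\<exists>B. \<forall>s\<le>R. norm (\<Sum>n<N. d n s) \<le> B" by blast
  qed (simp add: admissible_nonpos[OF admissible_d])
  have admissible_zero: "admissible (\<lambda>t. 0 :: 'a)" by (auto simp: admissible_def intro: exI[of _ 0])
  have T0: "T (\<lambda>t. 0) = (\<lambda>t. 0)"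
    using add[OF admissible_zero admissible_zero] by (auto simp: fun_eq_iff)
  have Tsum: "T (\<lambda>t. \<Sum>n<N. d n t) t = (\<Sum>n<N. d (Suc n) t)" for N t
  proof (induction N)
    case (Suc N)
    then show ?case using add[OF admissible_sum[of N] admissible_d[of N]] by (simp add: dS)
  qed (simp add: T0)
  \<comment> \<open>To exchange \<open>T\<close> with the infinite sum, \<open>T\<close> is applied
    to the remainder after N terms. The remainder is bounded by a constant that tends to 0, so the
    case n = 0 of \<open>bound\<close> is enough.\<close>
  have fix_eq: "\<psi> t = F t + T \<psi> t" for t
  proof (cases "t > 0")
    case True
    obtain B where B: "\<forall>s\<in>{0<..t}. norm (F s) \<le> B" using obtB[of t] by blast
    define r where "r N = (\<Sum>n. B * (M t * t) ^ (n + N) / fact (n + N))" for N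
    have r0: "r \<longlonglongrightarrow> 0" unfolding r_def by (rule suminf_exist_split2[OF summ])
    have e: "norm (T \<psi> t - (\<Sum>n<N. d (Suc n) t)) \<le> M t * r N * t" for N
    proof -
      have admissible_e: "admissible (\<lambda>s. \<psi> s - (\<Sum>n<N. d n s))"
        by (rule admissible_diff[OF admissible_psi admissible_sum])
      have "T \<psi> = T (\<lambda>s. (\<psi> s - (\<Sum>n<N. d n s)) + (\<Sum>n<N. d n s))" by simp
      also have "\<dots> = (\<lambda>s. T (\<lambda>s. \<psi> s - (\<Sum>n<N. d n s)) s + T (\<lambda>s. \<Sum>n<N. d n s) s)"
        by (rule add[OF admissible_e admissible_sum])
      finally have "T \<psi> t - (\<Sum>n<N. d (Suc n) t) = T (\<lambda>s. \<psi> s - (\<Sum>n<N. d n s)) t" by (simp add: Tsum)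
      also have "norm \<dots> \<le> M t * r N * t ^ (0 + 1) / (0 + 1)"
        using bound[OF admissible_e _ True order_refl, of "r N" 0] tail[OF B, of _ N] by (simp add: r_def)
      finally show ?thesis by simp
    qed
    have "(\<lambda>N. T \<psi> t - (\<Sum>n<N. d (Suc n) t)) \<longlonglongrightarrow> 0"
    proof (rule Lim_null_comparison[OF always_eventually[OF allI[OF e]]])
      show "(\<lambda>N. M t * r N * t) \<longlonglongrightarrow> 0" using r0 by (auto intro!: tendsto_eq_intros)
    qed
    moreover have "(\<lambda>N. T \<psi> t - (\<Sum>n<N. d (Suc n) t)) \<longlonglongrightarrow> T \<psi> t - (\<Sum>n. d (Suc n) t)"
      by (intro tendsto_intros summable_LIMSEQ iffD2[OF summable_Suc_iff] sd)
    ultimately have "0 = T \<psi> t - (\<Sum>n. d (Suc n) t)" by (rule LIMSEQ_unique)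
    then have "T \<psi> t = (\<Sum>n. d (Suc n) t)" by simp
    then show ?thesis unfolding \<psi>_def using suminf_split_head[OF sd[of t]] by (simp add: d0)
  next
    case False
    then show ?thesis using admissible_nonpos[OF admissible_psi] admissible_nonpos[OF F] admissible_nonpos[OF
        T[OF admissible_psi]] by simp
  qed
  show ?thesis using admissible_psi fix_eq psi_bound by (intro exI[of _ \<psi>]) auto
qed

section \<open>The potential ansatz\<close>

text \<open>The datum as seen in the open interval. End values are invisible to integrals, so they
  enter the ansatz separately as the numbers \<open>c\<close> and \<open>d\<close>.\<close>

definition unit_weight :: "(real \<Rightarrow> real) \<Rightarrow> bool" where
  "unit_weight f \<longleftrightarrow> f \<in> borel_measurable borel \<and> (\<forall>y. y \<notin> {0<..<1} \<longrightarrow> f y = 0) \<and> (\<exists>M. \<forall>y. \<bar>f y\<bar> \<le> M)"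

definition refl_unit :: "(real \<Rightarrow> real) \<Rightarrow> real \<Rightarrow> real" where
  "refl_unit f y = f (1 - y)"

lemma unit_weight_refl_unit: "unit_weight f \<Longrightarrow> unit_weight (refl_unit f)"
proof -
  assume f: "unit_weight f"
  then have "f \<in> borel_measurable borel" by (simp add: unit_weight_def)
  then have "(\<lambda>y. f (1 - y)) \<in> borel_measurable borel"
    by (rule measurable_compose[rotated]) simp
  then show ?thesis using f unfolding unit_weight_def refl_unit_def by auto
qed

lemma refl_unit_refl_unit [simp]: "refl_unit (refl_unit f) = f"
  by (simp add: refl_unit_def fun_eq_iff)

lemma unit_weight_measurable: "unit_weight f \<Longrightarrow> f \<in> borel_measurable borel"
  and unit_weight_outside: "unit_weight f \<Longrightarrow> y \<notin> {0<..<1} \<Longrightarrow> f y = 0"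
  by (auto simp: unit_weight_def)

lemma unit_weight_integrable: "unit_weight f \<Longrightarrow> integrable lborel f"
proof -
  assume f: "unit_weight f"
  then obtain M where "\<And>y. \<bar>f y\<bar> \<le> M" by (auto simp: unit_weight_def)
  then have "integrable lborel (\<lambda>y. f y * indicator {0..1} y)"
    by (intro integrable_bounded_Icc[of _ _ _ M]) (use f unit_weight_measurable in auto)
  also have "(\<lambda>y. f y * indicator {0..1} y) = f"
  proof
    fix y show "f y * indicator {0..1} y = f y"
      by (cases "y \<in> {0<..<1}") (simp_all add: unit_weight_outside[OF f])
  qed
  finally show ?thesis .
qed

definition mass :: "(real \<Rightarrow> real) \<Rightarrow> real" where
  "mass f = (\<integral>y. \<bar>f y\<bar> \<partial>lborel)"

lemma mass_nonneg: "0 \<le> mass f"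
  unfolding mass_def by (rule integral_nonneg_AE) simp

lemma mass_refl_unit: "mass (refl_unit f) = mass f"
  unfolding mass_def refl_unit_def
  using lborel_integral_real_affine[of "-1" "\<lambda>y. \<bar>f y\<bar>" 1] by simp

lemma space_integral_bound:
  assumes f: "unit_weight f" and k: "\<And>y. 0 < y \<Longrightarrow> y < 1 \<Longrightarrow> \<bar>k y\<bar> \<le> C"
  shows "\<bar>\<integral>y. k y * f y \<partial>lborel\<bar> \<le> C * mass f"
proof -
  have "norm (\<integral>y. k y * f y \<partial>lborel) \<le> (\<integral>y. C * \<bar>f y\<bar> \<partial>lborel)"
  proof (rule norm_integral_le_AE)
    show "integrable lborel (\<lambda>y. C * \<bar>f y\<bar>)" using unit_weight_integrable[OF f] by simp
    show "AE y in lborel. norm (k y * f y) \<le> C * \<bar>f y\<bar>"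
    proof (rule AE_I2)
      fix y show "norm (k y * f y) \<le> C * \<bar>f y\<bar>"
        using k[of y] unit_weight_outside[OF f, of y]
        by (cases "y \<in> {0<..<1}") (auto simp: abs_mult intro!: mult_right_mono)
    qed
  qed
  then show ?thesis by (simp add: mass_def)
qed

definition free_pot :: "(real \<Rightarrow> real) \<Rightarrow> nat \<Rightarrow> real \<Rightarrow> real \<Rightarrow> real" where
  "free_pot f i t x = (\<integral>y. hk i t (x - y) * f y \<partial>lborel)"

text \<open>The potential of the mirror image of \<open>f\<close> in 0; subtracted from
  \<open>free_pot\<close> it gives the value 0 at x = 0.\<close>

definition image_pot :: "(real \<Rightarrow> real) \<Rightarrow> nat \<Rightarrow> real \<Rightarrow> real \<Rightarrow> real" where
  "image_pot f i t x = (\<integral>y. hk i t (x + y) * f y \<partial>lborel)"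

definition bdry_pot :: "real \<Rightarrow> (real \<Rightarrow> real) \<Rightarrow> nat \<Rightarrow> real \<Rightarrow> real \<Rightarrow> real" where
  "bdry_pot \<sigma> f i t x = (\<integral>y. bk \<sigma> i t (x + y) * f y \<partial>lborel)"

lemma heat_on_space_pot:
  fixes k :: "nat \<Rightarrow> real \<Rightarrow> real \<Rightarrow> real"
  assumes k: "heat_on ({0<..} \<times> UNIV) k" and f: "unit_weight f" and c: "\<bar>c\<bar> = 1"
  shows "heat_on ({0<..} \<times> UNIV) (\<lambda>i t x. \<integral>y. k i t (x + c * y) * f y \<partial>lborel)"
proof (rule heat_on_integral[where a = 0 and b = 1])
  show "open ({0::real<..} \<times> (UNIV :: real set))" by (intro open_Times) auto
  show "heat_on ({0<..} \<times> UNIV) (\<lambda>i t x. k i t (x + c * y))" for y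
    using heat_on_shift[OF k, of "{0<..} \<times> UNIV" 0 "c * y"] by simp
  show "continuous_on (({0<..} \<times> UNIV) \<times> {0..1}) (\<lambda>(p, s). k i (fst p) (snd p + c * s))" if "i \<le> 2" for i
    unfolding case_prod_beta
    by (rule continuous_on_compose2[OF heat_on_continuous[OF k that], of _ "\<lambda>q. (fst (fst q), snd (fst q)
        + c * snd q)", simplified])
       (auto intro!: continuous_intros)
qed (use unit_weight_integrable[OF f] unit_weight_outside[OF f] in auto)

lemma heat_on_free_pot: "unit_weight f \<Longrightarrow> heat_on ({0<..} \<times> UNIV) (free_pot f)"
  using heat_on_space_pot[OF heat_on_hk, of f "-1"] by (simp add: free_pot_def[abs_def])

lemma heat_on_image_pot: "unit_weight f \<Longrightarrow> heat_on ({0<..} \<times> UNIV) (image_pot f)"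
  using heat_on_space_pot[OF heat_on_hk, of f 1] by (simp add: image_pot_def[abs_def])

lemma heat_on_bk_pos: "heat_on ({0<..} \<times> UNIV) (bk \<sigma>)"
  by (rule heat_on_subset[OF heat_on_bk]) (auto simp: kernel_dom_def)

lemma heat_on_bdry_pot: "unit_weight f \<Longrightarrow> heat_on ({0<..} \<times> UNIV) (bdry_pot \<sigma> f)"
  using heat_on_space_pot[OF heat_on_bk_pos, of f 1] by (simp add: bdry_pot_def[abs_def])

text \<open>The half-line correction at x = 0. Subtracting the mirror image cancels value and second
  derivative at 0 and doubles the first derivative. That term, multiplied by \<sigma>, is cancelled
  by the boundary potential with factor - 2 \<sigma>, since v'' / 2 + \<sigma> v' takes
  \<open>bk\<close> to \<open>- hk 1\<close>. The last term satisfies the homogeneous condition and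
  starts from the value \<open>c\<close> at 0.\<close>

definition end_data :: "real \<Rightarrow> (real \<Rightarrow> real) \<Rightarrow> real \<Rightarrow> nat \<Rightarrow> real \<Rightarrow> real \<Rightarrow> real" where
  "end_data \<sigma> f c i t x = - image_pot f i t x - 2 * \<sigma> * bdry_pot \<sigma> f i t x + c * bk \<sigma> i t x"

text \<open>The extra summand is the jump of the second derivative of the layer potential at the boundary.\<close>

definition end_layer :: "real \<Rightarrow> (real \<Rightarrow> real) \<Rightarrow> nat \<Rightarrow> real \<Rightarrow> real \<Rightarrow> real" where
  "end_layer \<sigma> \<psi> i t x = time_conv (bk \<sigma> i) \<psi> t x + (if i = 2 \<and> x = 0 then 2 * \<psi> t else 0)"

definition end_part where
  "end_part \<sigma> f c \<psi> i t x = end_data \<sigma> f c i t x + end_layer \<sigma> \<psi> i t x"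

text \<open>Each end is treated as if the other were absent; the right end is the left-end
  construction for the reflected datum, read at 1 - x, with the sign of the chain rule. What each
  end part produces at the opposite end is the error that the densities must absorb.\<close>

definition pot_sol where
  "pot_sol \<sigma> f c d \<psi> \<phi> i t x =
     free_pot f i t x + end_part \<sigma> f c \<psi> i t x + (-1) ^ i * end_part \<sigma> (refl_unit f) d \<phi> i t (1 - x)"

lemma heat_on_end_data:
  assumes "unit_weight f"
  shows "heat_on ({0<..} \<times> UNIV) (end_data \<sigma> f c)"
proof -
  have "heat_on ({0<..} \<times> UNIV) (\<lambda>i t x. (- 1 * image_pot f i t x + (- 2 * \<sigma>) * bdry_pot \<sigma> f i t x)
      + c * bk \<sigma> i t x)"
    by (intro heat_on_add heat_on_cmult heat_on_image_pot heat_on_bdry_pot heat_on_bk_pos assms)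
  then show ?thesis by (simp add: end_data_def[abs_def])
qed

lemma heat_on_end_part:
  assumes "unit_weight f" "admissible \<psi>"
  shows "heat_on ({0<..} \<times> {0<..}) (end_part \<sigma> f c \<psi>)"
proof (rule heat_on_cong_open)
  show "heat_on ({0<..} \<times> {0<..}) (\<lambda>i t x. end_data \<sigma> f c i t x + time_conv (bk \<sigma> i) \<psi> t x)"
    by (rule heat_on_add[OF heat_on_subset[OF heat_on_end_data[OF assms(1)]] heat_on_subset[OF
        heat_on_time_conv_bk[OF assms(2)]]]) auto
qed (auto simp: end_part_def end_layer_def intro!: open_Times)

lemma heat_on_pot_sol:
  assumes "unit_weight f" "admissible \<psi>" "admissible \<phi>"
  shows "heat_on ({0<..} \<times> {0<..<1}) (pot_sol \<sigma> f c d \<psi> \<phi>)"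
proof -
  have "heat_on ({0<..} \<times> {0<..<1}) (\<lambda>i t x. (free_pot f i t x + end_part \<sigma> f c \<psi> i t x)
      + (-1) ^ i * end_part \<sigma> (refl_unit f) d \<phi> i t (1 - x))"
    by (intro heat_on_add heat_on_reflect[OF heat_on_end_part] heat_on_subset[OF heat_on_free_pot]
        heat_on_subset[OF heat_on_end_part] assms unit_weight_refl_unit) auto
  then show ?thesis by (simp add: pot_sol_def[abs_def])
qed

lemma free_pot_refl_unit:
  assumes "i \<le> 2"
  shows "free_pot f i t (1 - x) = (-1) ^ i * free_pot (refl_unit f) i t x"
proof -
  have "free_pot (refl_unit f) i t x = (\<integral>y. hk i t (x - (1 + - 1 * y)) * f y \<partial>lborel)"
    unfolding free_pot_def refl_unit_def
    by (subst lborel_integral_real_affine[of "-1" _ 1]) auto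
  also have "\<dots> = (\<integral>y. (-1) ^ i * (hk i t (1 - x - y) * f y) \<partial>lborel)"
  proof (rule Bochner_Integration.integral_cong[OF refl])
    fix y
    show "hk i t (x - (1 + - 1 * y)) * f y = (-1) ^ i * (hk i t (1 - x - y) * f y)"
      using hk_minus[OF assms, of t "1 - x - y"] by (simp add: algebra_simps)
  qed
  finally have "free_pot (refl_unit f) i t x = (-1) ^ i * free_pot f i t (1 - x)"
    by (simp add: free_pot_def)
  then show ?thesis by (simp flip: power_mult_distrib mult.assoc)
qed

text \<open>Exchanging the ends is a symmetry of the ansatz, so facts at x = 1 follow from those at
  x = 0.\<close>

lemma pot_sol_refl_unit:
  assumes "i \<le> 2"
  shows "pot_sol \<sigma> f c d \<psi> \<phi> i t (1 - x) = (-1) ^ i * pot_sol \<sigma> (refl_unit f) d c \<phi> \<psi> i t x"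
  using assms unfolding pot_sol_def free_pot_refl_unit[OF assms]
  by (elim le_2_cases) (auto simp: algebra_simps)

text \<open>Bounds \<open>bk \<sigma> 0\<close> for times up to T and 0 <= x <= 2, the range of x +
  y for two points of the unit interval: the tail is at most 1, and - 2 \<sigma> x is at most 4
  |\<sigma>|.\<close>

definition bk_bd :: "real \<Rightarrow> real \<Rightarrow> real" where
  "bk_bd \<sigma> T = 2 * exp (2 * \<sigma>\<^sup>2 * T + 4 * \<bar>\<sigma>\<bar>)"

lemma bk_0_nonneg: "0 \<le> bk \<sigma> 0 t x"
  by (auto simp: bk_0 normal_tail_nonneg)

lemma bk_0_bound:
  assumes "r \<le> T" "0 \<le> T" "0 \<le> x" "x \<le> 2"
  shows "\<bar>bk \<sigma> 0 r x\<bar> \<le> bk_bd \<sigma> T"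
proof (cases "r > 0")
  case True
  have "- (\<sigma> * x) \<le> \<bar>\<sigma>\<bar> * 2"
    using mult_mono[of "\<bar>\<sigma>\<bar>" "\<bar>\<sigma>\<bar>" "\<bar>x\<bar>" 2] assms abs_mult[of \<sigma> x] by linarith
  moreover have "\<sigma>\<^sup>2 * r \<le> \<sigma>\<^sup>2 * T" using assms by (intro mult_left_mono) auto
  ultimately have "exp (2 * \<sigma>\<^sup>2 * r - 2 * \<sigma> * x) \<le> exp (2 * \<sigma>\<^sup>2 * T + 4 * \<bar>\<sigma>\<bar>)" by simp
  then have "2 * exp (2 * \<sigma>\<^sup>2 * r - 2 * \<sigma> * x) * normal_tail ((x - 2 * \<sigma> * r) / sqrt r)
      \<le> 2 * exp (2 * \<sigma>\<^sup>2 * T + 4 * \<bar>\<sigma>\<bar>) * 1"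
    by (intro mult_mono normal_tail_le_1 normal_tail_nonneg) auto
  then show ?thesis using True bk_0_nonneg[of \<sigma> r x] by (simp add: bk_0 bk_bd_def)
qed (simp add: bk_bd_def)

text \<open>At distance at least 1 from their source the kernels are continuous down to time 0,
  hence bounded on the compact set \<open>{0..T} \<times> {1..2}\<close>; for negative times they
  vanish. So each end sees the other through bounded kernels.\<close>

lemma kernel_far_bound:
  "\<exists>C\<ge>0. \<forall>i\<le>2. \<forall>r\<le>T. \<forall>x\<in>{1..2}. \<bar>bk \<sigma> i r x\<bar> \<le> C \<and> \<bar>hk i r x\<bar> \<le> C"
proof -
  have cpt: "compact ({0..T} \<times> {1..2::real})" by (intro compact_Times) auto
  have sub: "{0..T} \<times> {1..2::real} \<subseteq> kernel_dom" by (auto simp: kernel_dom_def)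
  have "\<exists>C. \<forall>p\<in>{0..T} \<times> {1..2}. \<bar>case p of (t, x) \<Rightarrow> k t x\<bar> \<le> C"
    if "continuous_on kernel_dom (\<lambda>(t, x). k t x)" for k :: "real \<Rightarrow> real \<Rightarrow> real"
    using compact_imp_bounded[OF compact_continuous_image[OF continuous_on_subset[OF that sub] cpt]]
    by (force simp: bounded_iff)
  then have "\<exists>C. \<forall>r\<in>{0..T}. \<forall>x\<in>{1..2}. \<bar>k r x\<bar> \<le> C"
    if "continuous_on kernel_dom (\<lambda>(t, x). k t x)" for k :: "real \<Rightarrow> real \<Rightarrow> real"
    using that by fastforce
  then have "\<forall>i. \<exists>C. i \<le> 2 \<longrightarrow> (\<forall>r\<in>{0..T}. \<forall>x\<in>{1..2}. \<bar>bk \<sigma> i r x\<bar> \<le> C)"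
    "\<forall>i. \<exists>C. i \<le> 2 \<longrightarrow> (\<forall>r\<in>{0..T}. \<forall>x\<in>{1..2}. \<bar>hk i r x\<bar> \<le> C)"
    using bk_continuous hk_continuous by blast+
  then obtain C1 C2 where C1: "\<And>i r x. i \<le> 2 \<Longrightarrow> r \<in> {0..T} \<Longrightarrow> x \<in> {1..2} \<Longrightarrow> \<bar>bk \<sigma> i r x\<bar> \<le> C1 i"
    and C2: "\<And>i r x. i \<le> 2 \<Longrightarrow> r \<in> {0..T} \<Longrightarrow> x \<in> {1..2} \<Longrightarrow> \<bar>hk i r x\<bar> \<le> C2 i"
    by metis
  define C where "C = (\<Sum>i\<le>2. \<bar>C1 i\<bar> + \<bar>C2 i\<bar>)"
  have C: "\<bar>C1 i\<bar> + \<bar>C2 i\<bar> \<le> C" "0 \<le> C" if "i \<le> 2" for i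
    unfolding C_def using that by (auto intro!: member_le_sum sum_nonneg)
  show ?thesis
  proof (intro exI[of _ C] conjI allI impI ballI)
    show "0 \<le> C" using C(2)[of 0] by simp
    fix i :: nat and r x :: real assume i: "i \<le> 2" and r: "r \<le> T" and x: "x \<in> {1..2}"
    show "\<bar>bk \<sigma> i r x\<bar> \<le> C"
      using C1[OF i _ x, of r] C[OF i] r by (cases "r \<ge> 0") force+
    show "\<bar>hk i r x\<bar> \<le> C"
      using C2[OF i _ x, of r] C[OF i] r by (cases "r \<ge> 0") force+
  qed
qed

section \<open>Regularity of the layers up to the boundary\<close>

lemma const_le_div_sqrt: "0 < r \<Longrightarrow> r \<le> T \<Longrightarrow> 0 \<le> C \<Longrightarrow> C \<le> C * sqrt T / sqrt r"
  by (simp add: pos_le_divide_eq mult_left_mono)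

lemma bk_0_singular_bound: "0 < r \<Longrightarrow> r \<le> T \<Longrightarrow> x \<in> {0..1} \<Longrightarrow> \<bar>bk \<sigma> 0 r x\<bar> \<le> bk_bd \<sigma> T * sqrt T / sqrt r"
  using const_le_div_sqrt[of r T "bk_bd \<sigma> T"] bk_0_bound[of r T x \<sigma>] by (force simp: bk_bd_def)

lemma hk_0_singular_bound: "0 < r \<Longrightarrow> \<bar>hk 0 r x\<bar> \<le> (1 / sqrt (2 * pi)) / sqrt r"
  using hk_le[of r x] hk_nonneg[of r x] by (simp add: real_sqrt_mult)

lemma continuous_on_time_conv_bk_0:
  assumes "admissible \<psi>"
  shows "continuous_on (UNIV \<times> {0..1}) (\<lambda>(t, x). time_conv (bk \<sigma> 0) \<psi> t x)"
proof (rule time_conv_continuous[OF assms])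
  show "continuous_on ({0<..} \<times> {0..1}) (\<lambda>(r, x). bk \<sigma> 0 r x)"
    by (rule continuous_on_subset[OF bk_continuous_pos]) auto
  show "\<exists>A. \<forall>r\<in>{0<..T}. \<forall>x\<in>{0..1}. \<bar>bk \<sigma> 0 r x\<bar> \<le> A / sqrt r" for T
    using bk_0_singular_bound[of _ T] by (intro exI[of _ "bk_bd \<sigma> T * sqrt T"]) auto
qed simp

lemma continuous_on_time_conv_hk_0:
  assumes "admissible \<psi>"
  shows "continuous_on (UNIV \<times> {0..1}) (\<lambda>(t, x). time_conv (hk 0) \<psi> t x)"
proof (rule time_conv_continuous[OF assms])
  show "continuous_on ({0<..} \<times> {0..1}) (\<lambda>(r, x). hk 0 r x)"
    by (rule continuous_on_subset[OF hk_continuous_pos]) auto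
  show "\<exists>A. \<forall>r\<in>{0<..T}. \<forall>x\<in>{0..1}. \<bar>hk 0 r x\<bar> \<le> A / sqrt r" for T
    using hk_0_singular_bound by (intro exI[of _ "1 / sqrt (2 * pi)"]) auto
qed simp

lemma kernel_measurable:
  assumes "continuous_on ({0<..} \<times> UNIV) (\<lambda>(t, x). k t x)" "\<And>t. t \<le> 0 \<Longrightarrow> k t x = 0"
  shows "(\<lambda>r::real. k r (x::real) :: real) \<in> borel_measurable borel"
proof -
  have "(\<lambda>r. indicator {0<..} r *\<^sub>R k r x) \<in> borel_measurable borel"
  proof (rule borel_measurable_continuous_on_indicator)
    show "continuous_on {0<..} (\<lambda>r. k r x)"
      by (rule continuous_on_compose2[OF assms(1), of _ "\<lambda>r. (r, x)", simplified])
         (auto intro!: continuous_intros)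
  qed simp
  also have "(\<lambda>r. indicator {0<..} r *\<^sub>R k r x) = (\<lambda>r. k r x)"
    using assms(2) by (auto simp: indicator_def fun_eq_iff)
  finally show ?thesis .
qed

lemma integrable_bk_0: "admissible \<psi> \<Longrightarrow> x \<in> {0..1} \<Longrightarrow> integrable lborel (\<lambda>s. bk \<sigma> 0 (t - s) x * \<psi> s)"
  by (rule time_conv_integrable[of \<psi> "bk \<sigma> 0" x t "bk_bd \<sigma> t * sqrt t"])
     (auto intro!: kernel_measurable bk_continuous_pos bk_0_singular_bound)

lemma integrable_hk_0: "admissible \<psi> \<Longrightarrow> integrable lborel (\<lambda>s. hk 0 (t - s) x * \<psi> s)"
  by (rule time_conv_integrable[of \<psi> "hk 0" x t "1 / sqrt (2 * pi)"])
     (auto intro!: kernel_measurable hk_continuous_pos hk_0_singular_bound simp del: divide_divide_eq_left)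

lemma integrable_hk_1:
  assumes "admissible \<psi>" "0 \<le> x"
  shows "integrable lborel (\<lambda>s. hk 1 (t - s) x * \<psi> s)"
proof (cases "x = 0")
  case False
  have "continuous_on {0..t} (\<lambda>r. hk 1 r x)"
    by (rule continuous_on_compose2[OF hk_continuous[of 1], of _ "\<lambda>r. (r, x)", simplified])
       (use assms False in \<open>auto simp: kernel_dom_def intro!: continuous_intros\<close>)
  then obtain C where C: "\<And>r. r \<in> {0..t} \<Longrightarrow> \<bar>hk 1 r x\<bar> \<le> C"
    using compact_imp_bounded[OF compact_continuous_image] by (fastforce simp: bounded_iff)
  show ?thesis
  proof (rule time_conv_integrable[OF assms(1)])
    fix r assume r: "0 < r" "r \<le> t"
    then have "\<bar>hk 1 r x\<bar> \<le> C" using C by simp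
    also have "C \<le> C * sqrt t / sqrt r"
      using r C[of r] by (intro const_le_div_sqrt) auto
    finally show "\<bar>hk 1 r x\<bar> \<le> C * sqrt t / sqrt r" .
  qed (auto intro!: kernel_measurable hk_continuous_pos)
qed (simp add: hk_1)

lemma time_conv_bk_1:
  assumes "admissible \<psi>" "x \<in> {0..1}"
  shows "time_conv (bk \<sigma> 1) \<psi> t x = - 2 * \<sigma> * time_conv (bk \<sigma> 0) \<psi> t x - 2 * time_conv (hk 0) \<psi> t x"
proof -
  have "time_conv (bk \<sigma> 1) \<psi> t x =
      (\<integral>s. - 2 * \<sigma> * (bk \<sigma> 0 (t - s) x * \<psi> s) - 2 * (hk 0 (t - s) x * \<psi> s) \<partial>lborel)"
    unfolding time_conv_def
    by (intro Bochner_Integration.integral_cong) (auto simp: bk_1 algebra_simps)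
  then show ?thesis using integrable_bk_0[OF assms] integrable_hk_0[OF assms(1)] by (simp add: time_conv_def)
qed

lemma time_conv_bk_2:
  assumes "admissible \<psi>" "x \<in> {0..1}"
  shows "time_conv (bk \<sigma> 2) \<psi> t x = 4 * \<sigma>\<^sup>2 * time_conv (bk \<sigma> 0) \<psi> t x + 4 * \<sigma> * time_conv (hk 0) \<psi> t x
    - 2 * time_conv (hk 1) \<psi> t x"
proof -
  have "time_conv (bk \<sigma> 2) \<psi> t x =
      (\<integral>s. 4 * \<sigma>\<^sup>2 * (bk \<sigma> 0 (t - s) x * \<psi> s) + 4 * \<sigma> * (hk 0 (t - s) x * \<psi> s) - 2 * (hk 1 (t - s) x * \<psi> s)
          \<partial>lborel)"
    unfolding time_conv_def
    by (intro Bochner_Integration.integral_cong) (auto simp: bk_2 algebra_simps)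
  then show ?thesis using integrable_bk_0[OF assms] integrable_hk_0[OF assms(1)] integrable_hk_1[of \<psi> x] assms
    by (simp add: time_conv_def)
qed

text \<open>At x = 0 the kernel \<open>hk 1\<close> is 0, so the convolution is 0 there although its
  limit from inside is \<open>- \<psi> t\<close>; the correction removes this discontinuity.\<close>

lemma continuous_on_time_conv_hk_1:
  assumes "admissible \<psi>"
  shows "continuous_on ({0<..} \<times> {0..}) (\<lambda>(t, x). time_conv (hk 1) \<psi> t x - (if x = 0 then \<psi> t else 0))"
    (is "continuous_on _ ?J")
proof -
  \<comment> \<open>\<open>- 2 * hk 1\<close> is the second derivative of \<open>bk 0\<close>, so in
    the open quadrant continuity is inherited from the layer with \<sigma> = 0.\<close>
  have pos: "continuous_on ({0<..} \<times> {0<..}) (\<lambda>(t, x). time_conv (hk 1) \<psi> t x)"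
  proof -
    have "continuous_on ({0<..} \<times> {0<..}) (\<lambda>p. - (1 / 2) * (case p of (t, x) \<Rightarrow> time_conv (bk 0 2) \<psi> t x))"
      by (intro continuous_on_mult continuous_on_const
          continuous_on_subset[OF heat_on_continuous[OF heat_on_time_conv_bk[OF assms]]]) auto
    moreover have "time_conv (bk 0 2) \<psi> t x = - 2 * time_conv (hk 1) \<psi> t x" for t x
    proof -
      have "time_conv (bk 0 2) \<psi> t x = (\<integral>s. - 2 * (hk 1 (t - s) x * \<psi> s) \<partial>lborel)"
        unfolding time_conv_def by (intro Bochner_Integration.integral_cong) (auto simp: bk_2)
      then show ?thesis by (simp add: time_conv_def)
    qed
    ultimately show ?thesis by (simp add: case_prod_beta)
  qed
  show ?thesis
    unfolding continuous_on_def
  proof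
    fix p :: "real \<times> real" assume p: "p \<in> {0<..} \<times> {0..}"
    obtain t x where px: "p = (t, x)" by (cases p)
    show "(?J \<longlongrightarrow> ?J p) (at p within {0<..} \<times> {0..})"
    proof (cases "x = 0")
      case False
      have "continuous_on ({0<..} \<times> {0<..}) ?J"
        by (rule continuous_on_eq[OF pos]) auto
      moreover have "open ({0::real<..} \<times> {0::real<..})" by (intro open_Times) auto
      ultimately have "isCont ?J p" using p False by (auto simp: continuous_on_eq_continuous_at px)
      then show ?thesis unfolding isCont_def by (rule tendsto_within_subset) simp
    next
      case True
      \<comment> \<open>The closed quadrant is split into its interior, where the jump relation
        applies, and the edge x = 0, where \<open>?J\<close> is minus the density.\<close>
      have 1: "(?J \<longlongrightarrow> - \<psi> t) (at (t, 0) within {0<..} \<times> {0<..})"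
        by (rule Lim_transform_eventually[OF time_conv_hk_1_tendsto[OF assms, of t]])
           (use p in \<open>auto simp: px eventually_at_filter intro!: always_eventually\<close>)
      have "isCont \<psi> t"
        using admissible_continuous[OF assms] p px continuous_on_eq_continuous_at[of "{0<..}" \<psi>] by simp
      then have "((\<lambda>q. - \<psi> (fst q)) \<longlongrightarrow> - \<psi> t) (at (t, 0) within {0<..} \<times> {0})"
        by (intro tendsto_minus isCont_tendsto_compose[where g = \<psi>]) (auto intro!: tendsto_eq_intros)
      then have 2: "(?J \<longlongrightarrow> - \<psi> t) (at (t, 0) within {0<..} \<times> {0})"
        by (rule Lim_transform_eventually)
           (auto simp: eventually_at_filter time_conv_def hk_1 intro!: always_eventually)
      have "(?J \<longlongrightarrow> - \<psi> t) (at (t, 0) within ({0<..} \<times> {0<..} \<union> {0<..} \<times> {0}))"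
        unfolding at_within_union by (rule filterlim_sup[OF 1 2])
      moreover have "{0::real<..} \<times> {0<..} \<union> {0::real<..} \<times> {0} = {0::real<..} \<times> {0::real..}" by auto
      ultimately have "(?J \<longlongrightarrow> - \<psi> t) (at (t, 0) within {0<..} \<times> {0..})" by (simp only:)
      moreover have "?J p = - \<psi> t" using True by (simp add: px time_conv_def hk_1)
      ultimately show ?thesis using True px by (simp only:)
    qed
  qed
qed

lemma continuous_on_end_layer:
  assumes "admissible \<psi>" "i \<le> 2"
  shows "continuous_on ({0<..} \<times> {0..1}) (\<lambda>(t, x). end_layer \<sigma> \<psi> i t x)"
proof -
  let ?D = "{0::real<..} \<times> {0::real..1}"
  have b: "continuous_on ?D (\<lambda>p. time_conv (bk \<sigma> 0) \<psi> (fst p) (snd p))"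
    by (rule continuous_on_subset[OF continuous_on_time_conv_bk_0[OF assms(1), unfolded case_prod_beta]]) auto
  have h: "continuous_on ?D (\<lambda>p. time_conv (hk 0) \<psi> (fst p) (snd p))"
    by (rule continuous_on_subset[OF continuous_on_time_conv_hk_0[OF assms(1), unfolded case_prod_beta]]) auto
  have j: "continuous_on ?D (\<lambda>p. time_conv (hk 1) \<psi> (fst p) (snd p) - (if snd p = 0 then \<psi> (fst p) else 0))"
    by (rule continuous_on_subset[OF continuous_on_time_conv_hk_1[OF assms(1), unfolded case_prod_beta]]) auto
  show ?thesis using assms(2)
  proof (elim le_2_cases)
    assume "i = 0" then show ?thesis using b by (simp add: end_layer_def case_prod_beta)
  next
    assume i: "i = 1"
    have "continuous_on ?D (\<lambda>p. - 2 * \<sigma> * time_conv (bk \<sigma> 0) \<psi> (fst p) (snd p)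
        - 2 * time_conv (hk 0) \<psi> (fst p) (snd p))"
      by (intro continuous_intros b h)
    then show ?thesis
      by (rule continuous_on_eq) (auto simp: i end_layer_def time_conv_bk_1[OF assms(1)])
  next
    assume i: "i = 2"
    have "continuous_on ?D (\<lambda>p. 4 * \<sigma>\<^sup>2 * time_conv (bk \<sigma> 0) \<psi> (fst p) (snd p)
        + 4 * \<sigma> * time_conv (hk 0) \<psi> (fst p) (snd p)
        - 2 * (time_conv (hk 1) \<psi> (fst p) (snd p) - (if snd p = 0 then \<psi> (fst p) else 0)))"
      by (intro continuous_intros b h j)
    then show ?thesis
      by (rule continuous_on_eq) (auto simp: i end_layer_def time_conv_bk_2[OF assms(1)])
  qed
qed

lemma continuous_on_end_part:
  assumes "unit_weight f" "admissible \<psi>" "i \<le> 2"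
  shows "continuous_on ({0<..} \<times> {0..1}) (\<lambda>(t, x). end_part \<sigma> f c \<psi> i t x)"
proof -
  have "continuous_on ({0<..} \<times> {0..1}) (\<lambda>p. (case p of (t, x) \<Rightarrow> end_data \<sigma> f c i t x) + (case p of (t,
      x) \<Rightarrow> end_layer \<sigma> \<psi> i t x))"
    by (intro continuous_on_add continuous_on_end_layer assms
        continuous_on_subset[OF heat_on_continuous[OF heat_on_end_data[OF assms(1)] assms(3)]]) auto
  then show ?thesis by (simp add: end_part_def case_prod_beta)
qed

lemma continuous_on_pot_sol:
  assumes "unit_weight f" "admissible \<psi>" "admissible \<phi>" "i \<le> 2"
  shows "continuous_on ({0<..} \<times> {0..1}) (\<lambda>(t, x). pot_sol \<sigma> f c d \<psi> \<phi> i t x)"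
proof -
  have 1: "continuous_on ({0<..} \<times> {0..1}) (\<lambda>p. end_part \<sigma> (refl_unit f) d \<phi> i (fst p) (1 - snd p))"
    by (rule continuous_on_compose2[OF continuous_on_end_part[OF unit_weight_refl_unit[OF assms(1)]
        assms(3,4)], of _ "\<lambda>p. (fst p, 1 - snd p)", simplified])
       (auto intro!: continuous_intros)
  have 2: "continuous_on ({0<..} \<times> {0..1}) (\<lambda>p. free_pot f i (fst p) (snd p))"
    using continuous_on_subset[OF heat_on_continuous[OF heat_on_free_pot[OF assms(1)] assms(4)], of
        "{0<..} \<times> {0..1}"]
    by (auto simp: case_prod_beta)
  have 3: "continuous_on ({0<..} \<times> {0..1}) (\<lambda>p. end_part \<sigma> f c \<psi> i (fst p) (snd p))"
    using continuous_on_end_part[OF assms(1,2,4)] by (simp add: case_prod_beta)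
  show ?thesis
    unfolding pot_sol_def case_prod_beta by (intro continuous_intros 1 2 3)
qed

section \<open>The boundary operator applied to the ansatz\<close>

lemma space_kernel_integrable:
  assumes "unit_weight f" "continuous_on {0..1} k"
  shows "integrable lborel (\<lambda>y. k y * f y)"
  by (rule integrable_bounded_mult[of f 0 1]) (use assms unit_weight_integrable unit_weight_outside in auto)

lemma continuous_on_slice:
  fixes t :: real
  assumes "continuous_on ({0<..} \<times> UNIV) (\<lambda>(t, x). k t x)" "t > 0"
  shows "continuous_on S (\<lambda>y. k t (x + c * y :: real) :: real)"
  by (rule continuous_on_compose2[OF assms(1), of _ "\<lambda>y. (t :: real, x + c * y)", simplified])
     (use assms(2) in \<open>auto intro!: continuous_intros\<close>)

text \<open>The cancellation takes place under the integral for each y, from the parity of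
  \<open>hk 1\<close> and \<open>hk 2\<close> and the first order equation for \<open>bk\<close>.
  The term with \<open>c\<close> vanishes because \<open>hk 1\<close> is 0 at x = 0.\<close>

lemma end_data_bdry_op:
  assumes f: "unit_weight f" and t: "t > 0"
  shows "(free_pot f 2 t 0 + end_data \<sigma> f c 2 t 0) / 2 + \<sigma> * (free_pot f 1 t 0 + end_data \<sigma> f c 1 t 0) = 0"
proof -
  have int: "integrable lborel (\<lambda>y. hk i t (0 - y) * f y)" "integrable lborel (\<lambda>y. hk i t (0 + y) * f y)"
    "integrable lborel (\<lambda>y. bk \<sigma> i t (0 + y) * f y)" if "i \<le> 2" for i
    using continuous_on_slice[OF hk_continuous_pos[OF that] t, where x = 0 and c = "-1"]
      continuous_on_slice[OF hk_continuous_pos[OF that] t, where x = 0 and c = 1]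
      continuous_on_slice[OF bk_continuous_pos[OF that] t, where x = 0 and c = 1]
    by (auto intro!: space_kernel_integrable f)
  have "(\<integral>y. (hk 2 t (0 - y) * f y - hk 2 t (0 + y) * f y - 2 * \<sigma> * (bk \<sigma> 2 t (0 + y) * f y)) / 2
      + \<sigma> * (hk 1 t (0 - y) * f y - hk 1 t (0 + y) * f y - 2 * \<sigma> * (bk \<sigma> 1 t (0 + y) * f y)) \<partial>lborel) = (\<integral>y. 0
          \<partial>(lborel :: real measure))"
    using hk_minus[of 1 t] hk_minus[of 2 t]
    by (intro Bochner_Integration.integral_cong) (auto simp: bk_1 bk_2 algebra_simps power2_eq_square
        add_divide_distrib diff_divide_distrib)
  then have "(free_pot f 2 t 0 - image_pot f 2 t 0 - 2 * \<sigma> * bdry_pot \<sigma> f 2 t 0) / 2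
      + \<sigma> * (free_pot f 1 t 0 - image_pot f 1 t 0 - 2 * \<sigma> * bdry_pot \<sigma> f 1 t 0) = 0"
    unfolding free_pot_def image_pot_def bdry_pot_def using int by simp
  moreover have "bk \<sigma> 2 t 0 / 2 + \<sigma> * bk \<sigma> 1 t 0 = 0"
    by (simp add: bk_1 bk_2 hk_1 algebra_simps power2_eq_square)
  then have "c * (bk \<sigma> 2 t 0 / 2 + \<sigma> * bk \<sigma> 1 t 0) = 0" by simp
  ultimately show ?thesis unfolding end_data_def by (simp add: algebra_simps add_divide_distrib
      diff_divide_distrib)
qed

text \<open>At x = 0 the data terms of the own end vanish and the layer returns its density through
  the jump term. What remains is the other end part at distance 1, with the sign of its first
  derivative reversed by the reflection.\<close>

lemma pot_sol_bdry_op: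
  assumes f: "unit_weight f" and \<psi>: "admissible \<psi>" and t: "t > 0"
  shows "pot_sol \<sigma> f c d \<psi> \<phi> 2 t 0 / 2 + \<sigma> * pot_sol \<sigma> f c d \<psi> \<phi> 1 t 0 =
    \<psi> t + end_part \<sigma> (refl_unit f) d \<phi> 2 t 1 / 2 - \<sigma> * end_part \<sigma> (refl_unit f) d \<phi> 1 t 1"
proof -
  have "time_conv (hk 1) \<psi> t 0 = 0" by (simp add: time_conv_def hk_1)
  then have e: "time_conv (bk \<sigma> 1) \<psi> t 0 = - 2 * \<sigma> * time_conv (bk \<sigma> 0) \<psi> t 0 - 2 * time_conv (hk 0) \<psi> t 0"
    "time_conv (bk \<sigma> 2) \<psi> t 0 = 4 * \<sigma>\<^sup>2 * time_conv (bk \<sigma> 0) \<psi> t 0 + 4 * \<sigma> * time_conv (hk 0) \<psi> t 0"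
    using time_conv_bk_1[OF \<psi>, of 0 \<sigma> t] time_conv_bk_2[OF \<psi>, of 0 \<sigma> t] by simp_all
  have "end_layer \<sigma> \<psi> 2 t 0 / 2 + \<sigma> * end_layer \<sigma> \<psi> 1 t 0 = \<psi> t"
    by (simp add: end_layer_def e field_simps power2_eq_square)
  then show ?thesis
    using end_data_bdry_op[OF f t, of \<sigma> c] by (simp add: pot_sol_def end_part_def algebra_simps
        add_divide_distrib)
qed

text \<open>The Gaussian is even, so at 0 the free potential and its mirror image cancel. The
  remaining kernels are bounded down to time 0, so the value at the end is controlled by the mass of
  \<open>f\<close> without a singular factor in t.\<close>

lemma pot_sol_0_at_0:
  assumes f: "unit_weight f"
  shows "pot_sol \<sigma> f c d \<psi> \<phi> 0 t 0 =
    - 2 * \<sigma> * bdry_pot \<sigma> f 0 t 0 + c * bk \<sigma> 0 t 0 + time_conv (bk \<sigma> 0) \<psi> t 0 + end_part \<sigma> (refl_unit f) d \<phi> 0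
        t 1"
proof -
  have "free_pot f 0 t 0 = image_pot f 0 t 0"
    using hk_minus[of 0 t] by (simp add: free_pot_def image_pot_def)
  then show ?thesis by (simp add: pot_sol_def end_part_def end_data_def end_layer_def)
qed

section \<open>Boundary densities\<close>

definition bounded_kernel :: "(real \<Rightarrow> real \<Rightarrow> real) \<Rightarrow> real \<Rightarrow> bool" where
  "bounded_kernel k x \<longleftrightarrow> continuous_on {0<..} (\<lambda>r. k r x) \<and> (\<forall>r\<le>0. k r x = 0) \<and>
     (\<forall>T. \<exists>C. \<forall>r. 0 < r \<longrightarrow> r \<le> T \<longrightarrow> \<bar>k r x\<bar> \<le> C)"

lemma bounded_kernel_bound:
  assumes "bounded_kernel k x"
  obtains C where "\<And>T. 0 \<le> C T" "\<And>T r. r \<le> T \<Longrightarrow> \<bar>k r x\<bar> \<le> C T"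
proof -
  obtain C where C: "\<And>T r. 0 < r \<Longrightarrow> r \<le> T \<Longrightarrow> \<bar>k r x\<bar> \<le> C T"
  proof -
    have "\<forall>T. \<exists>C. \<forall>r. 0 < r \<longrightarrow> r \<le> T \<longrightarrow> \<bar>k r x\<bar> \<le> C" using assms by (simp add: bounded_kernel_def)
    from choice[OF this] show ?thesis using that by blast
  qed
  have "\<bar>k r x\<bar> \<le> \<bar>C T\<bar>" if "r \<le> T" for r T
    using C[of r T] that assms by (cases "r > 0") (auto simp: bounded_kernel_def)
  then show ?thesis using that[of "\<lambda>T. \<bar>C T\<bar>"] by simp
qed

lemma bounded_kernel_integrable:
  assumes k: "bounded_kernel k x" and \<psi>: "admissible \<psi>"
  shows "integrable lborel (\<lambda>s. k (t - s) x * \<psi> s)"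
proof -
  obtain C where C: "\<And>T. 0 \<le> C T" "\<And>T r. r \<le> T \<Longrightarrow> \<bar>k r x\<bar> \<le> C T"
    using bounded_kernel_bound[OF k] by metis
  show ?thesis
  proof (rule time_conv_integrable[OF \<psi>])
    have "(\<lambda>r. indicator {0<..} r *\<^sub>R k r x) \<in> borel_measurable borel"
      by (rule borel_measurable_continuous_on_indicator) (use k in \<open>auto simp: bounded_kernel_def\<close>)
    also have "(\<lambda>r. indicator {0<..} r *\<^sub>R k r x) = (\<lambda>r. k r x)"
      using k by (auto simp: indicator_def fun_eq_iff bounded_kernel_def)
    finally show "(\<lambda>r. k r x) \<in> borel_measurable borel" .
    show "\<bar>k r x\<bar> \<le> C t * sqrt t / sqrt r" if "0 < r" "r \<le> t" for r
      using C(2)[OF that(2)] const_le_div_sqrt[OF that C(1)[of t]] by linarith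
  qed (use k in \<open>auto simp: bounded_kernel_def\<close>)
qed

lemma time_conv_add:
  assumes "bounded_kernel k x" "admissible \<psi>" "admissible \<phi>"
  shows "time_conv k (\<lambda>s. \<psi> s + \<phi> s) t x = time_conv k \<psi> t x + time_conv k \<phi> t x"
  unfolding time_conv_def distrib_left
  by (intro Bochner_Integration.integral_add bounded_kernel_integrable assms)

lemma time_conv_nonpos:
  assumes "bounded_kernel k x" "admissible \<psi>" "t \<le> 0"
  shows "time_conv k \<psi> t x = 0"
proof -
  have "k (t - s) x * \<psi> s = 0" for s
    using assms by (cases "s \<le> 0") (auto simp: bounded_kernel_def admissible_nonpos)
  then show ?thesis by (simp only: time_conv_def integral_zero)
qed

lemma admissible_time_conv:
  assumes k: "bounded_kernel k x" and \<psi>: "admissible \<psi>"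
  shows "admissible (\<lambda>t. time_conv k \<psi> t x)"
proof -
  obtain C where C: "\<And>T. 0 \<le> C T" "\<And>T r. r \<le> T \<Longrightarrow> \<bar>k r x\<bar> \<le> C T"
    using bounded_kernel_bound[OF k] by metis
  \<comment> \<open>Made constant in y, so that the joint continuity result on
    \<open>UNIV \<times> {x}\<close> can be quoted for a kernel controlled only at the point
    \<open>x\<close>.\<close>
  define l where "l r y = k r x" for r :: real and y :: real
  have "continuous_on (UNIV \<times> {x}) (\<lambda>(t, y). time_conv l \<psi> t y)"
  proof (rule time_conv_continuous[OF \<psi>])
    show "continuous_on ({0<..} \<times> {x}) (\<lambda>(r, x). l r x)"
      unfolding l_def case_prod_beta
      by (rule continuous_on_compose2[of "{0<..}" "\<lambda>r. k r x" _ fst])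
         (use k in \<open>auto simp: bounded_kernel_def intro!: continuous_intros\<close>)
    show "\<exists>A. \<forall>r\<in>{0<..T}. \<forall>x\<in>{x}. \<bar>l r x\<bar> \<le> A / sqrt r" for T
    proof (intro exI[of _ "C T * sqrt T"] ballI)
      fix r y assume "r \<in> {0<..T}"
      then show "\<bar>l r y\<bar> \<le> C T * sqrt T / sqrt r"
        using C(2)[of r T] const_le_div_sqrt[of r T, OF _ _ C(1)[of T]] by (simp add: l_def)
    qed
  qed (use k in \<open>auto simp: l_def bounded_kernel_def\<close>)
  then have "continuous_on UNIV (\<lambda>t. time_conv l \<psi> t x)"
    using continuous_on_compose2[of "UNIV \<times> {x}" "\<lambda>(t, y). time_conv l \<psi> t y" UNIV "\<lambda>t. (t, x)"]
    by (auto simp: continuous_on_Pair)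
  then have c: "continuous_on {0<..} (\<lambda>t. time_conv k \<psi> t x)"
    by (auto simp: l_def time_conv_def intro: continuous_on_subset)
  have b: "\<exists>B. \<forall>s\<le>T. norm (time_conv k \<psi> s x) \<le> B" for T
  proof -
    obtain B where B: "B \<ge> 0" "\<And>s. s \<le> T \<Longrightarrow> norm (\<psi> s) \<le> B" using admissible_bound[OF \<psi>] by metis
    have "norm (time_conv k \<psi> t x) \<le> C T * B * \<bar>T\<bar>" if t: "t \<le> T" for t
    proof (cases "t > 0")
      case True
      have "\<bar>time_conv k \<psi> t x\<bar> \<le> C T * B * t ^ (0 + 1) / real (0 + 1)"
        by (rule time_conv_bound[OF \<psi>]) (use C(2) B t True k in \<open>auto simp: bounded_kernel_def\<close>)
      also have "\<dots> \<le> C T * B * \<bar>T\<bar>" using C(1)[of T] B(1) t by (auto intro!: mult_left_mono)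
      finally show ?thesis by simp
    next
      case False
      then show ?thesis using time_conv_nonpos[OF k \<psi>] C(1)[of T] B(1) by simp
    qed
    then show ?thesis by blast
  qed
  show ?thesis unfolding admissible_def using c b time_conv_nonpos[OF k \<psi>] by blast
qed

section \<open>Closure properties of admissible densities\<close>

lemma admissible_add:
  assumes a: "admissible a" and b: "admissible b"
  shows "admissible (\<lambda>t. a t + b t)"
proof -
  have "admissible (\<lambda>t. 0 - b t)" by (rule admissible_diff[OF _ b]) (auto simp: admissible_def intro: exI[of _
      0])
  from admissible_diff[OF a this] show ?thesis by simp
qed

lemma admissible_cmult:
  fixes a :: "real \<Rightarrow> real"
  assumes a: "admissible a"
  shows "admissible (\<lambda>t. c * a t)"
  unfolding admissible_def
proof (intro conjI allI impI)
  fix R :: real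
  obtain B where B: "\<And>s. s \<le> R \<Longrightarrow> norm (a s) \<le> B" using admissible_bound[OF a] by metis
  have "norm (c * a s) \<le> \<bar>c\<bar> * B" if "s \<le> R" for s
    using B[OF that] by (simp add: abs_mult mult_left_mono)
  then show "\<exists>B. \<forall>s\<le>R. norm (c * a s) \<le> B" by blast
qed (auto intro!: continuous_on_mult admissible_continuous[OF a] simp: admissible_nonpos[OF a])

lemma admissible_Pair:
  assumes a: "admissible a" and b: "admissible b"
  shows "admissible (\<lambda>t. (a t, b t))"
  unfolding admissible_def
proof (intro conjI allI impI)
  fix R :: real
  obtain B where B: "\<And>s. s \<le> R \<Longrightarrow> norm (a s) \<le> B" using admissible_bound[OF a] by metis
  obtain C where C: "\<And>s. s \<le> R \<Longrightarrow> norm (b s) \<le> C" using admissible_bound[OF b] by metis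
  have "norm (a s, b s) \<le> B + C" if "s \<le> R" for s
    using norm_Pair_le[of "a s" "b s"] B[OF that] C[OF that] by linarith
  then show "\<exists>B. \<forall>s\<le>R. norm (a s, b s) \<le> B" by blast
qed (auto intro!: continuous_on_Pair admissible_continuous[OF a] admissible_continuous[OF b]
    simp: admissible_nonpos[OF a] admissible_nonpos[OF b] zero_prod_def)

lemma admissible_fst:
  assumes a: "admissible a"
  shows "admissible (\<lambda>t. fst (a t))"
  unfolding admissible_def
proof (intro conjI allI impI)
  fix R :: real
  obtain B where B: "\<And>s. s \<le> R \<Longrightarrow> norm (a s) \<le> B" using admissible_bound[OF a] by metis
  have "norm (fst (a s)) \<le> B" if "s \<le> R" for s
    using norm_fst_le[where x = "fst (a s)" and y = "snd (a s)"] B[OF that] by simp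
  then show "\<exists>B. \<forall>s\<le>R. norm (fst (a s)) \<le> B" by blast
qed (auto intro!: continuous_on_fst admissible_continuous[OF a] simp: admissible_nonpos[OF a])

lemma admissible_snd:
  assumes a: "admissible a"
  shows "admissible (\<lambda>t. snd (a t))"
  unfolding admissible_def
proof (intro conjI allI impI)
  fix R :: real
  obtain B where B: "\<And>s. s \<le> R \<Longrightarrow> norm (a s) \<le> B" using admissible_bound[OF a] by metis
  have "norm (snd (a s)) \<le> B" if "s \<le> R" for s
    using norm_snd_le[where x = "fst (a s)" and y = "snd (a s)"] B[OF that] by simp
  then show "\<exists>B. \<forall>s\<le>R. norm (snd (a s)) \<le> B" by blast
qed (auto intro!: continuous_on_snd admissible_continuous[OF a] simp: admissible_nonpos[OF a])

section \<open>The linear system for the two densities\<close>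

lemma kernel_slice_continuous:
  assumes "i \<le> 2"
  shows "continuous_on {0<..} (\<lambda>r. bk \<sigma> i r x)"
  by (rule continuous_on_compose2[OF bk_continuous_pos[OF assms], of _ "\<lambda>r. (r, x)", simplified])
     (auto intro!: continuous_intros)

lemma bounded_kernel_bk_0: "x \<in> {0..1} \<Longrightarrow> bounded_kernel (bk \<sigma> 0) x"
  unfolding bounded_kernel_def
proof (intro conjI allI impI kernel_slice_continuous)
  fix T :: real assume "x \<in> {0..1}"
  then have "\<bar>bk \<sigma> 0 r x\<bar> \<le> bk_bd \<sigma> T" if "0 < r" "r \<le> T" for r using bk_0_bound[of r T x \<sigma>] that by simp
  then show "\<exists>C. \<forall>r. 0 < r \<longrightarrow> r \<le> T \<longrightarrow> \<bar>bk \<sigma> 0 r x\<bar> \<le> C" by blast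
qed simp_all

lemma bounded_kernel_bk_1:
  assumes "i \<le> 2"
  shows "bounded_kernel (bk \<sigma> i) 1"
  unfolding bounded_kernel_def
proof (intro conjI allI impI kernel_slice_continuous assms)
  fix T :: real
  from kernel_far_bound[of T \<sigma>] obtain C where "\<forall>i\<le>2. \<forall>r\<le>T. \<forall>x\<in>{1..2}. \<bar>bk \<sigma> i r x\<bar> \<le> C \<and> \<bar>hk i r x\<bar> \<le> C"
    by blast
  then have "\<forall>r. 0 < r \<longrightarrow> r \<le> T \<longrightarrow> \<bar>bk \<sigma> i r 1\<bar> \<le> C" using assms by simp
  then show "\<exists>C. \<forall>r. 0 < r \<longrightarrow> r \<le> T \<longrightarrow> \<bar>bk \<sigma> i r 1\<bar> \<le> C" ..
qed simp

text \<open>The operator \<alpha> v - v'' / 2 + \<sigma> v' applied to \<open>bk\<close>: through it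
  the density of one end acts on the equation of the other. The sign of v' is the one for the
  reflected coordinate.\<close>

definition cross_kernel :: "real \<Rightarrow> real \<Rightarrow> real \<Rightarrow> real \<Rightarrow> real" where
  "cross_kernel \<sigma> \<alpha> r x = \<alpha> * bk \<sigma> 0 r x - bk \<sigma> 2 r x / 2 + \<sigma> * bk \<sigma> 1 r x"

lemma abs_comb_le: "\<bar>a * x - y / 2 + s * z\<bar> \<le> \<bar>a\<bar> * \<bar>x\<bar> + \<bar>y\<bar> + \<bar>s\<bar> * \<bar>z\<bar>" for a x y s z :: real
  unfolding abs_mult[symmetric] by linarith

lemma bounded_kernel_cross: "bounded_kernel (cross_kernel \<sigma> \<alpha>) 1"
  unfolding bounded_kernel_def
proof (intro conjI allI impI)
  show "continuous_on {0<..} (\<lambda>r. cross_kernel \<sigma> \<alpha> r 1)"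
    unfolding cross_kernel_def by (intro continuous_intros kernel_slice_continuous) auto
  fix T :: real
  from kernel_far_bound[of T \<sigma>] obtain C where C: "\<forall>i\<le>2. \<forall>r\<le>T. \<forall>x\<in>{1..2}. \<bar>bk \<sigma> i r x\<bar> \<le> C \<and> \<bar>hk i r x\<bar> \<le> C"
    by blast
  have "\<bar>cross_kernel \<sigma> \<alpha> r 1\<bar> \<le> \<bar>\<alpha>\<bar> * C + C + \<bar>\<sigma>\<bar> * C" if "r \<le> T" for r
  proof -
    have "\<bar>bk \<sigma> i r 1\<bar> \<le> C" if "i \<le> 2" for i using C that \<open>r \<le> T\<close> by simp
    then show ?thesis
      unfolding cross_kernel_def by (intro order_trans[OF abs_comb_le] add_mono mult_left_mono) auto
  qed
  then show "\<exists>C. \<forall>r. 0 < r \<longrightarrow> r \<le> T \<longrightarrow> \<bar>cross_kernel \<sigma> \<alpha> r 1\<bar> \<le> C" by blast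
qed (simp add: cross_kernel_def)

lemma time_conv_cross_kernel:
  assumes "admissible \<phi>"
  shows "time_conv (cross_kernel \<sigma> \<alpha>) \<phi> t 1 =
    \<alpha> * end_layer \<sigma> \<phi> 0 t 1 - end_layer \<sigma> \<phi> 2 t 1 / 2 + \<sigma> * end_layer \<sigma> \<phi> 1 t 1"
proof -
  have i: "integrable lborel (\<lambda>s. bk \<sigma> i (t - s) 1 * \<phi> s)" if "i \<le> 2" for i
    by (rule bounded_kernel_integrable[OF bounded_kernel_bk_1[OF that] assms])
  have "time_conv (cross_kernel \<sigma> \<alpha>) \<phi> t 1 =
     (\<integral>s. \<alpha> * (bk \<sigma> 0 (t - s) 1 * \<phi> s) - (bk \<sigma> 2 (t - s) 1 * \<phi> s) / 2 + \<sigma> * (bk \<sigma> 1 (t - s) 1 * \<phi> s) \<partial>lborel)"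
    unfolding time_conv_def cross_kernel_def
    by (intro Bochner_Integration.integral_cong) (auto simp: algebra_simps)
  then show ?thesis using i by (simp add: end_layer_def time_conv_def)
qed

definition cross_data :: "real \<Rightarrow> real \<Rightarrow> (real \<Rightarrow> real) \<Rightarrow> real \<Rightarrow> real \<Rightarrow> real" where
  "cross_data \<sigma> \<alpha> g d t = \<alpha> * end_data \<sigma> g d 0 t 1 - end_data \<sigma> g d 2 t 1 / 2 + \<sigma> * end_data \<sigma> g d 1 t 1"

text \<open>The part of the right-hand side of \<open>density_eq\<close> that is free of the
  densities: \<alpha> times the value at 0 of the own data terms, and the data terms of the other
  end seen from distance 1.\<close>

definition forcing :: "real \<Rightarrow> real \<Rightarrow> (real \<Rightarrow> real) \<Rightarrow> real \<Rightarrow> real \<Rightarrow> real \<Rightarrow> real" where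
  "forcing \<sigma> \<alpha> f c d t =
     \<alpha> * (- 2 * \<sigma> * bdry_pot \<sigma> f 0 t 0 + c * bk \<sigma> 0 t 0) + cross_data \<sigma> \<alpha> (refl_unit f) d t"

text \<open>Only kernels bounded down to time 0 occur: \<open>bk \<sigma> 0\<close> for the own end,
  and all orders at distances between 1 and 2 for the other end. Hence the bound is linear in the L1
  size and the end values, with one constant for all data.\<close>

lemma forcing_bound:
  "\<exists>K\<ge>0. \<forall>f c d t. unit_weight f \<longrightarrow> t \<le> R \<longrightarrow> \<bar>forcing \<sigma> \<alpha> f c d t\<bar> \<le> K * (mass f + \<bar>c\<bar> + \<bar>d\<bar>)"
proof -
  from kernel_far_bound[of R \<sigma>] obtain C where C0: "C \<ge> 0"
    and C: "\<forall>i\<le>2. \<forall>r\<le>R. \<forall>x\<in>{1..2}. \<bar>bk \<sigma> i r x\<bar> \<le> C \<and> \<bar>hk i r x\<bar> \<le> C"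
    by blast
  define b where "b = bk_bd \<sigma> \<bar>R\<bar>"
  have b: "b \<ge> 0" by (simp add: b_def bk_bd_def)
  \<comment> \<open>One summand for each term of \<open>end_data\<close>: the image, the boundary
    potential with its factor 2 |\<sigma>|, and the point term.\<close>
  define C' where "C' = C + 2 * \<bar>\<sigma>\<bar> * C + C"
  have C': "C' \<ge> 0" using C0 by (simp add: C'_def)
  define K where "K = \<bar>\<alpha>\<bar> * (2 * \<bar>\<sigma>\<bar> * b + b) + (\<bar>\<alpha>\<bar> * C' + C' + \<bar>\<sigma>\<bar> * C')"
  have "\<bar>forcing \<sigma> \<alpha> f c d t\<bar> \<le> K * (mass f + \<bar>c\<bar> + \<bar>d\<bar>)" if f: "unit_weight f" and t: "t \<le> R" for f c d t
  proof -
    define N where "N = mass f + \<bar>c\<bar> + \<bar>d\<bar>"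
    have N: "mass f \<le> N" "\<bar>c\<bar> \<le> N" "\<bar>d\<bar> \<le> N" "0 \<le> N" using mass_nonneg[of f] by (auto simp: N_def)
    have bk0: "\<bar>bk \<sigma> 0 t y\<bar> \<le> b" if "0 \<le> y" "y \<le> 2" for y
      unfolding b_def by (rule bk_0_bound) (use that t in auto)
    have "\<bar>bdry_pot \<sigma> f 0 t 0\<bar> \<le> b * mass f"
      unfolding bdry_pot_def by (rule space_integral_bound[OF f]) (auto intro: bk0)
    also have "\<dots> \<le> b * N" using b N by (intro mult_left_mono)
    finally have 1: "\<bar>bdry_pot \<sigma> f 0 t 0\<bar> \<le> b * N" .
    have 2: "\<bar>c * bk \<sigma> 0 t 0\<bar> \<le> b * N"
      unfolding abs_mult mult.commute[of b] using N bk0[of 0] by (intro mult_mono) auto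
    have 3: "\<bar>end_data \<sigma> (refl_unit f) d i t 1\<bar> \<le> C' * N" if i: "i \<le> 2" for i
    proof -
      have "\<bar>image_pot (refl_unit f) i t 1\<bar> \<le> C * mass (refl_unit f)"
        unfolding image_pot_def by (rule space_integral_bound[OF unit_weight_refl_unit[OF f]])
            (use C i t in auto)
      also have "\<dots> \<le> C * N" unfolding mass_refl_unit using C0 N by (intro mult_left_mono)
      finally have a: "\<bar>image_pot (refl_unit f) i t 1\<bar> \<le> C * N" .
      have "\<bar>bdry_pot \<sigma> (refl_unit f) i t 1\<bar> \<le> C * mass (refl_unit f)"
        unfolding bdry_pot_def by (rule space_integral_bound[OF unit_weight_refl_unit[OF f]])
            (use C i t in auto)
      also have "\<dots> \<le> C * N" unfolding mass_refl_unit using C0 N by (intro mult_left_mono)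
      finally have "2 * \<bar>\<sigma>\<bar> * \<bar>bdry_pot \<sigma> (refl_unit f) i t 1\<bar> \<le> 2 * \<bar>\<sigma>\<bar> * (C * N)"
        by (intro mult_left_mono) auto
      then have b: "\<bar>2 * \<sigma> * bdry_pot \<sigma> (refl_unit f) i t 1\<bar> \<le> 2 * \<bar>\<sigma>\<bar> * (C * N)"
        by (simp add: abs_mult)
      have c: "\<bar>d * bk \<sigma> i t 1\<bar> \<le> C * N"
        unfolding abs_mult mult.commute[of C] using N C i t by (intro mult_mono) auto
      have "\<bar>end_data \<sigma> (refl_unit f) d i t 1\<bar> \<le> C * N + 2 * \<bar>\<sigma>\<bar> * (C * N) + C * N"
        unfolding end_data_def using a b c by linarith
      then show ?thesis by (simp add: C'_def algebra_simps)
    qed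
    have "\<bar>\<alpha> * (- 2 * \<sigma> * bdry_pot \<sigma> f 0 t 0 + c * bk \<sigma> 0 t 0)\<bar> \<le> \<bar>\<alpha>\<bar> * (2 * \<bar>\<sigma>\<bar> * (b * N) + b * N)"
      unfolding abs_mult[of \<alpha>]
    proof (intro mult_left_mono)
      have "\<bar>2 * \<sigma> * bdry_pot \<sigma> f 0 t 0\<bar> \<le> 2 * \<bar>\<sigma>\<bar> * (b * N)"
        using mult_left_mono[OF 1, of "2 * \<bar>\<sigma>\<bar>"] by (simp add: abs_mult)
      then show "\<bar>- 2 * \<sigma> * bdry_pot \<sigma> f 0 t 0 + c * bk \<sigma> 0 t 0\<bar> \<le> 2 * \<bar>\<sigma>\<bar> * (b * N) + b * N"
        using 2 by linarith
    qed simp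
    moreover have "\<bar>cross_data \<sigma> \<alpha> (refl_unit f) d t\<bar> \<le> \<bar>\<alpha>\<bar> * (C' * N) + C' * N + \<bar>\<sigma>\<bar> * (C' * N)"
      unfolding cross_data_def by (intro order_trans[OF abs_comb_le] add_mono mult_left_mono 3) auto
    ultimately have "\<bar>forcing \<sigma> \<alpha> f c d t\<bar> \<le> \<bar>\<alpha>\<bar> * (2 * \<bar>\<sigma>\<bar> * (b * N) + b * N) + (\<bar>\<alpha>\<bar> * (C' * N) + C' * N
        + \<bar>\<sigma>\<bar> * (C' * N))"
      unfolding forcing_def by linarith
    also have "\<dots> = K * N" by (simp add: K_def algebra_simps)
    finally show ?thesis by (simp add: N_def)
  qed
  moreover have "K \<ge> 0" unfolding K_def using b C' by simp
  ultimately show ?thesis by blast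
qed

lemma heat_on_time_slice:
  assumes "heat_on ({0<..} \<times> UNIV) k" "i \<le> 2"
  shows "continuous_on {0<..} (\<lambda>t. k i t x)"
  by (rule continuous_on_compose2[OF heat_on_continuous[OF assms], of _ "\<lambda>r. (r, x)", simplified])
     (auto intro!: continuous_intros)

lemma admissible_forcing:
  assumes f: "unit_weight f"
  shows "admissible (forcing \<sigma> \<alpha> f c d)"
  unfolding admissible_def
proof (intro conjI allI impI)
  show "continuous_on {0<..} (forcing \<sigma> \<alpha> f c d)"
    unfolding forcing_def[abs_def] cross_data_def
    by (intro continuous_intros heat_on_time_slice[OF heat_on_bdry_pot] heat_on_time_slice[OF
        heat_on_end_data]
        kernel_slice_continuous f unit_weight_refl_unit) auto
  fix R :: real
  from forcing_bound[of R \<sigma> \<alpha>] obtain K where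
    "\<forall>f c d t. unit_weight f \<longrightarrow> t \<le> R \<longrightarrow> \<bar>forcing \<sigma> \<alpha> f c d t\<bar> \<le> K * (mass f + \<bar>c\<bar> + \<bar>d\<bar>)" by blast
  then have "\<forall>s\<le>R. norm (forcing \<sigma> \<alpha> f c d s) \<le> K * (mass f + \<bar>c\<bar> + \<bar>d\<bar>)" using f by simp
  then show "\<exists>B. \<forall>s\<le>R. norm (forcing \<sigma> \<alpha> f c d s) \<le> B" ..
qed (simp add: forcing_def cross_data_def end_data_def image_pot_def bdry_pot_def)

text \<open>For t > 0 and under the assumptions of \<open>pot_sol_bdry_op\<close> this says v'' / 2
  + \<sigma> v' = \<alpha> v at x = 0 for the ansatz v. The right end uses the same relation with
  the datum reflected and both the end values and the densities exchanged.\<close>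

definition density_eq where
  "density_eq \<sigma> \<alpha> f c d \<psi> \<phi> \<longleftrightarrow> (\<forall>t. \<psi> t = \<alpha> * pot_sol \<sigma> f c d \<psi> \<phi> 0 t 0
     - end_part \<sigma> (refl_unit f) d \<phi> 2 t 1 / 2 + \<sigma> * end_part \<sigma> (refl_unit f) d \<phi> 1 t 1)"

text \<open>Inserting the ansatz leaves convolutions with bounded kernels only: the own density
  through \<open>bk \<sigma> 0\<close> at distance 0, the other one through
  \<open>cross_kernel\<close> at distance 1. So the pair solves an equation of the second kind. The
  order of quantifiers matters: \<open>K\<close> is chosen before the datum.\<close>

lemma densities_exist:
  "\<exists>K. \<forall>f c d. unit_weight f \<longrightarrow> (\<exists>\<psi> \<phi>. admissible \<psi> \<and> admissible \<phi> \<and>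
     density_eq \<sigma> \<alpha> f c d \<psi> \<phi> \<and>
     density_eq \<sigma> \<beta> (refl_unit f) d c \<phi> \<psi> \<and>
     (\<forall>R t. 0 < t \<longrightarrow> t \<le> R \<longrightarrow>
        \<bar>\<psi> t\<bar> \<le> K R * (mass f + \<bar>c\<bar> + \<bar>d\<bar>) \<and> \<bar>\<phi> t\<bar> \<le> K R * (mass f + \<bar>c\<bar> + \<bar>d\<bar>)))"
proof -
  note bk0 = bounded_kernel_bk_0[of 0 \<sigma>, simplified]
  obtain C0 where C0: "\<And>T. 0 \<le> C0 T" "\<And>T r. r \<le> T \<Longrightarrow> \<bar>bk \<sigma> 0 r 0\<bar> \<le> C0 T"
    using bounded_kernel_bound[OF bk0] by metis
  obtain CA where CA: "\<And>T. 0 \<le> CA T" "\<And>T r. r \<le> T \<Longrightarrow> \<bar>cross_kernel \<sigma> \<alpha> r 1\<bar> \<le> CA T"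
    using bounded_kernel_bound[OF bounded_kernel_cross] by metis
  obtain CB where CB: "\<And>T. 0 \<le> CB T" "\<And>T r. r \<le> T \<Longrightarrow> \<bar>cross_kernel \<sigma> \<beta> r 1\<bar> \<le> CB T"
    using bounded_kernel_bound[OF bounded_kernel_cross] by metis
  obtain KA where KA: "\<And>R. 0 \<le> KA R" "\<And>R f c d t. unit_weight f \<Longrightarrow> t \<le> R \<Longrightarrow>
      \<bar>forcing \<sigma> \<alpha> f c d t\<bar> \<le> KA R * (mass f + \<bar>c\<bar> + \<bar>d\<bar>)"
    using forcing_bound[of _ \<sigma> \<alpha>] by metis
  obtain KB where KB: "\<And>R. 0 \<le> KB R" "\<And>R f c d t. unit_weight f \<Longrightarrow> t \<le> R \<Longrightarrow>
      \<bar>forcing \<sigma> \<beta> f c d t\<bar> \<le> KB R * (mass f + \<bar>c\<bar> + \<bar>d\<bar>)"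
    using forcing_bound[of _ \<sigma> \<beta>] by metis
  \<comment> \<open>The norm of a pair is at most the sum of the absolute values of its components,
    hence the sum of the bounds for the two rows of the system.\<close>
  define M where "M R = (\<bar>\<alpha>\<bar> * C0 R + CA R) + (\<bar>\<beta>\<bar> * C0 R + CB R)" for R
  define T where "T \<theta> t = (\<alpha> * time_conv (bk \<sigma> 0) (\<lambda>s. fst (\<theta> s)) t 0
      + time_conv (cross_kernel \<sigma> \<alpha>) (\<lambda>s. snd (\<theta> s)) t 1,
      \<beta> * time_conv (bk \<sigma> 0) (\<lambda>s. snd (\<theta> s)) t 0 + time_conv (cross_kernel \<sigma> \<beta>) (\<lambda>s. fst (\<theta> s)) t 1)"
    for \<theta> :: "real \<Rightarrow> real \<times> real" and t
  show ?thesis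
  proof (rule exI[of _ "\<lambda>R. (KA R + KB R) * exp (M R * R)"], intro allI impI)
    fix f :: "real \<Rightarrow> real" and c d :: real assume f: "unit_weight f"
    define N where "N = mass f + \<bar>c\<bar> + \<bar>d\<bar>"
    have N': "mass (refl_unit f) + \<bar>d\<bar> + \<bar>c\<bar> = N" by (simp add: N_def mass_refl_unit)
    define F where "F t = (forcing \<sigma> \<alpha> f c d t, forcing \<sigma> \<beta> (refl_unit f) d c t)" for t
    have "\<exists>\<theta>. admissible \<theta> \<and> (\<forall>t. \<theta> t = F t + T \<theta> t) \<and>
      (\<forall>R B. (\<forall>s\<in>{0<..R}. norm (F s) \<le> B) \<longrightarrow> (\<forall>t\<in>{0<..R}. norm (\<theta> t) \<le> B * exp (M R * R)))"
    proof (rule volterra_exists)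
      show "admissible (T \<theta>)" if "admissible \<theta>" for \<theta>
        unfolding T_def[abs_def]
        by (intro admissible_Pair admissible_add admissible_cmult admissible_time_conv admissible_fst
            admissible_snd that bk0 bounded_kernel_cross)
      show "T (\<lambda>t. \<theta> t + \<xi> t) = (\<lambda>t. T \<theta> t + T \<xi> t)" if "admissible \<theta>" "admissible \<xi>" for \<theta> \<xi>
        unfolding T_def
        by (simp add: time_conv_add[OF bk0] time_conv_add[OF bounded_kernel_cross] admissible_fst
            admissible_snd that algebra_simps)
      show "0 \<le> M R" for R unfolding M_def using C0 CA CB by simp
      show "admissible F" unfolding F_def[abs_def] by (intro admissible_Pair admissible_forcing f
          unit_weight_refl_unit)
      fix \<theta> :: "real \<Rightarrow> real \<times> real" and R B t :: real and n :: nat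
      assume \<theta>: "admissible \<theta>" and B: "\<And>s. 0 < s \<Longrightarrow> s \<le> R \<Longrightarrow> norm (\<theta> s) \<le> B * s ^ n" and t: "0 < t" "t \<le> R"
      define E where "E = B * t ^ (n + 1) / real (n + 1)"
      have tc: "\<bar>time_conv k \<xi> t x\<bar> \<le> C * E"
        if "bounded_kernel k x" "admissible \<xi>" "\<And>r. r \<le> R \<Longrightarrow> \<bar>k r x\<bar> \<le> C" "\<And>s. \<bar>\<xi> s\<bar> \<le> norm (\<theta> s)" for k \<xi> x C
      proof -
        have "\<bar>time_conv k \<xi> t x\<bar> \<le> C * B * t ^ (n + 1) / real (n + 1)"
        proof (rule time_conv_bound[OF that(2)])
          show "\<bar>\<xi> s\<bar> \<le> B * s ^ n" if s: "0 < s" "s \<le> t" for s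
            using B[of s] \<open>\<And>s. \<bar>\<xi> s\<bar> \<le> norm (\<theta> s)\<close>[of s] s t by linarith
        qed (use that t in \<open>auto simp: bounded_kernel_def\<close>)
        then show ?thesis by (simp add: E_def mult.assoc)
      qed
      have n1: "\<bar>fst (\<theta> s)\<bar> \<le> norm (\<theta> s)" "\<bar>snd (\<theta> s)\<bar> \<le> norm (\<theta> s)" for s
        using norm_fst_le[where x = "fst (\<theta> s)" and y = "snd (\<theta> s)"] norm_snd_le[where x = "fst (\<theta> s)"
            and y = "snd (\<theta> s)"] by auto
      have "norm (T \<theta> t) \<le> \<bar>fst (T \<theta> t)\<bar> + \<bar>snd (T \<theta> t)\<bar>"
        using norm_Pair_le[of "fst (T \<theta> t)" "snd (T \<theta> t)"] by simp
      also have "\<bar>fst (T \<theta> t)\<bar> \<le> \<bar>\<alpha>\<bar> * (C0 R * E) + CA R * E"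
        unfolding T_def fst_conv
        by (intro order_trans[OF abs_triangle_ineq] add_mono)
           (auto simp: abs_mult intro!: mult_left_mono tc bk0 bounded_kernel_cross admissible_fst
               admissible_snd \<theta> C0 CA n1)
      also have "\<bar>snd (T \<theta> t)\<bar> \<le> \<bar>\<beta>\<bar> * (C0 R * E) + CB R * E"
        unfolding T_def snd_conv
        by (intro order_trans[OF abs_triangle_ineq] add_mono)
           (auto simp: abs_mult intro!: mult_left_mono tc bk0 bounded_kernel_cross admissible_fst
               admissible_snd \<theta> C0 CB n1)
      finally have "norm (T \<theta> t) \<le> M R * E" by (simp add: M_def algebra_simps)
      then show "norm (T \<theta> t) \<le> M R * B * t ^ (n + 1) / (n + 1)" by (simp add: E_def mult.assoc)
    qed
    then obtain \<theta> where \<theta>: "admissible \<theta>" "\<And>t. \<theta> t = F t + T \<theta> t"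
      "\<And>R B t. (\<forall>s\<in>{0<..R}. norm (F s) \<le> B) \<Longrightarrow> t \<in> {0<..R} \<Longrightarrow> norm (\<theta> t) \<le> B * exp (M R * R)"
      by blast
    define \<psi> where "\<psi> t = fst (\<theta> t)" for t
    define \<phi> where "\<phi> t = snd (\<theta> t)" for t
    have admissible: "admissible \<psi>" "admissible \<phi>" unfolding \<psi>_def[abs_def] \<phi>_def[abs_def]
        by (intro admissible_fst admissible_snd \<theta>)+
    have e1: "\<psi> t = forcing \<sigma> \<alpha> f c d t + (\<alpha> * time_conv (bk \<sigma> 0) \<psi> t 0 + time_conv (cross_kernel \<sigma> \<alpha>) \<phi> t 1)"
        for t
      using arg_cong[OF \<theta>(2)[of t], of fst] by (simp add: F_def T_def \<psi>_def[abs_def] \<phi>_def[abs_def])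
    have e2: "\<phi> t = forcing \<sigma> \<beta> (refl_unit f) d c t + (\<beta> * time_conv (bk \<sigma> 0) \<phi> t 0
        + time_conv (cross_kernel \<sigma> \<beta>) \<psi> t 1)" for t
      using arg_cong[OF \<theta>(2)[of t], of snd] by (simp add: F_def T_def \<psi>_def[abs_def] \<phi>_def[abs_def])
    have F_le: "norm (F s) \<le> (KA R + KB R) * N" if "s \<le> R" for s R
    proof -
      have "norm (F s) \<le> norm (forcing \<sigma> \<alpha> f c d s) + norm (forcing \<sigma> \<beta> (refl_unit f) d c s)"
        unfolding F_def by (rule norm_Pair_le)
      also have "\<dots> \<le> KA R * N + KB R * N"
        using KA(2)[OF f that, of c d] KB(2)[OF unit_weight_refl_unit[OF f] that, of d c] unfolding N'
            by (simp add: N_def)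
      finally show ?thesis by (simp add: algebra_simps)
    qed
    show "\<exists>\<psi> \<phi>. admissible \<psi> \<and> admissible \<phi> \<and>
     density_eq \<sigma> \<alpha> f c d \<psi> \<phi> \<and>
     density_eq \<sigma> \<beta> (refl_unit f) d c \<phi> \<psi> \<and>
     (\<forall>R t. 0 < t \<longrightarrow> t \<le> R \<longrightarrow>
        \<bar>\<psi> t\<bar> \<le> (KA R + KB R) * exp (M R * R) * (mass f + \<bar>c\<bar> + \<bar>d\<bar>) \<and>
        \<bar>\<phi> t\<bar> \<le> (KA R + KB R) * exp (M R * R) * (mass f + \<bar>c\<bar> + \<bar>d\<bar>))"
    proof (rule exI[of _ \<psi>], rule exI[of _ \<phi>], intro conjI admissible allI impI)
      show "density_eq \<sigma> \<alpha> f c d \<psi> \<phi>"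
        unfolding density_eq_def
        by (rule allI, subst e1) (simp add: time_conv_cross_kernel[OF admissible(2)] pot_sol_0_at_0[OF f]
            forcing_def cross_data_def
            end_part_def algebra_simps add_divide_distrib)
      show "density_eq \<sigma> \<beta> (refl_unit f) d c \<phi> \<psi>"
        unfolding density_eq_def
        by (rule allI, subst e2) (simp add: time_conv_cross_kernel[OF admissible(1)] pot_sol_0_at_0[OF
            unit_weight_refl_unit[OF f]] forcing_def cross_data_def
            end_part_def algebra_simps add_divide_distrib)
    next
      fix R t :: real assume t: "0 < t" "t \<le> R"
      have "norm (\<theta> t) \<le> ((KA R + KB R) * N) * exp (M R * R)"
        by (rule \<theta>(3)) (use F_le t in auto)
      then have le: "norm (\<theta> t) \<le> (KA R + KB R) * exp (M R * R) * N" by (simp add: mult_ac)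
      show "\<bar>\<psi> t\<bar> \<le> (KA R + KB R) * exp (M R * R) * (mass f + \<bar>c\<bar> + \<bar>d\<bar>)"
        using norm_fst_le[where x = "fst (\<theta> t)" and y = "snd (\<theta> t)"] le by (simp add: \<psi>_def N_def)
      show "\<bar>\<phi> t\<bar> \<le> (KA R + KB R) * exp (M R * R) * (mass f + \<bar>c\<bar> + \<bar>d\<bar>)"
        using norm_snd_le[where x = "fst (\<theta> t)" and y = "snd (\<theta> t)"] le by (simp add: \<phi>_def N_def)
    qed
  qed
qed

section \<open>Bounds and initial behaviour\<close>

text \<open>The density is even, so the sum of the tails at z and - z has derivative 0; its value at
  0 is 1.\<close>

lemma normal_tail_minus: "normal_tail (- z) = 1 - normal_tail z"
proof -
  have "((\<lambda>z. normal_tail z + normal_tail (- z)) has_real_derivative 0) (at z)" for z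
  proof -
    have "((\<lambda>z. normal_tail (- z)) has_real_derivative (- std_normal_density (- z)) * (- 1)) (at z)"
      by (rule DERIV_chain2[OF has_real_derivative_normal_tail]) (auto intro!: derivative_eq_intros)
    from DERIV_add[OF has_real_derivative_normal_tail this]
    show ?thesis by (simp add: std_normal_density_def)
  qed
  then have "(\<lambda>z. normal_tail z + normal_tail (- z)) z = (\<lambda>z. normal_tail z + normal_tail (- z)) 0"
    by (intro DERIV_isconst_all) auto
  then show ?thesis by (simp add: normal_tail_0)
qed

lemma normal_tail_antimono: "a \<le> b \<Longrightarrow> normal_tail b \<le> normal_tail a"
proof -
  assume "a \<le> b"
  moreover have "0 \<le> integral {a..b} std_normal_density"
    by (rule integral_nonneg) (auto simp: std_normal_density_def intro!: integrable_continuous_interval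
        continuous_intros)
  ultimately show ?thesis using normal_tail_diff[of a b] by linarith
qed

text \<open>Half of \<open>bk 0 0 t\<close>, taken at x - y, is a Gaussian tail and an
  antiderivative of the kernel in y.\<close>

lemma hk_space_integral:
  assumes t: "t > 0" and "a \<le> b"
  shows "has_bochner_integral lborel (\<lambda>y. hk 0 t (x - y) * indicator {a..b} y)
    (normal_tail ((x - b) / sqrt t) - normal_tail ((x - a) / sqrt t))"
proof -
  have "has_bochner_integral lborel (\<lambda>y. hk 0 t (x - y) * indicator {a..b} y)
     (bk 0 0 t (x - b) / 2 - bk 0 0 t (x - a) / 2)"
  proof (rule has_bochner_integral_FTC_Icc_nonneg)
    show "(\<lambda>y. hk 0 t (x - y)) \<in> borel_measurable borel"
      using continuous_on_slice[OF hk_continuous_pos[of 0] t, where x = x and c = "-1"]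
      by (intro borel_measurable_continuous_onI) simp
    show "((\<lambda>y. bk 0 0 t (x - y) / 2) has_real_derivative hk 0 t (x - y)) (at y)" for y
    proof -
      have "((\<lambda>y. bk 0 0 t (x - y)) has_real_derivative bk 0 1 t (x - y) * (- 1)) (at y)"
        by (rule DERIV_chain2[OF bk_0_has_derivative_x]) (auto intro!: derivative_eq_intros)
      from DERIV_cdivide[OF this, of 2] show ?thesis by (simp add: bk_1)
    qed
  qed (use assms hk_nonneg in auto)
  then show ?thesis using t by (simp add: bk_0_0)
qed

text \<open>The kernel is nonnegative with mass at most 1, so the supremum of the datum is a bound
  that does not deteriorate as t tends to 0.\<close>

lemma hk_space_integral_le:
  assumes f: "unit_weight f" "\<And>y. \<bar>f y\<bar> \<le> M" and t: "t > 0"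
  shows "\<bar>\<integral>y. hk 0 t (x - y) * f y \<partial>lborel\<bar> \<le> M"
proof -
  have M: "M \<ge> 0" using f(2)[of 0] by linarith
  note hb = hk_space_integral[OF t zero_le_one, of x]
  have "norm (\<integral>y. hk 0 t (x - y) * f y \<partial>lborel) \<le> (\<integral>y. M * (hk 0 t (x - y) * indicator {0..1} y) \<partial>lborel)"
  proof (rule norm_integral_le_AE)
    show "integrable lborel (\<lambda>y. M * (hk 0 t (x - y) * indicator {0..1} y))"
      using hb by (auto simp: has_bochner_integral_iff)
    show "AE y in lborel. norm (hk 0 t (x - y) * f y) \<le> M * (hk 0 t (x - y) * indicator {0..1} y)"
    proof (rule AE_I2)
      fix y
      show "norm (hk 0 t (x - y) * f y) \<le> M * (hk 0 t (x - y) * indicator {0..1} y)"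
      proof (cases "y \<in> {0<..<1}")
        case True
        have "hk 0 t (x - y) * \<bar>f y\<bar> \<le> hk 0 t (x - y) * M" by (intro mult_left_mono f hk_nonneg)
        then show ?thesis using True hk_nonneg[of t "x - y"] by (simp add: abs_mult mult.commute)
      next
        case False
        then show ?thesis using unit_weight_outside[OF f(1) False] M hk_nonneg[of t "x - y"] by simp
      qed
    qed
  qed
  also have "\<dots> = M * (normal_tail ((x - 1) / sqrt t) - normal_tail (x / sqrt t))"
    using hb by (simp add: has_bochner_integral_iff)
  also have "\<dots> \<le> M * 1"
    using normal_tail_le_1[of "(x - 1) / sqrt t"] normal_tail_nonneg[of "x / sqrt t"] M
    by (intro mult_left_mono) linarith+
  finally show ?thesis by simp
qed

lemma image_pot_eq: "image_pot f 0 t x = (\<integral>y. hk 0 t (- x - y) * f y \<partial>lborel)"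
proof -
  have "hk 0 t (x + y) = hk 0 t (- x - y)" for y using hk_minus[of 0 t "x + y"] by simp
  then show ?thesis by (simp add: image_pot_def)
qed

lemma end_layer_0_bound:
  assumes \<psi>: "admissible \<psi>" and B: "\<And>s. 0 < s \<Longrightarrow> s \<le> t \<Longrightarrow> \<bar>\<psi> s\<bar> \<le> B" and t: "0 < t" and x: "x \<in> {0..1}"
  shows "\<bar>end_layer \<sigma> \<psi> 0 t x\<bar> \<le> bk_bd \<sigma> t * B * t"
proof -
  have "\<bar>time_conv (bk \<sigma> 0) \<psi> t x\<bar> \<le> bk_bd \<sigma> t * B * t ^ (0 + 1) / real (0 + 1)"
    by (rule time_conv_bound[OF \<psi>]) (use bk_0_bound[of _ t x \<sigma>] B t x in auto)
  then show ?thesis by (simp add: end_layer_def)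
qed

lemma bdry_pot_0_bound:
  assumes f: "unit_weight f" and t: "t \<le> T" "0 \<le> T" and x: "x \<in> {0..1}"
  shows "\<bar>bdry_pot \<sigma> f 0 t x\<bar> \<le> bk_bd \<sigma> T * mass f"
  unfolding bdry_pot_def by (rule space_integral_bound[OF f]) (use bk_0_bound[of t T _ \<sigma>] x t in auto)

lemma hk_pot_bound:
  assumes f: "unit_weight f" and t: "t > 0"
  shows "\<bar>free_pot f 0 t x\<bar> \<le> 1 / sqrt (2 * pi * t) * mass f"
    and "\<bar>image_pot f 0 t x\<bar> \<le> 1 / sqrt (2 * pi * t) * mass f"
proof -
  have h: "\<bar>hk 0 t y\<bar> \<le> 1 / sqrt (2 * pi * t)" for y using hk_le[OF t, of y] hk_nonneg[of t y] by linarith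
  show "\<bar>free_pot f 0 t x\<bar> \<le> 1 / sqrt (2 * pi * t) * mass f"
    unfolding free_pot_def by (rule space_integral_bound[OF f]) (rule h)
  show "\<bar>image_pot f 0 t x\<bar> \<le> 1 / sqrt (2 * pi * t) * mass f"
    unfolding image_pot_def by (rule space_integral_bound[OF f]) (rule h)
qed

lemma end_part_0_le:
  assumes "\<bar>image_pot f 0 t x\<bar> \<le> a" "\<bar>bdry_pot \<sigma> f 0 t x\<bar> \<le> b" "\<bar>bk \<sigma> 0 t x\<bar> \<le> b'" "\<bar>end_layer \<sigma> \<psi> 0 t x\<bar> \<le> e"
  shows "\<bar>end_part \<sigma> f c \<psi> 0 t x\<bar> \<le> a + 2 * \<bar>\<sigma>\<bar> * b + \<bar>c\<bar> * b' + e"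
proof -
  have "\<bar>2 * \<sigma> * bdry_pot \<sigma> f 0 t x\<bar> \<le> 2 * \<bar>\<sigma>\<bar> * b"
    using mult_left_mono[OF assms(2), of "2 * \<bar>\<sigma>\<bar>"] by (simp add: abs_mult)
  moreover have "\<bar>c * bk \<sigma> 0 t x\<bar> \<le> \<bar>c\<bar> * b'"
    using mult_left_mono[OF assms(3), of "\<bar>c\<bar>"] by (simp add: abs_mult)
  ultimately show ?thesis using assms(1,4) unfolding end_part_def end_data_def by linarith
qed

text \<open>The bound by the L1 size at a fixed time. \<open>K t\<close> contains 1 / sqrt (2 pi t)
  and blows up as t tends to 0, so boundedness down to t = 0 is obtained separately, from the
  supremum of the datum.\<close>

lemma pot_sol_0_bound:
  "\<exists>K. \<forall>t>0. 0 \<le> K t \<and> (\<forall>f c d \<psi> \<phi> B. \<forall>x\<in>{0..1}. unit_weight f \<longrightarrow> admissible \<psi> \<longrightarrow> admissible \<phi> \<longrightarrow>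
     (\<forall>s. 0 < s \<longrightarrow> s \<le> t \<longrightarrow> \<bar>\<psi> s\<bar> \<le> B \<and> \<bar>\<phi> s\<bar> \<le> B) \<longrightarrow>
     \<bar>pot_sol \<sigma> f c d \<psi> \<phi> 0 t x\<bar> \<le> K t * (mass f + \<bar>c\<bar> + \<bar>d\<bar> + B))"
proof -
  define h where "h t = 1 / sqrt (2 * pi * t)" for t
  \<comment> \<open>Three Gaussian potentials (one free, two images), two boundary potentials with
    factor 2 |\<sigma>| each, two point terms and two layers.\<close>
  define K where "K t = 3 * h t + 4 * \<bar>\<sigma>\<bar> * bk_bd \<sigma> t + 2 * bk_bd \<sigma> t + 2 * bk_bd \<sigma> t * t" for t
  have b0: "0 \<le> bk_bd \<sigma> t" for t by (simp add: bk_bd_def)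
  have "\<bar>pot_sol \<sigma> f c d \<psi> \<phi> 0 t x\<bar> \<le> K t * (mass f + \<bar>c\<bar> + \<bar>d\<bar> + B)"
    if t: "t > 0" and x: "x \<in> {0..1}" and f: "unit_weight f" and \<psi>: "admissible \<psi>" "admissible \<phi>"
      and B: "\<And>s. 0 < s \<Longrightarrow> s \<le> t \<Longrightarrow> \<bar>\<psi> s\<bar> \<le> B \<and> \<bar>\<phi> s\<bar> \<le> B"
    for f c d \<psi> \<phi> B t x
  proof -
    define N where "N = mass f + \<bar>c\<bar> + \<bar>d\<bar> + B"
    have B0: "0 \<le> B" using B[of t] t by force
    then have N: "mass f \<le> N" "\<bar>c\<bar> \<le> N" "\<bar>d\<bar> \<le> N" "B \<le> N" using mass_nonneg[of f] by (auto simp: N_def)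
    have ep: "\<bar>end_part \<sigma> g c' \<xi> 0 t y\<bar> \<le> h t * N + 2 * \<bar>\<sigma>\<bar> * (bk_bd \<sigma> t * N) + bk_bd \<sigma> t * N
        + bk_bd \<sigma> t * t * N"
      if g: "unit_weight g" "mass g = mass f" "\<bar>c'\<bar> \<le> N" "admissible \<xi>" "\<And>s. 0 < s \<Longrightarrow> s \<le> t \<Longrightarrow>
          \<bar>\<xi> s\<bar> \<le> B" "y \<in> {0..1}" for g c' \<xi> y
    proof -
      have "\<bar>end_part \<sigma> g c' \<xi> 0 t y\<bar> \<le> h t * mass f + 2 * \<bar>\<sigma>\<bar> * (bk_bd \<sigma> t * mass f) + \<bar>c'\<bar> * bk_bd \<sigma> t
          + bk_bd \<sigma> t * B * t"
        using hk_pot_bound(2)[OF g(1) t, of y] bdry_pot_0_bound[OF g(1) order_refl less_imp_le[OF t] g(6), of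
            \<sigma>]
          bk_0_bound[of t t y \<sigma>] t g(6)
        by (intro end_part_0_le end_layer_0_bound[OF g(4,5) t g(6)]) (auto simp: h_def g(2))
      also have "\<dots> \<le> h t * N + 2 * \<bar>\<sigma>\<bar> * (bk_bd \<sigma> t * N) + bk_bd \<sigma> t * N + bk_bd \<sigma> t * t * N"
      proof (intro add_mono)
        show "h t * mass f \<le> h t * N" using N t by (intro mult_left_mono) (auto simp: h_def)
        show "2 * \<bar>\<sigma>\<bar> * (bk_bd \<sigma> t * mass f) \<le> 2 * \<bar>\<sigma>\<bar> * (bk_bd \<sigma> t * N)" using N b0
            by (intro mult_left_mono) auto
        show "\<bar>c'\<bar> * bk_bd \<sigma> t \<le> bk_bd \<sigma> t * N" using g(3) b0[of t] mult_left_mono[OF g(3) b0[of t]]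
            by (simp add: mult.commute)
        have "bk_bd \<sigma> t * t * B \<le> bk_bd \<sigma> t * t * N" using N b0 t by (intro mult_left_mono) auto
        then show "bk_bd \<sigma> t * B * t \<le> bk_bd \<sigma> t * t * N" by (simp add: mult_ac)
      qed
      finally show ?thesis .
    qed
    have 1: "\<bar>free_pot f 0 t x\<bar> \<le> h t * N"
      using hk_pot_bound(1)[OF f t, of x] mult_left_mono[OF N(1), of "h t"] t by (simp add: h_def)
    have 2: "\<bar>end_part \<sigma> f c \<psi> 0 t x\<bar> \<le> h t * N + 2 * \<bar>\<sigma>\<bar> * (bk_bd \<sigma> t * N) + bk_bd \<sigma> t * N
        + bk_bd \<sigma> t * t * N"
      by (rule ep) (use f \<psi> B N x in auto)
    have 3: "\<bar>end_part \<sigma> (refl_unit f) d \<phi> 0 t (1 - x)\<bar> \<le> h t * N + 2 * \<bar>\<sigma>\<bar> * (bk_bd \<sigma> t * N) + bk_bd \<sigma> t * N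
        + bk_bd \<sigma> t * t * N"
      by (rule ep) (use unit_weight_refl_unit[OF f] \<psi> B N x in \<open>auto simp: mass_refl_unit\<close>)
    define E where "E = h t * N + 2 * \<bar>\<sigma>\<bar> * (bk_bd \<sigma> t * N) + bk_bd \<sigma> t * N + bk_bd \<sigma> t * t * N"
    have "\<bar>pot_sol \<sigma> f c d \<psi> \<phi> 0 t x\<bar> \<le> h t * N + (E + E)"
    proof -
      have "\<bar>a + b + b'\<bar> \<le> \<bar>a\<bar> + (\<bar>b\<bar> + \<bar>b'\<bar>)" for a b b' :: real by linarith
      then show ?thesis
        unfolding pot_sol_def power_0 mult_1_left
        by (rule order_trans) (intro add_mono 1 2[folded E_def] 3[folded E_def])
    qed
    also have "\<dots> = K t * N" by (simp add: K_def E_def algebra_simps)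
    finally show ?thesis by (simp add: N_def)
  qed
  moreover have "0 \<le> K t" if "t > 0" for t
    unfolding K_def h_def using b0[of t] that by (intro add_nonneg_nonneg mult_nonneg_nonneg) auto
  ultimately show ?thesis by (intro exI[of _ K]) blast
qed

text \<open>\<open>U_space\<close> asks for boundedness down to t = 0. The Gaussian potentials are
  bounded there by the supremum of \<open>f\<close>, and the kernels of all other terms are bounded
  themselves.\<close>

lemma pot_sol_0_bounded:
  assumes f: "unit_weight f" and \<psi>: "admissible \<psi>" "admissible \<phi>"
  shows "\<exists>K. \<forall>t\<in>{0<..1}. \<forall>x\<in>{0..1}. \<bar>pot_sol \<sigma> f c d \<psi> \<phi> 0 t x\<bar> \<le> K"
proof -
  obtain M where M: "\<And>y. \<bar>f y\<bar> \<le> M" using f by (auto simp: unit_weight_def)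
  have b0: "0 \<le> bk_bd \<sigma> t" for t by (simp add: bk_bd_def)
  have ep: "\<exists>K. \<forall>t\<in>{0<..1}. \<forall>x\<in>{0..1}. \<bar>end_part \<sigma> g c \<xi> 0 t x\<bar> \<le> K"
    if g: "unit_weight g" "\<And>y. \<bar>g y\<bar> \<le> M" "admissible \<xi>" for g c \<xi>
  proof -
    obtain B where B: "B \<ge> 0" "\<And>s. s \<le> 1 \<Longrightarrow> norm (\<xi> s) \<le> B" using admissible_bound[OF g(3)] by metis
    have "\<bar>end_part \<sigma> g c \<xi> 0 t x\<bar> \<le> M + 2 * \<bar>\<sigma>\<bar> * (bk_bd \<sigma> 1 * mass g) + \<bar>c\<bar> * bk_bd \<sigma> 1 + bk_bd \<sigma> 1 * B"
      if t: "t \<in> {0<..1}" and x: "x \<in> {0..1}" for t x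
    proof (rule end_part_0_le)
      show "\<bar>image_pot g 0 t x\<bar> \<le> M"
        unfolding image_pot_eq by (rule hk_space_integral_le) (use g t in auto)
      show "\<bar>bdry_pot \<sigma> g 0 t x\<bar> \<le> bk_bd \<sigma> 1 * mass g" by (rule bdry_pot_0_bound) (use g t x in auto)
      show "\<bar>bk \<sigma> 0 t x\<bar> \<le> bk_bd \<sigma> 1" by (rule bk_0_bound) (use t x in auto)
      have "\<bar>end_layer \<sigma> \<xi> 0 t x\<bar> \<le> bk_bd \<sigma> t * B * t"
        by (rule end_layer_0_bound) (use g t x B in auto)
      also have "\<dots> \<le> bk_bd \<sigma> 1 * B * 1"
      proof (intro mult_mono)
        have "\<sigma>\<^sup>2 * t \<le> \<sigma>\<^sup>2 * 1" using t by (intro mult_left_mono) auto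
        then show "bk_bd \<sigma> t \<le> bk_bd \<sigma> 1" by (simp add: bk_bd_def)
      qed (use B t b0 in auto)
      finally show "\<bar>end_layer \<sigma> \<xi> 0 t x\<bar> \<le> bk_bd \<sigma> 1 * B" by simp
    qed
    then show ?thesis by blast
  qed
  obtain K1 where K1: "\<And>t x. t \<in> {0<..1} \<Longrightarrow> x \<in> {0..1} \<Longrightarrow> \<bar>end_part \<sigma> f c \<psi> 0 t x\<bar> \<le> K1"
    using ep[OF f M \<psi>(1), of c] by blast
  have "\<And>y. \<bar>refl_unit f y\<bar> \<le> M" using M by (simp add: refl_unit_def)
  then obtain K2 where K2: "\<And>t x. t \<in> {0<..1} \<Longrightarrow> x \<in> {0..1} \<Longrightarrow> \<bar>end_part \<sigma> (refl_unit f) d \<phi> 0 t x\<bar> \<le> K2"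
    using ep[OF unit_weight_refl_unit[OF f] _ \<psi>(2), of d] by blast
  have "\<bar>pot_sol \<sigma> f c d \<psi> \<phi> 0 t x\<bar> \<le> M + K1 + K2" if "t \<in> {0<..1}" "x \<in> {0..1}" for t x
  proof -
    have "\<bar>free_pot f 0 t x\<bar> \<le> M" unfolding free_pot_def by (rule hk_space_integral_le) (use f M that in auto)
    then show ?thesis
      using K1[OF that] K2[of t "1 - x"] that unfolding pot_sol_def by simp
  qed
  then show ?thesis by blast
qed

section \<open>Decay away from the ends and initial values\<close>

lemma bk_0_le:
  assumes "0 \<le> \<delta>" "\<delta> \<le> z" "z \<le> 2"
  shows "bk \<sigma> 0 t z \<le> exp (4 * \<bar>\<sigma>\<bar>) * bk \<sigma> 0 t \<delta>"
proof (cases "t > 0")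
  case True
  \<comment> \<open>For \<sigma> < 0 the exponential factor of \<open>bk\<close> grows in space;
    over a length of at most 2 this costs a factor of at most exp (4 |\<sigma>|), while the tail
    decreases.\<close>
  have "- (\<sigma> * (z - \<delta>)) \<le> \<bar>\<sigma>\<bar> * 2"
    using mult_mono[of "\<bar>\<sigma>\<bar>" "\<bar>\<sigma>\<bar>" "\<bar>z - \<delta>\<bar>" 2] assms abs_mult[of \<sigma> "z - \<delta>"] by linarith
  then have "exp (2 * \<sigma>\<^sup>2 * t - 2 * \<sigma> * z) \<le> exp (4 * \<bar>\<sigma>\<bar>) * exp (2 * \<sigma>\<^sup>2 * t - 2 * \<sigma> * \<delta>)"
    unfolding exp_add[symmetric] by (simp add: algebra_simps)
  moreover have "normal_tail ((z - 2 * \<sigma> * t) / sqrt t) \<le> normal_tail ((\<delta> - 2 * \<sigma> * t) / sqrt t)"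
    using assms True by (intro normal_tail_antimono divide_right_mono) auto
  ultimately have "exp (2 * \<sigma>\<^sup>2 * t - 2 * \<sigma> * z) * normal_tail ((z - 2 * \<sigma> * t) / sqrt t)
      \<le> (exp (4 * \<bar>\<sigma>\<bar>) * exp (2 * \<sigma>\<^sup>2 * t - 2 * \<sigma> * \<delta>)) * normal_tail ((\<delta> - 2 * \<sigma> * t) / sqrt t)"
    by (intro mult_mono normal_tail_nonneg) auto
  then show ?thesis using True by (simp add: bk_0 mult_ac)
qed simp

lemma kernel_tendsto_0_at_0:
  assumes "\<delta> > 0"
  shows "((\<lambda>t. hk 0 t \<delta>) \<longlongrightarrow> 0) (at_right 0)" "((\<lambda>t. bk \<sigma> 0 t \<delta>) \<longlongrightarrow> 0) (at_right 0)"
proof -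
  have "continuous_on UNIV (\<lambda>t. hk 0 t \<delta>)" "continuous_on UNIV (\<lambda>t. bk \<sigma> 0 t \<delta>)"
    by (rule continuous_on_compose2[OF hk_continuous[of 0], of _ "\<lambda>r. (r, \<delta>)", simplified]
        continuous_on_compose2[OF bk_continuous[of 0], of _ "\<lambda>r. (r, \<delta>)", simplified],
        use assms in \<open>auto simp: kernel_dom_def intro!: continuous_intros\<close>)+
  then have "isCont (\<lambda>t. hk 0 t \<delta>) 0" "isCont (\<lambda>t. bk \<sigma> 0 t \<delta>) 0"
    by (simp_all add: continuous_on_eq_continuous_at)
  then show "((\<lambda>t. hk 0 t \<delta>) \<longlongrightarrow> 0) (at_right 0)" "((\<lambda>t. bk \<sigma> 0 t \<delta>) \<longlongrightarrow> 0) (at_right 0)"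
    unfolding isCont_def by (auto intro: tendsto_within_subset)
qed

lemma end_layer_0_decay:
  assumes \<psi>: "admissible \<psi>"
  shows "\<exists>B. \<forall>t\<in>{0<..1}. \<forall>x\<in>{0..1}. \<bar>end_layer \<sigma> \<psi> 0 t x\<bar> \<le> B * t"
proof -
  obtain B where B: "B \<ge> 0" "\<And>s. s \<le> 1 \<Longrightarrow> norm (\<psi> s) \<le> B" using admissible_bound[OF \<psi>] by metis
  have "\<bar>end_layer \<sigma> \<psi> 0 t x\<bar> \<le> (bk_bd \<sigma> 1 * B) * t" if t: "t \<in> {0<..1}" and x: "x \<in> {0..1}" for t x
  proof -
    have "\<bar>end_layer \<sigma> \<psi> 0 t x\<bar> \<le> bk_bd \<sigma> t * B * t"
      by (rule end_layer_0_bound) (use \<psi> t x B in auto)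
    also have "\<dots> \<le> bk_bd \<sigma> 1 * B * t"
    proof (intro mult_right_mono)
      have "\<sigma>\<^sup>2 * t \<le> \<sigma>\<^sup>2 * 1" using t by (intro mult_left_mono) auto
      then show "bk_bd \<sigma> t \<le> bk_bd \<sigma> 1" by (simp add: bk_bd_def)
    qed (use B t in auto)
    finally show ?thesis .
  qed
  then show ?thesis by blast
qed

text \<open>For x >= \<delta> every kernel of this end is taken at distance at least \<delta>, where
  up to a constant it is dominated by its value at \<delta>; these values tend to 0 with t. The
  layer is of order t.\<close>

lemma end_part_0_decay:
  assumes f: "unit_weight f" and \<psi>: "admissible \<psi>" and \<delta>: "0 < \<delta>"
  shows "\<exists>g. (g \<longlongrightarrow> 0) (at_right 0) \<and> (\<forall>t\<in>{0<..1}. \<forall>x\<in>{\<delta>..1}. \<bar>end_part \<sigma> f c \<psi> 0 t x\<bar> \<le> g t)"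
proof -
  obtain B where B: "\<forall>t\<in>{0<..1}. \<forall>x\<in>{0..1}. \<bar>end_layer \<sigma> \<psi> 0 t x\<bar> \<le> B * t"
    using end_layer_0_decay[OF \<psi>] by blast
  define e where "e t = exp (4 * \<bar>\<sigma>\<bar>) * bk \<sigma> 0 t \<delta>" for t
  define g where "g t = hk 0 t \<delta> * mass f + 2 * \<bar>\<sigma>\<bar> * (e t * mass f) + \<bar>c\<bar> * e t + B * t" for t
  have "(g \<longlongrightarrow> 0) (at_right 0)"
    unfolding g_def e_def by (auto intro!: tendsto_eq_intros kernel_tendsto_0_at_0 \<delta>)
  moreover have "\<bar>end_part \<sigma> f c \<psi> 0 t x\<bar> \<le> g t" if t: "t \<in> {0<..1}" and x: "x \<in> {\<delta>..1}" for t x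
    unfolding g_def
  proof (rule end_part_0_le)
    show "\<bar>image_pot f 0 t x\<bar> \<le> hk 0 t \<delta> * mass f"
      unfolding image_pot_def
    proof (rule space_integral_bound[OF f])
      fix y :: real assume "0 < y" "y < 1"
      then show "\<bar>hk 0 t (x + y)\<bar> \<le> hk 0 t \<delta>"
        using hk_antimono[of \<delta> "x + y" t] hk_nonneg[of t "x + y"] x \<delta> by simp
    qed
    show "\<bar>bdry_pot \<sigma> f 0 t x\<bar> \<le> e t * mass f"
      unfolding bdry_pot_def e_def
    proof (rule space_integral_bound[OF f])
      fix y :: real assume "0 < y" "y < 1"
      then show "\<bar>bk \<sigma> 0 t (x + y)\<bar> \<le> exp (4 * \<bar>\<sigma>\<bar>) * bk \<sigma> 0 t \<delta>"
        using bk_0_le[of \<delta> "x + y" \<sigma> t] bk_0_nonneg[of \<sigma> t "x + y"] x \<delta> by simp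
    qed
    show "\<bar>bk \<sigma> 0 t x\<bar> \<le> e t"
      unfolding e_def using bk_0_le[of \<delta> x \<sigma> t] bk_0_nonneg[of \<sigma> t x] x \<delta> by simp
    show "\<bar>end_layer \<sigma> \<psi> 0 t x\<bar> \<le> B * t" using B t x \<delta> by simp
  qed
  ultimately show ?thesis by blast
qed

lemma tendsto_0_by_bound:
  fixes h g :: "real \<Rightarrow> real"
  assumes "(g \<longlongrightarrow> 0) (at_right 0)" "\<And>t. t \<in> {0<..1} \<Longrightarrow> \<bar>h t\<bar> \<le> g t"
  shows "(h \<longlongrightarrow> 0) (at_right 0)"
proof (rule Lim_null_comparison[OF _ assms(1)])
  show "\<forall>\<^sub>F t in at_right 0. norm (h t) \<le> g t"
    using eventually_at_right_less[of 0] eventually_at_right[of 0 1] assms(2)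
    by (auto simp: eventually_at_right[of 0 1] intro!: exI[of _ 1])
qed

text \<open>At x = 0 the free and image potentials have cancelled. The boundary potential tends to 0
  by dominated convergence, the layer is of order t, the other end is at distance 1, and
  \<open>bk \<sigma> 0 t 0\<close> tends to 1.\<close>

lemma pot_sol_tendsto_left:
  assumes f: "unit_weight f" and \<psi>: "admissible \<psi>" "admissible \<phi>"
  shows "((\<lambda>t. pot_sol \<sigma> f c d \<psi> \<phi> 0 t 0) \<longlongrightarrow> c) (at_right 0)"
proof -
  have 1: "((\<lambda>t. bdry_pot \<sigma> f 0 t 0) \<longlongrightarrow> 0) (at_right 0)"
    unfolding tendsto_at_iff_sequentially comp_def
  proof (intro allI impI)
    fix X :: "nat \<Rightarrow> real" assume X: "\<forall>i. X i \<in> {0<..} - {0}" "X \<longlonglongrightarrow> 0"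
    from convergent_imp_Bseq[OF convergentI[OF X(2)]] obtain T where T: "T > 0" "\<And>n. \<bar>X n\<bar> \<le> T"
      by (auto simp: Bseq_def)
    have "(\<lambda>n. \<integral>y. bk \<sigma> 0 (X n) (0 + y) * f y \<partial>lborel) \<longlonglongrightarrow> (\<integral>y. 0 \<partial>(lborel :: real measure))"
    proof (rule integral_dominated_convergence[where w = "\<lambda>y. bk_bd \<sigma> T * \<bar>f y\<bar>"])
      show "integrable lborel (\<lambda>y. bk_bd \<sigma> T * \<bar>f y\<bar>)" using unit_weight_integrable[OF f] by simp
      show "(\<lambda>y. bk \<sigma> 0 (X n) (0 + y) * f y) \<in> borel_measurable lborel" for n
        using X(1) continuous_on_slice[OF bk_continuous_pos[of 0 \<sigma>], of "X n" _ 0 1]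
        by (intro borel_measurable_integrable space_kernel_integrable f) auto
      show "AE y in lborel. norm (bk \<sigma> 0 (X n) (0 + y) * f y) \<le> bk_bd \<sigma> T * \<bar>f y\<bar>" for n
      proof (rule AE_I2)
        fix y show "norm (bk \<sigma> 0 (X n) (0 + y) * f y) \<le> bk_bd \<sigma> T * \<bar>f y\<bar>"
        proof (cases "y \<in> {0<..<1}")
          case True
          have "\<bar>bk \<sigma> 0 (X n) (0 + y)\<bar> \<le> bk_bd \<sigma> T"
            using T(2)[of n] T(1) True by (intro bk_0_bound) auto
          then show ?thesis by (simp add: abs_mult mult_right_mono)
        qed (simp add: unit_weight_outside[OF f])
      qed
      show "AE y in lborel. (\<lambda>n. bk \<sigma> 0 (X n) (0 + y) * f y) \<longlonglongrightarrow> 0"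
      proof (rule AE_I2)
        fix y show "(\<lambda>n. bk \<sigma> 0 (X n) (0 + y) * f y) \<longlonglongrightarrow> 0"
        proof (cases "y \<in> {0<..<1}")
          case True
          then have "((\<lambda>t. bk \<sigma> 0 t y) \<longlongrightarrow> 0) (at_right 0)" by (intro kernel_tendsto_0_at_0) auto
          then have "(\<lambda>n. bk \<sigma> 0 (X n) y) \<longlonglongrightarrow> 0"
            using X unfolding tendsto_at_iff_sequentially comp_def by simp
          then show ?thesis by (auto intro!: tendsto_mult_left_zero)
        qed (simp add: unit_weight_outside[OF f])
      qed
    qed auto
    then show "(\<lambda>n. bdry_pot \<sigma> f 0 (X n) 0) \<longlonglongrightarrow> 0" by (simp add: bdry_pot_def)
  qed
  have 2: "((\<lambda>t. bk \<sigma> 0 t 0) \<longlongrightarrow> 1) (at_right 0)"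
  proof -
    \<comment> \<open>At x = 0 the argument of the tail simplifies to - 2 \<sigma> sqrt t, which is
      continuous at t = 0.\<close>
    have "continuous_on UNIV (\<lambda>t. 2 * exp (2 * \<sigma>\<^sup>2 * t) * normal_tail (- (2 * \<sigma> * sqrt t)))"
      by (intro continuous_intros)
    then have "((\<lambda>t. 2 * exp (2 * \<sigma>\<^sup>2 * t) * normal_tail (- (2 * \<sigma> * sqrt t))) \<longlongrightarrow> 2 * exp (2 * \<sigma>\<^sup>2 * 0) *
        normal_tail (- (2 * \<sigma> * sqrt 0))) (at 0)"
      by (simp only: continuous_on_eq_continuous_at[OF open_UNIV] isCont_def UNIV_I)
    then have "((\<lambda>t. 2 * exp (2 * \<sigma>\<^sup>2 * t) * normal_tail (- (2 * \<sigma> * sqrt t))) \<longlongrightarrow> 1) (at 0)"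
      by (simp add: normal_tail_0)
    from tendsto_within_subset[OF this subset_UNIV]
    have "((\<lambda>t. 2 * exp (2 * \<sigma>\<^sup>2 * t) * normal_tail (- (2 * \<sigma> * sqrt t))) \<longlongrightarrow> 1) (at_right 0)" .
    then show ?thesis
    proof (rule Lim_transform_eventually)
      have "2 * exp (2 * \<sigma>\<^sup>2 * t) * normal_tail (- (2 * \<sigma> * sqrt t)) = bk \<sigma> 0 t 0" if "t > 0" for t
      proof -
        have "(0 - 2 * \<sigma> * t) / sqrt t = - (2 * \<sigma> * sqrt t)"
          using that real_div_sqrt[of t] by (simp add: mult.assoc flip: times_divide_eq_right)
        then show ?thesis using that by (simp add: bk_0)
      qed
      then show "\<forall>\<^sub>F t in at_right 0. 2 * exp (2 * \<sigma>\<^sup>2 * t) * normal_tail (- (2 * \<sigma> * sqrt t)) = bk \<sigma> 0 t 0"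
        by (auto simp: eventually_at_filter)
    qed
  qed
  obtain B where B: "\<forall>t\<in>{0<..1}. \<forall>x\<in>{0..1}. \<bar>end_layer \<sigma> \<psi> 0 t x\<bar> \<le> B * t"
    using end_layer_0_decay[OF \<psi>(1)] by blast
  have 3: "((\<lambda>t. end_layer \<sigma> \<psi> 0 t 0) \<longlongrightarrow> 0) (at_right 0)"
    by (rule tendsto_0_by_bound[of "\<lambda>t. B * t"]) (use B in \<open>auto intro!: tendsto_eq_intros\<close>)
  obtain g where g: "(g \<longlongrightarrow> 0) (at_right 0)"
    "\<forall>t\<in>{0<..1}. \<forall>x\<in>{1..1}. \<bar>end_part \<sigma> (refl_unit f) d \<phi> 0 t x\<bar> \<le> g t"
    using end_part_0_decay[OF unit_weight_refl_unit[OF f] \<psi>(2) zero_less_one] by blast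
  have 4: "((\<lambda>t. end_part \<sigma> (refl_unit f) d \<phi> 0 t 1) \<longlongrightarrow> 0) (at_right 0)"
    by (rule tendsto_0_by_bound[OF g(1)]) (use g(2) in auto)
  have "((\<lambda>t. - 2 * \<sigma> * bdry_pot \<sigma> f 0 t 0 + c * bk \<sigma> 0 t 0 + end_layer \<sigma> \<psi> 0 t 0
      + end_part \<sigma> (refl_unit f) d \<phi> 0 t 1)
      \<longlongrightarrow> - 2 * \<sigma> * 0 + c * 1 + 0 + 0) (at_right 0)"
    by (intro tendsto_intros 1 2 3 4)
  then show ?thesis by (simp add: pot_sol_0_at_0[OF f] end_layer_def)
qed

lemma pot_sol_tendsto_right:
  assumes f: "unit_weight f" and \<psi>: "admissible \<psi>" "admissible \<phi>"
  shows "((\<lambda>t. pot_sol \<sigma> f c d \<psi> \<phi> 0 t 1) \<longlongrightarrow> d) (at_right 0)"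
  using pot_sol_tendsto_left[OF unit_weight_refl_unit[OF f] \<psi>(2,1), of \<sigma> d c] pot_sol_refl_unit[of 0 \<sigma> f c d \<psi>
      \<phi> _ 0]
  by simp

lemma compact_subset_open_unit:
  fixes K :: "real set"
  assumes "compact K" "K \<subseteq> {0<..<1}"
  obtains \<delta> where "0 < \<delta>" "\<delta> < 1 / 2" "K \<subseteq> {\<delta>..1 - \<delta>}"
proof (cases "K = {}")
  case False
  obtain a where a: "a \<in> K" "\<And>x. x \<in> K \<Longrightarrow> a \<le> x" using compact_attains_inf[OF assms(1) False] by blast
  obtain b where b: "b \<in> K" "\<And>x. x \<in> K \<Longrightarrow> x \<le> b" using compact_attains_sup[OF assms(1) False] by blast
  show ?thesis
  proof (rule that)
    have "0 < a" "b < 1" using a(1) b(1) assms(2) by auto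
    \<comment> \<open>The cap 1 / 4 keeps the margin below 1 / 2; the same value serves for the
      empty set.\<close>
    then show "0 < min (min a (1 - b)) (1 / 4)" by simp
    show "min (min a (1 - b)) (1 / 4) < 1 / 2" by (simp add: min_def)
    show "K \<subseteq> {min (min a (1 - b)) (1 / 4)..1 - min (min a (1 - b)) (1 / 4)}"
    proof
      fix x assume "x \<in> K"
      then have "a \<le> x" "x \<le> b" using a(2) b(2) by auto
      then show "x \<in> {min (min a (1 - b)) (1 / 4)..1 - min (min a (1 - b)) (1 / 4)}" by (auto simp: min_def)
    qed
  qed
qed (use that[of "1 / 4"] in auto)

text \<open>Three errors, each uniform over \<open>K\<close>: the oscillation of the datum within
  distance \<open>\<eta>\<close>, the kernel at distance \<open>\<eta>\<close>, and the Gaussian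
  mass outside the unit interval, which is at most twice the tail at \<delta> / sqrt t.\<close>

lemma free_pot_uniform_limit:
  assumes f: "unit_weight f" and c: "continuous_on {0<..<1} f" and K: "compact K" "K \<subseteq> {0<..<1}"
  shows "uniform_limit K (\<lambda>t. free_pot f 0 t) f (at_right 0)"
proof (rule uniform_limitI)
  fix e :: real assume e: "e > 0"
  obtain \<delta> where \<delta>: "0 < \<delta>" "\<delta> < 1 / 2" "K \<subseteq> {\<delta>..1 - \<delta>}" using compact_subset_open_unit[OF K] by metis
  obtain M where M: "\<And>y. \<bar>f y\<bar> \<le> M" using f by (auto simp: unit_weight_def)
  have M0: "M \<ge> 0" using M[of 0] by linarith
  \<comment> \<open>A point within \<open>\<eta>\<close> <= \<delta> / 2 of \<open>K\<close> may
    leave \<open>K\<close> but stays in this larger compact interval.\<close>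
  have "uniformly_continuous_on {\<delta> / 2..1 - \<delta> / 2} f"
    by (rule compact_uniformly_continuous[OF continuous_on_subset[OF c]]) (use \<delta> in auto)
  then obtain d where d: "d > 0" "\<And>x y. x \<in> {\<delta> / 2..1 - \<delta> / 2} \<Longrightarrow> y \<in> {\<delta> / 2..1 - \<delta> / 2} \<Longrightarrow> dist y x < d \<Longrightarrow>
      dist (f y) (f x) < e / 2"
    using e unfolding uniformly_continuous_on_def by (metis half_gt_zero)
  define \<eta> where "\<eta> = min d (\<delta> / 2)"
  have \<eta>: "\<eta> > 0" "\<eta> \<le> d" "\<eta> \<le> \<delta> / 2" using d \<delta> by (auto simp: \<eta>_def)
  define R where "R t = e / 2 + 2 * M * hk 0 t \<eta> * (1 - 0) + M * bk 0 0 t \<delta>" for t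
  have main: "dist (free_pot f 0 t x) (f x) \<le> R t" if t: "t > 0" and x: "x \<in> K" for t x
  proof -
    have x': "x \<in> {\<delta>..1 - \<delta>}" using x \<delta> by auto
    define k where "k y = hk 0 t (x - y) * indicator {0..1} y" for y
    define m where "m = normal_tail ((x - 1) / sqrt t) - normal_tail ((x - 0) / sqrt t)"
    have hb: "has_bochner_integral lborel k m"
      unfolding k_def[abs_def] m_def using hk_space_integral[OF t zero_le_one] by blast
    have ident: "\<bar>(\<integral>y. k y * f y \<partial>lborel) - f x * (\<integral>y. k y \<partial>lborel)\<bar>
        \<le> e / 2 * (\<integral>y. k y \<partial>lborel) + 2 * M * hk 0 t \<eta> * (1 - 0)"
    proof (rule approx_identity_bound[where c = x and \<eta> = \<eta>])
      show "integrable lborel k" using hb by (simp add: has_bochner_integral_iff)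
      show "0 \<le> k y" for y using hk_nonneg[of t "x - y"] by (simp add: k_def indicator_def)
      show "k y = 0" if "y \<notin> {0..1}" for y using that by (simp add: k_def)
      show "\<bar>f y - f x\<bar> \<le> e / 2" if "\<bar>y - x\<bar> < \<eta>" for y
        using d(2)[of x y] that \<eta> \<delta>(1) x' by (auto simp: dist_real_def abs_less_iff)
      show "k y \<le> hk 0 t \<eta>" if "\<eta> \<le> \<bar>y - x\<bar>" for y
        using hk_antimono[of \<eta> "x - y" t] that \<eta>(1) hk_nonneg[of t \<eta>]
            by (auto simp: k_def indicator_def abs_minus_commute)
    qed (use e M unit_weight_measurable[OF f] hk_nonneg in auto)
    have km: "(\<integral>y. k y \<partial>lborel) = m" using hb by (simp add: has_bochner_integral_iff)
    have kf: "(\<integral>y. k y * f y \<partial>lborel) = free_pot f 0 t x"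
      unfolding free_pot_def
    proof (rule Bochner_Integration.integral_cong[OF refl])
      fix y show "k y * f y = hk 0 t (x - y) * f y"
        by (cases "y \<in> {0<..<1}") (simp_all add: k_def unit_weight_outside[OF f])
    qed
    have m: "m \<le> 1" "1 - bk 0 0 t \<delta> \<le> m"
    proof -
      have e1: "normal_tail ((x - 1) / sqrt t) = 1 - normal_tail ((1 - x) / sqrt t)"
        using normal_tail_minus[of "(1 - x) / sqrt t"] by (simp add: minus_divide_left)
      show "m \<le> 1" unfolding m_def using normal_tail_le_1[of "(x - 1) / sqrt t"] normal_tail_nonneg[of
          "(x - 0) / sqrt t"] by linarith
      have "normal_tail ((1 - x) / sqrt t) \<le> normal_tail (\<delta> / sqrt t)" "normal_tail ((x - 0) / sqrt t)
          \<le> normal_tail (\<delta> / sqrt t)"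
        using x' t by (auto intro!: normal_tail_antimono divide_right_mono)
      then show "1 - bk 0 0 t \<delta> \<le> m" unfolding m_def e1 bk_0_0[OF t] by linarith
    qed
    moreover have "\<bar>f x * m - f x\<bar> \<le> M * bk 0 0 t \<delta>"
    proof -
      have "\<bar>f x * m - f x\<bar> = \<bar>f x\<bar> * \<bar>m - 1\<bar>" by (simp add: abs_mult[symmetric] algebra_simps)
      also have "\<dots> \<le> M * bk 0 0 t \<delta>" using M[of x] m M0 by (intro mult_mono) auto
      finally show ?thesis .
    qed
    moreover have "e / 2 * m \<le> e / 2" using m e mult_left_mono[of m 1 "e / 2"] by simp
    ultimately show ?thesis using ident unfolding km kf R_def dist_real_def by linarith
  qed
  have "(R \<longlongrightarrow> e / 2 + 2 * M * 0 * (1 - 0) + M * 0) (at_right 0)"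
    unfolding R_def by (intro tendsto_intros kernel_tendsto_0_at_0 \<eta> \<delta>)
  then have "\<forall>\<^sub>F t in at_right 0. R t < e" by (rule order_tendstoD(2)) (use e in simp)
  moreover have "\<forall>\<^sub>F t in at_right (0::real). t > 0" by (auto simp: eventually_at_filter)
  ultimately show "\<forall>\<^sub>F t in at_right 0. \<forall>x\<in>K. dist (free_pot f 0 t x) (f x) < e"
    by eventually_elim (use main in fastforce)
qed

lemma pot_sol_uniform_limit:
  assumes f: "unit_weight f" and c: "continuous_on {0<..<1} f" and \<psi>: "admissible \<psi>" "admissible \<phi>"
      and K: "compact K" "K \<subseteq> {0<..<1}"
  shows "uniform_limit K (\<lambda>t. pot_sol \<sigma> f c0 c1 \<psi> \<phi> 0 t) f (at_right 0)"
proof -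
  obtain \<delta> where \<delta>: "0 < \<delta>" "\<delta> < 1 / 2" "K \<subseteq> {\<delta>..1 - \<delta>}" using compact_subset_open_unit[OF K] by metis
  have ul: "uniform_limit S (\<lambda>t x. h t x) (\<lambda>x. 0) (at_right 0)"
    if "(g \<longlongrightarrow> 0) (at_right 0)" "\<forall>t\<in>{0<..1}. \<forall>x\<in>S. \<bar>h t x\<bar> \<le> g t" for S :: "real set"
        and h :: "real \<Rightarrow> real \<Rightarrow> real" and g
  proof (rule uniform_limitI)
    fix e :: real assume "e > 0"
    then have "\<forall>\<^sub>F t in at_right 0. g t < e" using order_tendstoD(2)[OF that(1)] by blast
    moreover have "\<forall>\<^sub>F t in at_right (0::real). t \<in> {0<..1}"
      unfolding eventually_at_right[OF zero_less_one] by (auto intro!: exI[of _ 1])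
    ultimately show "\<forall>\<^sub>F t in at_right 0. \<forall>x\<in>S. dist (h t x) 0 < e"
      by eventually_elim (use that(2) in \<open>fastforce simp: dist_real_def\<close>)
  qed
  obtain g where g: "(g \<longlongrightarrow> 0) (at_right 0)" "\<forall>t\<in>{0<..1}. \<forall>x\<in>{\<delta>..1}. \<bar>end_part \<sigma> f c0 \<psi> 0 t x\<bar> \<le> g t"
    using end_part_0_decay[OF f \<psi>(1) \<delta>(1)] by blast
  obtain g' where g': "(g' \<longlongrightarrow> 0) (at_right 0)" "\<forall>t\<in>{0<..1}. \<forall>x\<in>{\<delta>..1}. \<bar>end_part \<sigma> (refl_unit f) c1 \<phi> 0 t x\<bar>
      \<le> g' t"
    using end_part_0_decay[OF unit_weight_refl_unit[OF f] \<psi>(2) \<delta>(1)] by blast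
  have 1: "uniform_limit K (\<lambda>t x. end_part \<sigma> f c0 \<psi> 0 t x) (\<lambda>x. 0) (at_right 0)"
    by (rule ul[OF g(1)]) (use g(2) \<delta> in force)
  have 2: "uniform_limit K (\<lambda>t x. end_part \<sigma> (refl_unit f) c1 \<phi> 0 t (1 - x)) (\<lambda>x. 0) (at_right 0)"
    by (rule ul[OF g'(1)]) (use g'(2) \<delta> in force)
  have "uniform_limit K (\<lambda>t x. free_pot f 0 t x + end_part \<sigma> f c0 \<psi> 0 t x
      + end_part \<sigma> (refl_unit f) c1 \<phi> 0 t (1 - x))
      (\<lambda>x. f x + 0 + 0) (at_right 0)"
    by (intro uniform_limit_add free_pot_uniform_limit[OF f c K] 1 2)
  then show ?thesis by (simp add: pot_sol_def[abs_def])
qed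

section \<open>Existence\<close>

text \<open>A derivative known inside that extends continuously to the ends is the one-sided
  derivative there, because \<open>g\<close> is the integral of \<open>g'\<close> over the closed
  interval.\<close>

lemma DERIV_within_unit_interval:
  fixes g g' :: "real \<Rightarrow> real"
  assumes g: "continuous_on {0..1} g" and g': "continuous_on {0..1} g'"
    and d: "\<And>x. 0 < x \<Longrightarrow> x < 1 \<Longrightarrow> (g has_real_derivative g' x) (at x)" and x: "x \<in> {0..1}"
  shows "(g has_real_derivative g' x) (at x within {0..1})"
proof -
  have eq: "g y = g 0 + integral {0..y} g'" if y: "y \<in> {0..1}" for y
  proof -
    have "(g' has_integral g y - g 0) {0..y}"
    proof (rule fundamental_theorem_of_calculus_interior)
      show "0 \<le> y" using y by simp
      show "continuous_on {0..y} g" by (rule continuous_on_subset[OF g]) (use y in auto)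
      fix z assume "z \<in> {0<..<y}"
      then have "(g has_real_derivative g' z) (at z)" using y by (intro d) auto
      then show "(g has_vector_derivative g' z) (at z)"
        by (simp only: has_real_derivative_iff_has_vector_derivative)
    qed
    then show ?thesis by (simp add: integral_unique)
  qed
  have "((\<lambda>y. g 0 + integral {0..y} g') has_real_derivative 0 + g' x) (at x within {0..1})"
    by (rule DERIV_add[OF DERIV_const integral_has_real_derivative[OF g' x]])
  then have "((\<lambda>y. g 0 + integral {0..y} g') has_real_derivative g' x) (at x within {0..1})" by simp
  then show ?thesis
    by (rule has_field_derivative_transform_within[OF _ zero_less_one x]) (rule eq[symmetric])
qed

text \<open>The heat equation is available for 0 < x < 1 only, but time derivatives are wanted at
  the ends too. The identity integrated over \<open>{a..s}\<close> passes to the closure in the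
  space variable by continuity and is then differentiated in s.\<close>

lemma DERIV_time_at_boundary:
  fixes w w' :: "real \<Rightarrow> real \<Rightarrow> real"
  assumes w: "continuous_on ({0<..} \<times> {0..1}) (\<lambda>(t, x). w t x)"
    and w': "continuous_on ({0<..} \<times> {0..1}) (\<lambda>(t, x). w' t x)"
    and d: "\<And>t x. 0 < t \<Longrightarrow> 0 < x \<Longrightarrow> x < 1 \<Longrightarrow> ((\<lambda>s. w s x) has_real_derivative w' t x) (at t)"
    and t: "0 < t" and x: "x \<in> {0..1}"
  shows "((\<lambda>s. w s x) has_real_derivative w' t x) (at t)"
proof -
  define a b where "a = t / 2" and "b = 2 * t"
  have ab: "0 < a" "a < t" "t < b" using t by (auto simp: a_def b_def)
  have ct: "continuous_on {a..b} (\<lambda>r. v r y)" if "continuous_on ({0<..} \<times> {0..1}) (\<lambda>(t, x). v t x)"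
      "y \<in> {0..1}"
    for v :: "real \<Rightarrow> real \<Rightarrow> real" and y
    by (rule continuous_on_compose2[OF that(1), of _ "\<lambda>r. (r, y)", simplified])
       (use that ab in \<open>auto intro!: continuous_intros\<close>)
  have cx: "continuous_on {0..1} (v r)" if "continuous_on ({0<..} \<times> {0..1}) (\<lambda>(t, x). v t x)" "r > 0"
    for v :: "real \<Rightarrow> real \<Rightarrow> real" and r
    by (rule continuous_on_compose2[OF that(1), of _ "\<lambda>y. (r, y)", simplified])
       (use that in \<open>auto intro!: continuous_intros\<close>)
  have eq: "w s x - w a x - integral {a..s} (\<lambda>r. w' r x) = 0" if s: "s \<in> {a..b}" for s
  proof (rule continuous_constant_on_closure[where S = "{0<..<1}"
      and f = "\<lambda>y. w s y - w a y - integral {a..s} (\<lambda>r. w' r y)"])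
    have "continuous_on ({0..1} \<times> cbox a s) (\<lambda>(y, r). w' r y)"
      unfolding case_prod_beta
      by (rule continuous_on_compose2[OF w', of _ "\<lambda>q. (snd q, fst q)", simplified])
         (use ab in \<open>auto intro!: continuous_intros\<close>)
    from integral_continuous_on_param[OF this]
    show "continuous_on (closure {0<..<1}) (\<lambda>y. w s y - w a y - integral {a..s} (\<lambda>r. w' r y))"
      using s ab by (auto intro!: continuous_intros cx[OF w])
    show "x \<in> closure {0<..<1}" using x by simp
    fix y :: real assume y: "y \<in> {0<..<1}"
    have "((\<lambda>r. w' r y) has_integral w s y - w a y) {a..s}"
    proof (rule fundamental_theorem_of_calculus)
      show "a \<le> s" using s by simp
      fix r assume "r \<in> {a..s}"
      then have "((\<lambda>r. w r y) has_real_derivative w' r y) (at r)" using ab y by (intro d) auto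
      then have "((\<lambda>r. w r y) has_real_derivative w' r y) (at r within {a..s})"
        by (rule has_field_derivative_at_within)
      then show "((\<lambda>r. w r y) has_vector_derivative w' r y) (at r within {a..s})"
        by (simp only: has_real_derivative_iff_has_vector_derivative)
    qed
    then show "w s y - w a y - integral {a..s} (\<lambda>r. w' r y) = 0" by (simp add: integral_unique)
  qed
  have "((\<lambda>s. w a x + integral {a..s} (\<lambda>r. w' r x)) has_real_derivative 0 + w' t x) (at t within {a..b})"
    by (rule DERIV_add[OF DERIV_const integral_has_real_derivative[OF ct[OF w' x]]]) (use ab in auto)
  then have "((\<lambda>s. w a x + integral {a..s} (\<lambda>r. w' r x)) has_real_derivative w' t x) (at t)"
    using ab by (simp add: at_within_Icc_at)
  then show ?thesis
  proof (rule has_field_derivative_transform_within_open[of _ _ _ "{a<..<b}"])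
    show "w a x + integral {a..s} (\<lambda>r. w' r x) = w s x" if "s \<in> {a<..<b}" for s
      using eq[of s] that by simp
  qed (use ab in auto)
qed

lemma vector_derivative_within_unit:
  fixes g :: "real \<Rightarrow> real"
  assumes "(g has_real_derivative g') (at x within {0..1})" "x \<in> {0..1}"
  shows "vector_derivative g (at x within {0..1}) = g'"
  using vector_derivative_within_cbox[of 0 1 x g g'] assms
  by (simp add: has_real_derivative_iff_has_vector_derivative)

text \<open>Interior derivatives with continuous extensions to the closed interval determine
  everything: one-sided space derivatives and time derivatives at the ends follow from the two
  preceding principles. Bounds of the derivatives on \<open>{T1..T2}\<close> come from compactness,
  so only boundedness near t = 0 is a separate hypothesis.\<close>

lemma U_spaceI:
  assumes w: "continuous_on ({0<..} \<times> {0..1}) (\<lambda>(t, x). w t x)"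
    and w1: "continuous_on ({0<..} \<times> {0..1}) (\<lambda>(t, x). w1 t x)"
    and w2: "continuous_on ({0<..} \<times> {0..1}) (\<lambda>(t, x). w2 t x)"
    and wt: "continuous_on ({0<..} \<times> {0..1}) (\<lambda>(t, x). wt t x)"
    and d1: "\<And>t x. 0 < t \<Longrightarrow> 0 < x \<Longrightarrow> x < 1 \<Longrightarrow> (w t has_real_derivative w1 t x) (at x)"
    and d2: "\<And>t x. 0 < t \<Longrightarrow> 0 < x \<Longrightarrow> x < 1 \<Longrightarrow> (w1 t has_real_derivative w2 t x) (at x)"
    and dt: "\<And>t x. 0 < t \<Longrightarrow> 0 < x \<Longrightarrow> x < 1 \<Longrightarrow> ((\<lambda>s. w s x) has_real_derivative wt t x) (at t)"
    and bd: "\<And>t x. 0 < t \<Longrightarrow> t \<le> 1 \<Longrightarrow> x \<in> {0..1} \<Longrightarrow> \<bar>w t x\<bar> \<le> K"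
    and u: "u \<in> {0<..} \<rightarrow>\<^sub>E extensional {0..1}" "\<And>t x. 0 < t \<Longrightarrow> x \<in> {0..1} \<Longrightarrow> u t x = w t x"
  shows "u \<in> U_space"
    and "\<And>t x. 0 < t \<Longrightarrow> x \<in> {0..1} \<Longrightarrow> dt u t x = wt t x"
    and "\<And>t x. 0 < t \<Longrightarrow> x \<in> {0..1} \<Longrightarrow> dx u t x = w1 t x"
    and "\<And>t x. 0 < t \<Longrightarrow> x \<in> {0..1} \<Longrightarrow> dxx u t x = w2 t x"
proof -
  have cx: "continuous_on {0..1} (v r)" if "continuous_on ({0<..} \<times> {0..1}) (\<lambda>(t, x). v t x)" "r > 0"
    for v :: "real \<Rightarrow> real \<Rightarrow> real" and r
    by (rule continuous_on_compose2[OF that(1), of _ "\<lambda>y. (r, y)", simplified])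
       (use that in \<open>auto intro!: continuous_intros\<close>)
  have e1: "(u t has_real_derivative w1 t x) (at x within {0..1})" if t: "0 < t" "x \<in> {0..1}" for t x
  proof -
    have "(w t has_real_derivative w1 t x) (at x within {0..1})"
      by (rule DERIV_within_unit_interval[OF cx[OF w] cx[OF w1]]) (use t d1 in auto)
    then show ?thesis by (rule has_field_derivative_transform_within[OF _ zero_less_one t(2)])
        (use u(2) t in auto)
  qed
  show dx_eq: "dx u t x = w1 t x" if "0 < t" "x \<in> {0..1}" for t x
    unfolding dx_def by (rule vector_derivative_within_unit[OF e1[OF that] that(2)])
  have e2: "(dx u t has_real_derivative w2 t x) (at x within {0..1})" if t: "0 < t" "x \<in> {0..1}" for t x
  proof -
    have "(w1 t has_real_derivative w2 t x) (at x within {0..1})"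
      by (rule DERIV_within_unit_interval[OF cx[OF w1] cx[OF w2]]) (use t d2 in auto)
    then show ?thesis by (rule has_field_derivative_transform_within[OF _ zero_less_one t(2)])
        (use dx_eq t in auto)
  qed
  show dxx_eq: "dxx u t x = w2 t x" if "0 < t" "x \<in> {0..1}" for t x
    unfolding dxx_def by (rule vector_derivative_within_unit[OF e2[OF that] that(2)])
  have et: "((\<lambda>s. u s x) has_real_derivative wt t x) (at t)" if t: "0 < t" "x \<in> {0..1}" for t x
  proof -
    have "((\<lambda>s. w s x) has_real_derivative wt t x) (at t)"
      by (rule DERIV_time_at_boundary[OF w wt dt t])
    then show ?thesis
      by (rule has_field_derivative_transform_within_open[of _ _ _ "{0<..}"]) (use t u(2) in auto)
  qed
  show dt_eq: "dt u t x = wt t x" if "0 < t" "x \<in> {0..1}" for t x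
    unfolding dt_def by (rule DERIV_imp_deriv[OF et[OF that]])
  have cont: "\<forall>v\<in>{u, dt u, dx u, dxx u}. continuous_on ({0<..} \<times> {0..1}) (\<lambda>(t, x). v t x)"
  proof -
    have "continuous_on ({0<..} \<times> {0..1}) (\<lambda>(t, x). u t x)"
      by (rule continuous_on_eq[OF w]) (use u(2) in auto)
    moreover have "continuous_on ({0<..} \<times> {0..1}) (\<lambda>(t, x). dt u t x)"
      by (rule continuous_on_eq[OF wt]) (use dt_eq in auto)
    moreover have "continuous_on ({0<..} \<times> {0..1}) (\<lambda>(t, x). dx u t x)"
      by (rule continuous_on_eq[OF w1]) (use dx_eq in auto)
    moreover have "continuous_on ({0<..} \<times> {0..1}) (\<lambda>(t, x). dxx u t x)"
      by (rule continuous_on_eq[OF w2]) (use dxx_eq in auto)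
    ultimately show ?thesis by blast
  qed
  have "C12 u"
    unfolding C12_def
  proof (intro conjI allI impI ballI cont[rule_format])
    fix t x :: real assume t: "0 < t" "x \<in> {0..1}"
    show "(\<lambda>s. u s x) differentiable at t" using et[OF t] real_differentiable_def by blast
    show "u t differentiable at x within {0..1}" using e1[OF t] real_differentiable_def by blast
    show "dx u t differentiable at x within {0..1}" using e2[OF t] real_differentiable_def by blast
  qed
  moreover have "bounded ((\<lambda>(t, x). u t x) ` ({0<..1} \<times> {0..1}))"
    unfolding bounded_iff by (intro exI[of _ K]) (use bd u(2) in auto)
  moreover have "bounded ((\<lambda>(t, x). v t x) ` ({T1..T2} \<times> {0..1}))"
    if "0 < T1" "v \<in> {dt u, dx u, dxx u}" for T1 T2 v
  proof (intro compact_imp_bounded compact_continuous_image compact_Times compact_Icc)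
    have "continuous_on ({0<..} \<times> {0..1}) (\<lambda>(t, x). v t x)" using cont that(2) by blast
    then show "continuous_on ({T1..T2} \<times> {0..1}) (\<lambda>(t, x). v t x)"
      by (rule continuous_on_subset) (use that(1) in auto)
  qed
  ultimately show "u \<in> U_space" unfolding U_space_def using u(1) by blast
qed

section \<open>Basic properties of \<open>U_space\<close> and \<open>F_space\<close>\<close>

lemma U_space_C12: "u \<in> U_space \<Longrightarrow> C12 u"
  by (simp add: U_space_def)

lemma C12_continuous:
  assumes "C12 u"
  shows "continuous_on ({0<..} \<times> {0..1}) (\<lambda>(t, x). u t x)"
    "continuous_on ({0<..} \<times> {0..1}) (\<lambda>(t, x). dt u t x)"
    "continuous_on ({0<..} \<times> {0..1}) (\<lambda>(t, x). dx u t x)"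
    "continuous_on ({0<..} \<times> {0..1}) (\<lambda>(t, x). dxx u t x)"
  using assms unfolding C12_def by blast+

lemma C12_derivs:
  assumes "C12 u" "0 < t" "x \<in> {0..1}"
  shows "((\<lambda>s. u s x) has_real_derivative dt u t x) (at t)"
    "(u t has_real_derivative dx u t x) (at x within {0..1})"
    "(dx u t has_real_derivative dxx u t x) (at x within {0..1})"
proof -
  have "(\<lambda>s. u s x) differentiable at t" using assms unfolding C12_def by blast
  then show "((\<lambda>s. u s x) has_real_derivative dt u t x) (at t)"
    unfolding dt_def using real_differentiable_def DERIV_imp_deriv by metis
  have *: "(g has_real_derivative vector_derivative g (at x within {0..1})) (at x within {0..1})"
    if "g differentiable at x within {0..1}" for g :: "real \<Rightarrow> real"
    using that vector_derivative_within_unit assms(3) real_differentiable_def by metis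
  show "(u t has_real_derivative dx u t x) (at x within {0..1})"
    unfolding dx_def by (rule *) (use assms in \<open>auto simp: C12_def\<close>)
  show "(dx u t has_real_derivative dxx u t x) (at x within {0..1})"
    unfolding dxx_def by (rule *) (use assms in \<open>auto simp: C12_def\<close>)
qed

lemma slice_continuous:
  fixes v :: "real \<Rightarrow> real \<Rightarrow> real"
  assumes "continuous_on ({0<..} \<times> {0..1}) (\<lambda>(t, x). v t x)" "t > 0"
  shows "continuous_on {0..1} (v t)"
  by (rule continuous_on_compose2[OF assms(1), of _ "\<lambda>y. (t, y)", simplified])
     (use assms in \<open>auto intro!: continuous_intros\<close>)

lemma U_space_slice_F: "u \<in> U_space \<Longrightarrow> t > 0 \<Longrightarrow> u t \<in> F_space"
proof -
  assume u: "u \<in> U_space" and t: "t > 0"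
  have c: "continuous_on {0..1} (u t)"
    by (rule slice_continuous[OF C12_continuous(1)[OF U_space_C12[OF u]] t])
  have "u t \<in> extensional {0..1}" using u t by (auto simp: U_space_def)
  moreover have "bounded (u t ` {0..1})" by (rule compact_imp_bounded[OF compact_continuous_image[OF c]]) simp
  moreover have "continuous_on {0<..<1} (u t)" by (rule continuous_on_subset[OF c]) auto
  ultimately show ?thesis by (simp add: F_space_def)
qed

lemma F_space_bound:
  assumes "f \<in> F_space"
  obtains M where "0 \<le> M" "\<And>x. x \<in> {0..1} \<Longrightarrow> \<bar>f x\<bar> \<le> M"
proof -
  have "bounded (f ` {0..1})" using assms by (simp add: F_space_def)
  then obtain M where "\<forall>y\<in>f ` {0..1}. norm y \<le> M" unfolding bounded_iff by blast
  then have M: "\<bar>f x\<bar> \<le> M" if "x \<in> {0..1}" for x using that by simp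
  have "0 \<le> M" by (rule order_trans[OF abs_ge_zero M[of 0]]) simp
  then show ?thesis using that M by blast
qed

lemma F_space_unif_norm:
  assumes "f \<in> F_space" "x \<in> {0..1}"
  shows "\<bar>f x\<bar> \<le> unif_norm f"
proof -
  obtain M where "\<And>x. x \<in> {0..1} \<Longrightarrow> \<bar>f x\<bar> \<le> M" using F_space_bound[OF assms(1)] by metis
  then show ?thesis unfolding unif_norm_def by (intro cSUP_upper assms bdd_aboveI2)
qed

lemma unif_norm_nonneg: "f \<in> F_space \<Longrightarrow> 0 \<le> unif_norm f"
  using F_space_unif_norm[of f 0] by force

lemma unif_norm_le:
  assumes "\<And>x. x \<in> {0..1} \<Longrightarrow> \<bar>f x\<bar> \<le> C"
  shows "unif_norm f \<le> C"
  unfolding unif_norm_def by (rule cSUP_least) (use assms in auto)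

text \<open>The size of the datum in which solutions are estimated: the L1 norm on the open interval
  plus the end values. Along a sequence converging in \<open>F_space\<close> the size of the
  difference to the limit tends to 0, although the supremum norm of the difference need not.\<close>

definition F_mass :: "(real \<Rightarrow> real) \<Rightarrow> real" where
  "F_mass f = (\<integral>y. indicator {0<..<1} y * \<bar>f y\<bar> \<partial>lborel) + \<bar>f 0\<bar> + \<bar>f 1\<bar>"

lemma F_space_measurable:
  assumes "f \<in> F_space"
  shows "(\<lambda>y. indicator {0<..<1} y * f y) \<in> borel_measurable borel"
  using borel_measurable_continuous_on_indicator[of "{0<..<1::real}" f] assms by (simp add: F_space_def)

text \<open>\<open>g\<close> stands for the exponential gauge factor; the indicator removes the end
  values, where \<open>f\<close> may jump.\<close>

lemma unit_weight_of_F: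
  assumes f: "f \<in> F_space" and g: "continuous_on {0..1} g"
  shows "unit_weight (\<lambda>y. indicator {0<..<1} y * (g y * f y))"
proof -
  obtain M where M: "0 \<le> M" "\<And>x. x \<in> {0..1} \<Longrightarrow> \<bar>f x\<bar> \<le> M" using F_space_bound[OF f] by metis
  have "bounded (g ` {0..1})" by (rule compact_imp_bounded[OF compact_continuous_image[OF g]]) simp
  then obtain C where "\<forall>y\<in>g ` {0..1}. norm y \<le> C" unfolding bounded_iff by blast
  then have C: "\<bar>g x\<bar> \<le> C" if "x \<in> {0..1}" for x using that by simp
  have m: "(\<lambda>y. indicator {0<..<1} y * (g y * f y)) \<in> borel_measurable borel"
  proof -
    have "continuous_on {0<..<1} (\<lambda>y. g y * f y)"
      using f by (intro continuous_on_mult continuous_on_subset[OF g]) (auto simp: F_space_def)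
    then show ?thesis
      using borel_measurable_continuous_on_indicator[of "{0<..<1::real}" "\<lambda>y. g y * f y"] by simp
  qed
  have "\<bar>indicator {0<..<1} y * (g y * f y)\<bar> \<le> C * M" for y
  proof (cases "y \<in> {0<..<1}")
    case True
    then have "\<bar>g y\<bar> * \<bar>f y\<bar> \<le> C * M" using M C[of y] by (intro mult_mono) auto
    then show ?thesis using True by (simp add: abs_mult)
  next
    case False
    have "0 \<le> C" using C[of 0] by force
    then show ?thesis using False M by simp
  qed
  then show ?thesis unfolding unit_weight_def using m by auto
qed

lemma uniform_limit_gauge:
  fixes v :: "real \<Rightarrow> real \<Rightarrow> real"
  assumes v: "uniform_limit K v g (at_right 0)" and K: "compact K" and g: "continuous_on K g"
  shows "uniform_limit K (\<lambda>t x. exp (- \<mu> * x - \<mu>\<^sup>2 / 2 * t) * v t x) (\<lambda>x. exp (- \<mu> * x) * g x) (at_right 0)"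
proof -
  have 1: "uniform_limit K (\<lambda>t x. exp (- (\<mu>\<^sup>2 / 2) * t)) (\<lambda>x. 1) (at_right 0)"
  proof (rule uniform_limitI)
    fix e :: real assume e: "e > 0"
    have "((\<lambda>t. exp (- (\<mu>\<^sup>2 / 2) * t)) \<longlongrightarrow> 1) (at_right 0)"
      by (auto intro!: tendsto_eq_intros)
    from tendstoD[OF this e] show "\<forall>\<^sub>F t in at_right 0. \<forall>x\<in>K. dist (exp (- (\<mu>\<^sup>2 / 2) * t)) 1 < e"
      by eventually_elim auto
  qed
  have bg: "bounded (g ` K)" by (intro compact_imp_bounded compact_continuous_image g K)
  have be: "bounded ((\<lambda>x. exp (- \<mu> * x)) ` K)"
    by (intro compact_imp_bounded compact_continuous_image K continuous_intros)
  have 2: "uniform_limit K (\<lambda>t x. exp (- (\<mu>\<^sup>2 / 2) * t) * v t x) (\<lambda>x. 1 * g x) (at_right 0)"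
    by (rule uniform_lim_mult[OF 1 v _ bg]) (auto simp: bounded_iff intro: exI[of _ 1])
  have "uniform_limit K (\<lambda>t x. exp (- \<mu> * x) * (exp (- (\<mu>\<^sup>2 / 2) * t) * v t x)) (\<lambda>x. exp (- \<mu> * x) * (1 * g
      x)) (at_right 0)"
    by (rule uniform_lim_mult[OF uniform_limit_const 2 be]) (use bg in simp)
  moreover have "exp (- \<mu> * x) * (exp (- (\<mu>\<^sup>2 / 2) * t) * v t x) = exp (- \<mu> * x - \<mu>\<^sup>2 / 2 * t) * v t x"
      for t x
    by (simp add: mult.assoc[symmetric] exp_add[symmetric])
  ultimately show ?thesis by (simp only: mult_1_left)
qed

text \<open>For a member of \<open>U_space\<close> the norms are bounded for t in (0, 1), and an
  interior point is a compact set; so the limits at the two ends and the uniform limits on compact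
  sets are what remains to be given.\<close>

lemma F_converges_at_0I:
  assumes u: "u \<in> U_space" and f: "f \<in> F_space"
    and 0: "((\<lambda>t. u t 0) \<longlongrightarrow> f 0) (at_right 0)" and 1: "((\<lambda>t. u t 1) \<longlongrightarrow> f 1) (at_right 0)"
    and c: "unif_conv_compacts u f (at_right 0)"
  shows "F_converges_at_0 u f"
proof -
  have "bounded ((\<lambda>(t, x). u t x) ` ({0<..1} \<times> {0..1}))" using u by (simp add: U_space_def)
  then obtain K where K: "\<And>t x. t \<in> {0<..1} \<Longrightarrow> x \<in> {0..1} \<Longrightarrow> \<bar>u t x\<bar> \<le> K" by (force simp: bounded_iff)
  have "norm (unif_norm (u t)) \<le> K" if "t \<in> {0<..<1}" for t
    using unif_norm_le[of "u t" K] K[of t] unif_norm_nonneg[OF U_space_slice_F[OF u, of t]] that by auto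
  then have "bounded ((\<lambda>t. unif_norm (u t)) ` {0<..<1})" unfolding bounded_iff by blast
  then have b: "\<exists>\<delta>>0. bounded ((\<lambda>t. unif_norm (u t)) ` {0<..<\<delta>})" using zero_less_one by blast
  have p: "((\<lambda>t. u t x) \<longlongrightarrow> f x) (at_right 0)" if x: "x \<in> {0..1}" for x
  proof -
    consider "x = 0" | "x = 1" | "0 < x" "x < 1" using x by fastforce
    then show ?thesis
    proof cases
      case 3
      then have "compact {x} \<and> {x} \<subseteq> {0<..<1}" by simp
      then have "uniform_limit {x} u f (at_right 0)" using c unfolding unif_conv_compacts_def by blast
      then show ?thesis by (rule tendsto_uniform_limitI) simp
    qed (use 0 1 in auto)
  qed
  show ?thesis
    unfolding F_converges_at_0_def using U_space_slice_F[OF u] f b p c by blast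
qed

lemma F_mass_bound_datum:
  assumes f: "f \<in> F_space"
  shows "mass (\<lambda>y. indicator {0<..<1} y * (exp (\<mu> * y) * f y)) + \<bar>f 0\<bar> + \<bar>exp \<mu> * f 1\<bar> \<le> exp \<bar>\<mu>\<bar> * F_mass f"
proof -
  have s1: "unit_weight (\<lambda>y. indicator {0<..<1} y * (1 * f y))" by (rule unit_weight_of_F[OF f]) auto
  then have i: "integrable lborel (\<lambda>y. indicator {0<..<1} y * \<bar>f y\<bar>)"
    using integrable_abs[OF unit_weight_integrable[OF s1]] by (simp add: abs_mult)
  have s2: "unit_weight (\<lambda>y. indicator {0<..<1} y * (exp (\<mu> * y) * f y))"
    by (rule unit_weight_of_F[OF f]) (auto intro!: continuous_intros)
  have e: "exp (\<mu> * y) \<le> exp \<bar>\<mu>\<bar>" if "y \<in> {0..1}" for y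
    using that mult_mono[of "\<mu>" "\<bar>\<mu>\<bar>" y 1] by auto
  have "mass (\<lambda>y. indicator {0<..<1} y * (exp (\<mu> * y) * f y)) \<le> (\<integral>y. exp \<bar>\<mu>\<bar> * (indicator {0<..<1} y * \<bar>f y\<bar>)
      \<partial>lborel)"
    unfolding mass_def
  proof (rule integral_mono)
    show "integrable lborel (\<lambda>y. \<bar>indicator {0<..<1} y * (exp (\<mu> * y) * f y)\<bar>)"
      by (rule integrable_abs[OF unit_weight_integrable[OF s2]])
    show "\<bar>indicator {0<..<1} y * (exp (\<mu> * y) * f y)\<bar> \<le> exp \<bar>\<mu>\<bar> * (indicator {0<..<1} y * \<bar>f y\<bar>)" for y
      using e[of y] by (cases "y \<in> {0<..<1}") (auto simp: abs_mult intro!: mult_right_mono)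
  qed (use i in simp)
  moreover have "(\<integral>y. exp \<bar>\<mu>\<bar> * (indicator {0<..<1} y * \<bar>f y\<bar>) \<partial>lborel)
      = exp \<bar>\<mu>\<bar> * (\<integral>y. indicator {0<..<1} y * \<bar>f y\<bar> \<partial>lborel)"
    by (rule integral_mult_right_zero)
  moreover have "\<bar>f 0\<bar> \<le> exp \<bar>\<mu>\<bar> * \<bar>f 0\<bar>" using mult_right_mono[of 1 "exp \<bar>\<mu>\<bar>" "\<bar>f 0\<bar>"] by simp
  moreover have "\<bar>exp \<mu> * f 1\<bar> \<le> exp \<bar>\<mu>\<bar> * \<bar>f 1\<bar>" using e[of 1] by (simp add: abs_mult mult_right_mono)
  ultimately show ?thesis unfolding F_mass_def distrib_left by linarith
qed

text \<open>The bound is established together with existence because it is read off the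
  construction; after uniqueness it becomes a property of the operators \<open>Q\<close>.\<close>

lemma solves_ivp_exists:
  "\<exists>K. \<forall>f\<in>F_space. \<exists>u. solves_ivp \<mu> \<sigma> f u \<and> (\<forall>t>0. \<forall>x\<in>{0..1}. \<bar>u t x\<bar> \<le> K t * F_mass f)"
proof -
  \<comment> \<open>For u = exp (- \<mu> x - \<mu>^2 t / 2) v the time derivative is v'' / 2 -
    \<mu>^2 v / 2 and the space derivative is v' - \<mu> v, up to the common exponential. So the
    boundary conditions become v'' / 2 + \<sigma> v' = \<alpha> v at 0 and v'' / 2 - \<sigma> v' =
    \<beta> v at 1.\<close>
  define \<alpha> where "\<alpha> = \<mu>\<^sup>2 / 2 + \<sigma> * \<mu>"
  define \<beta> where "\<beta> = \<mu>\<^sup>2 / 2 - \<sigma> * \<mu>"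
  from densities_exist[of \<sigma> \<alpha> \<beta>] obtain D where D: "\<forall>f c d. unit_weight f \<longrightarrow> (\<exists>\<psi> \<phi>. admissible \<psi> \<and>
      admissible \<phi> \<and>
     density_eq \<sigma> \<alpha> f c d \<psi> \<phi> \<and> density_eq \<sigma> \<beta> (refl_unit f) d c \<phi> \<psi> \<and>
     (\<forall>R t. 0 < t \<longrightarrow> t \<le> R \<longrightarrow>
        \<bar>\<psi> t\<bar> \<le> D R * (mass f + \<bar>c\<bar> + \<bar>d\<bar>) \<and> \<bar>\<phi> t\<bar> \<le> D R * (mass f + \<bar>c\<bar> + \<bar>d\<bar>)))"
    by (rule exE)
  from pot_sol_0_bound[of \<sigma>] obtain E where E: "\<forall>t>0. 0 \<le> E t \<and> (\<forall>f c d \<psi> \<phi> B. \<forall>x\<in>{0..1}. unit_weight f \<longrightarrow>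
      admissible \<psi> \<longrightarrow> admissible \<phi> \<longrightarrow>
     (\<forall>s. 0 < s \<longrightarrow> s \<le> t \<longrightarrow> \<bar>\<psi> s\<bar> \<le> B \<and> \<bar>\<phi> s\<bar> \<le> B) \<longrightarrow>
     \<bar>pot_sol \<sigma> f c d \<psi> \<phi> 0 t x\<bar> \<le> E t * (mass f + \<bar>c\<bar> + \<bar>d\<bar> + B))"
    by (rule exE)
  show ?thesis
  \<comment> \<open>One factor exp |\<mu>| comes from the gauge on the solution, the other from the
    gauge on the datum; 1 + |D t| adds the size of the densities to that of the datum.\<close>
  proof (rule exI[of _ "\<lambda>t. exp \<bar>\<mu>\<bar> * (E t * ((1 + \<bar>D t\<bar>) * exp \<bar>\<mu>\<bar>))"], rule ballI)
    fix f assume f: "f \<in> F_space"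
    define g where "g y = indicator {0<..<1} y * (exp (\<mu> * y) * f y)" for y
    \<comment> \<open>The end values of the gauged datum exp (\<mu> x) f(x).\<close>
    define c d where "c = f 0" and "d = exp \<mu> * f 1"
    have g: "unit_weight g" unfolding g_def[abs_def] by (rule unit_weight_of_F[OF f]) (auto intro!:
        continuous_intros)
    obtain \<psi> \<phi> where admissible: "admissible \<psi>" "admissible \<phi>"
      and \<psi>: "density_eq \<sigma> \<alpha> g c d \<psi> \<phi>" and \<phi>: "density_eq \<sigma> \<beta> (refl_unit g) d c \<phi> \<psi>"
      and bd: "\<And>R t. 0 < t \<Longrightarrow> t \<le> R \<Longrightarrow>
        \<bar>\<psi> t\<bar> \<le> D R * (mass g + \<bar>c\<bar> + \<bar>d\<bar>) \<and> \<bar>\<phi> t\<bar> \<le> D R * (mass g + \<bar>c\<bar> + \<bar>d\<bar>)"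
      using D[rule_format, OF g, of c d] by blast
    define v where "v = pot_sol \<sigma> g c d \<psi> \<phi>"
    define e where "e t x = exp (- \<mu> * x - \<mu>\<^sup>2 / 2 * t)" for t x
    define w where "w t x = e t x * v 0 t x" for t x
    define w1 where "w1 t x = e t x * (v 1 t x - \<mu> * v 0 t x)" for t x
    define w2 where "w2 t x = e t x * (v 2 t x - 2 * \<mu> * v 1 t x + \<mu>\<^sup>2 * v 0 t x)" for t x
    define wt where "wt t x = e t x * (v 2 t x / 2 - \<mu>\<^sup>2 / 2 * v 0 t x)" for t x
    define u where "u = (\<lambda>t\<in>{0<..}. \<lambda>x\<in>{0..1}. w t x)"
    have vc: "continuous_on ({0<..} \<times> {0..1}) (\<lambda>p. v i (fst p) (snd p))" if "i \<le> 2" for i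
      using continuous_on_pot_sol[OF g admissible that, of \<sigma> c d] by (simp add: v_def case_prod_beta)
    have ec: "continuous_on ({0<..} \<times> {0..1}) (\<lambda>p::real \<times> real. e (fst p) (snd p))"
      unfolding e_def by (intro continuous_intros)
    have h: "heat_on ({0<..} \<times> {0<..<1}) v" unfolding v_def by (rule heat_on_pot_sol[OF g admissible])
    have ex: "((\<lambda>x. e t x) has_real_derivative - \<mu> * e t x) (at x)" for t x
      unfolding e_def by (auto intro!: derivative_eq_intros)
    have et: "((\<lambda>t. e t x) has_real_derivative - (\<mu>\<^sup>2 / 2) * e t x) (at t)" for t x
      unfolding e_def by (auto intro!: derivative_eq_intros)
    have e_le: "e t x \<le> exp \<bar>\<mu>\<bar>" if "0 < t" "x \<in> {0..1}" for t x
    proof -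
      have "- \<mu> * x \<le> \<bar>\<mu>\<bar>" using that mult_mono[of "- \<mu>" "\<bar>\<mu>\<bar>" x 1] by auto
      moreover have "0 \<le> \<mu>\<^sup>2 / 2 * t" using that by simp
      ultimately show ?thesis unfolding e_def by simp
    qed
    have e_pos: "e t x > 0" for t x by (simp add: e_def)
    have uw: "u t x = w t x" if "0 < t" "x \<in> {0..1}" for t x using that by (simp add: u_def)
    obtain K where K: "\<And>t x. t \<in> {0<..1} \<Longrightarrow> x \<in> {0..1} \<Longrightarrow> \<bar>v 0 t x\<bar> \<le> K"
      using pot_sol_0_bounded[OF g admissible, of \<sigma> c d] unfolding v_def by blast
    have w_le: "\<bar>w t x\<bar> \<le> exp \<bar>\<mu>\<bar> * B" if "0 < t" "x \<in> {0..1}" "\<bar>v 0 t x\<bar> \<le> B" for t x B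
      unfolding w_def abs_mult using e_le[OF that(1,2)] e_pos[of t x] that(3) by (intro mult_mono) auto
    have "u \<in> U_space \<and> (\<forall>t x. 0 < t \<longrightarrow> x \<in> {0..1} \<longrightarrow> dt u t x = wt t x \<and> dx u t x = w1 t x \<and>
        dxx u t x = w2 t x)"
    proof -
      have a1: "continuous_on ({0<..} \<times> {0..1}) (\<lambda>(t, x). w t x)"
        unfolding w_def case_prod_beta by (intro continuous_intros ec vc) auto
      have a2: "continuous_on ({0<..} \<times> {0..1}) (\<lambda>(t, x). w1 t x)"
        unfolding w1_def case_prod_beta by (intro continuous_intros ec vc) auto
      have a3: "continuous_on ({0<..} \<times> {0..1}) (\<lambda>(t, x). w2 t x)"
        unfolding w2_def case_prod_beta by (intro continuous_intros ec vc) auto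
      have a4: "continuous_on ({0<..} \<times> {0..1}) (\<lambda>(t, x). wt t x)"
        unfolding wt_def case_prod_beta by (intro continuous_intros ec vc) auto
      have b1: "(w t has_real_derivative w1 t x) (at x)" if "0 < t" "0 < x" "x < 1" for t x
      proof -
        have "((\<lambda>x. e t x * v 0 t x) has_real_derivative w1 t x) (at x)"
          by (rule DERIV_cong[OF DERIV_mult[OF ex heat_onD(1)[OF h]]])
              (use that in \<open>auto simp: w1_def algebra_simps\<close>)
        then show ?thesis by (simp add: w_def[abs_def])
      qed
      have b2: "(w1 t has_real_derivative w2 t x) (at x)" if "0 < t" "0 < x" "x < 1" for t x
      proof -
        have "((\<lambda>x. e t x * (v 1 t x - \<mu> * v 0 t x)) has_real_derivative w2 t x) (at x)"
          by (rule DERIV_cong[OF DERIV_mult[OF ex DERIV_diff[OF heat_onD(2)[OF h] DERIV_cmult[OF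
              heat_onD(1)[OF h]]]]])
             (use that in \<open>auto simp: w2_def algebra_simps power2_eq_square\<close>)
        then show ?thesis by (simp add: w1_def[abs_def])
      qed
      have b3: "((\<lambda>s. w s x) has_real_derivative wt t x) (at t)" if "0 < t" "0 < x" "x < 1" for t x
      proof -
        have "((\<lambda>s. e s x * v 0 s x) has_real_derivative wt t x) (at t)"
          by (rule DERIV_cong[OF DERIV_mult[OF et heat_onD(3)[OF h]]])
              (use that in \<open>auto simp: wt_def algebra_simps\<close>)
        then show ?thesis by (simp add: w_def)
      qed
      have b4: "\<bar>w t x\<bar> \<le> exp \<bar>\<mu>\<bar> * K" if "0 < t" "t \<le> 1" "x \<in> {0..1}" for t x
        by (rule w_le) (use K that in auto)
      have b5: "u \<in> {0<..} \<rightarrow>\<^sub>E extensional {0..1}" by (auto simp: u_def)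
      note U = U_spaceI[OF a1 a2 a3 a4 b1 b2 b3 b4 b5 uw]
      show ?thesis using U(1) U(2) U(3) U(4) by blast
    qed
    then have U: "u \<in> U_space" and dts: "\<And>t x. 0 < t \<Longrightarrow> x \<in> {0..1} \<Longrightarrow> dt u t x = wt t x"
      "\<And>t x. 0 < t \<Longrightarrow> x \<in> {0..1} \<Longrightarrow> dx u t x = w1 t x"
      "\<And>t x. 0 < t \<Longrightarrow> x \<in> {0..1} \<Longrightarrow> dxx u t x = w2 t x" by auto
    have left: "v 2 t 0 / 2 + \<sigma> * v 1 t 0 = \<alpha> * v 0 t 0" if "t > 0" for t
      using pot_sol_bdry_op[OF g admissible(1) that, of \<sigma> c d \<phi>] \<psi>[unfolded density_eq_def, rule_format, of t]
          unfolding v_def by linarith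
    \<comment> \<open>The condition at the right end is the left condition of the reflected ansatz,
      transported by the exchange symmetry for the orders 0, 1 and 2.\<close>
    have right: "v 2 t 1 / 2 - \<sigma> * v 1 t 1 = \<beta> * v 0 t 1" if "t > 0" for t
      using pot_sol_bdry_op[OF unit_weight_refl_unit[OF g] admissible(2) that, of \<sigma> d c \<psi>] \<phi>[unfolded
          density_eq_def, rule_format, of t]
        pot_sol_refl_unit[of 0 \<sigma> g c d \<psi> \<phi> t 0] pot_sol_refl_unit[of 1 \<sigma> g c d \<psi> \<phi> t 0]
        pot_sol_refl_unit[of 2 \<sigma> g c d \<psi> \<phi> t 0]
      unfolding v_def by simp
    have bvp: "solves_bvp \<mu> \<sigma> u"
      unfolding solves_bvp_def
    proof (intro conjI allI impI ballI)
      fix t x :: real assume t: "t > 0" and x: "x \<in> {0<..<1}"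
      then show "dt u t x = 1 / 2 * dxx u t x + \<mu> * dx u t x"
        by (simp add: dts wt_def w1_def w2_def algebra_simps power2_eq_square add_divide_distrib
            diff_divide_distrib)
    next
      fix t :: real assume t: "t > 0"
      have "v 2 t 0 / 2 - \<mu>\<^sup>2 / 2 * v 0 t 0 = - \<sigma> * (v 1 t 0 - \<mu> * v 0 t 0)"
        using left[OF t] by (simp add: \<alpha>_def algebra_simps)
      then show "dt u t 0 = - \<sigma> * dx u t 0" using t by (simp add: dts wt_def w1_def)
    next
      fix t :: real assume t: "t > 0"
      have "v 2 t 1 / 2 - \<mu>\<^sup>2 / 2 * v 0 t 1 = \<sigma> * (v 1 t 1 - \<mu> * v 0 t 1)"
        using right[OF t] by (simp add: \<beta>_def algebra_simps)
      then show "dt u t 1 = \<sigma> * dx u t 1" using t by (simp add: dts wt_def w1_def)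
    qed
    have ev_pos: "\<forall>\<^sub>F t in at_right (0::real). t > 0" by (auto simp: eventually_at_filter)
    have conv: "F_converges_at_0 u f"
    proof (rule F_converges_at_0I[OF U f])
      have "((\<lambda>t. e t 0 * v 0 t 0) \<longlongrightarrow> 1 * c) (at_right 0)"
        unfolding v_def e_def by (intro tendsto_mult pot_sol_tendsto_left g admissible) (auto intro!:
            tendsto_eq_intros)
      then show "((\<lambda>t. u t 0) \<longlongrightarrow> f 0) (at_right 0)"
        by (rule Lim_transform_eventually[THEN tendsto_eq_rhs])
           (use ev_pos in \<open>auto simp: c_def elim!: eventually_mono simp: uw w_def\<close>)
      have "((\<lambda>t. e t 1 * v 0 t 1) \<longlongrightarrow> exp (- \<mu>) * d) (at_right 0)"
        unfolding v_def e_def by (intro tendsto_mult pot_sol_tendsto_right g admissible) (auto intro!: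
            tendsto_eq_intros)
      then show "((\<lambda>t. u t 1) \<longlongrightarrow> f 1) (at_right 0)"
        by (rule Lim_transform_eventually[THEN tendsto_eq_rhs])
           (use ev_pos in \<open>auto simp: d_def exp_minus elim!: eventually_mono simp: uw w_def\<close>)
      show "unif_conv_compacts u f (at_right 0)"
        unfolding unif_conv_compacts_def
      proof (intro allI impI)
        fix K assume K: "compact K \<and> K \<subseteq> {0<..<1::real}"
        have "continuous_on {0<..<1} (\<lambda>y. exp (\<mu> * y) * f y)"
          using f by (auto simp: F_space_def intro!: continuous_intros)
        then have gc: "continuous_on {0<..<1} g"
          by (rule continuous_on_eq) (auto simp: g_def)
        have "uniform_limit K (\<lambda>t x. e t x * v 0 t x) (\<lambda>x. exp (- \<mu> * x) * g x) (at_right 0)"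
          unfolding e_def v_def using K
          by (intro uniform_limit_gauge pot_sol_uniform_limit g gc admissible continuous_on_subset[OF gc])
              auto
        then show "uniform_limit K u f (at_right 0)"
        proof (rule uniform_limit_cong[THEN iffD1, rotated 2])
          show "\<forall>\<^sub>F t in at_right 0. \<forall>x\<in>K. e t x * v 0 t x = u t x"
            using ev_pos by eventually_elim (use K in \<open>auto simp: uw w_def\<close>)
          show "exp (- \<mu> * x) * g x = f x" if "x \<in> K" for x
            using K that by (auto simp: g_def subset_iff simp flip: mult.assoc exp_add)
        qed
      qed
    qed
    show "\<exists>u. solves_ivp \<mu> \<sigma> f u \<and> (\<forall>t>0. \<forall>x\<in>{0..1}. \<bar>u t x\<bar> \<le> exp \<bar>\<mu>\<bar> * (E t * ((1
        + \<bar>D t\<bar>) * exp \<bar>\<mu>\<bar>)) * F_mass f)"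
    proof (intro exI[of _ u] conjI allI impI ballI)
      show "solves_ivp \<mu> \<sigma> f u" using U bvp conv by (simp add: solves_ivp_def)
      fix t x :: real assume t: "t > 0" and x: "x \<in> {0..1}"
      define N where "N = mass g + \<bar>c\<bar> + \<bar>d\<bar>"
      have N0: "0 \<le> N" using mass_nonneg[of g] by (simp add: N_def)
      have N: "N \<le> exp \<bar>\<mu>\<bar> * F_mass f"
        unfolding N_def c_def d_def g_def[abs_def] by (rule F_mass_bound_datum[OF f])
      have "\<bar>v 0 t x\<bar> \<le> E t * (mass g + \<bar>c\<bar> + \<bar>d\<bar> + \<bar>D t\<bar> * N)"
        unfolding v_def
      proof (rule E[rule_format, OF t, THEN conjunct2, rule_format, OF x g admissible])
        fix s assume "0 < s" "s \<le> t"
        moreover have "D t * N \<le> \<bar>D t\<bar> * N" using N0 by (intro mult_right_mono) auto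
        ultimately show "\<bar>\<psi> s\<bar> \<le> \<bar>D t\<bar> * N \<and> \<bar>\<phi> s\<bar> \<le> \<bar>D t\<bar> * N"
          using bd[of s t] unfolding N_def[symmetric] by linarith
      qed
      also have "\<dots> = E t * ((1 + \<bar>D t\<bar>) * N)" by (simp add: N_def algebra_simps)
      also have "\<dots> \<le> E t * ((1 + \<bar>D t\<bar>) * (exp \<bar>\<mu>\<bar> * F_mass f))"
        by (intro mult_left_mono N E[rule_format, OF t, THEN conjunct1]) auto
      finally have "\<bar>w t x\<bar> \<le> exp \<bar>\<mu>\<bar> * (E t * ((1 + \<bar>D t\<bar>) * (exp \<bar>\<mu>\<bar> * F_mass f)))"
        by (rule w_le[OF t x])
      then show "\<bar>u t x\<bar> \<le> exp \<bar>\<mu>\<bar> * (E t * ((1 + \<bar>D t\<bar>) * exp \<bar>\<mu>\<bar>)) * F_mass f"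
        using uw[OF t x] by (simp add: mult_ac)
    qed
  qed
qed

section \<open>Duality and uniqueness\<close>

text \<open>Dominated convergence on the open interval, since the pointwise limit is known only
  there; the two end points do not affect the integrals.\<close>

lemma tendsto_integral_unit_interval:
  fixes h :: "real \<Rightarrow> real \<Rightarrow> real"
  assumes d: "0 < \<delta>" and c: "\<And>r. 0 < r \<Longrightarrow> r < \<delta> \<Longrightarrow> continuous_on {0..1} (h r)"
    and b: "\<And>r x. 0 < r \<Longrightarrow> r < \<delta> \<Longrightarrow> x \<in> {0..1} \<Longrightarrow> \<bar>h r x\<bar> \<le> B"
    and l: "\<And>x. 0 < x \<Longrightarrow> x < 1 \<Longrightarrow> ((\<lambda>r. h r x) \<longlongrightarrow> g x) (at_right 0)"
  shows "((\<lambda>r. integral {0..1} (h r)) \<longlongrightarrow> integral {0..1} g) (at_right 0)"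
  unfolding tendsto_at_iff_sequentially comp_def
proof (intro allI impI)
  fix X :: "nat \<Rightarrow> real" assume X: "\<forall>i. X i \<in> {0<..} - {0}" and X0: "X \<longlonglongrightarrow> 0"
  from order_tendstoD(2)[OF X0 d] obtain N where N: "\<And>n. N \<le> n \<Longrightarrow> X n < \<delta>"
    by (auto simp: eventually_sequentially)
  define Y where "Y n = X (n + N)" for n
  have Y: "0 < Y n" "Y n < \<delta>" for n using X N[of "n + N"] by (auto simp: Y_def)
  have Y0: "Y \<longlonglongrightarrow> 0" unfolding Y_def[abs_def] by (rule LIMSEQ_ignore_initial_segment[OF X0])
  have "(\<lambda>n. integral {0<..<1} (h (Y n))) \<longlonglongrightarrow> integral {0<..<1} g"
  proof (rule dominated_convergence(2)[where h = "\<lambda>x. B"])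
    show "h (Y n) integrable_on {0<..<1}" for n
      using integrable_continuous_interval[OF c[OF Y]] by (simp add: integrable_on_open_interval_real)
    show "(\<lambda>x. B) integrable_on {0<..<1::real}"
      by (simp add: integrable_on_open_interval_real integrable_const_ivl)
    show "norm (h (Y n) x) \<le> B" if "x \<in> {0<..<1}" for n x using b[OF Y, of x] that by simp
    show "(\<lambda>n. h (Y n) x) \<longlonglongrightarrow> g x" if "x \<in> {0<..<1}" for x
      using l[of x] that Y0 Y unfolding tendsto_at_iff_sequentially comp_def by simp
  qed
  then have "(\<lambda>n. integral {0..1} (h (X (n + N)))) \<longlonglongrightarrow> integral {0..1} g"
    by (simp add: integral_open_interval_real Y_def)
  then show "(\<lambda>n. integral {0..1} (h (X n))) \<longlonglongrightarrow> integral {0..1} g" by (rule LIMSEQ_offset)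
qed

text \<open>The weight exp (2 \<mu> x) makes the operator u'' / 2 + \<mu> u' symmetric up to
  boundary terms.\<close>

definition wint :: "real \<Rightarrow> (real \<Rightarrow> real) \<Rightarrow> (real \<Rightarrow> real) \<Rightarrow> real" where
  "wint \<mu> f g = integral {0..1} (\<lambda>x. exp (2 * \<mu> * x) * (f x * g x))"

text \<open>For \<open>\<sigma> = 0\<close> the quotient below is 0, so the pairing reduces to the weighted integral.\<close>

definition pairing :: "real \<Rightarrow> real \<Rightarrow> (real \<Rightarrow> real) \<Rightarrow> (real \<Rightarrow> real) \<Rightarrow> real" where
  "pairing \<mu> \<sigma> f g = wint \<mu> f g - 1 / (2 * \<sigma>) * (exp (2 * \<mu>) * (f 1 * g 1) + f 0 * g 0)"

lemma wint_commute: "wint \<mu> f g = wint \<mu> g f"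
  by (simp add: wint_def mult.commute[of "f _"])

lemma pairing_commute: "pairing \<mu> \<sigma> f g = pairing \<mu> \<sigma> g f"
  unfolding pairing_def wint_commute[of \<mu> f g] by (simp add: mult.commute)

lemma C12_bounded:
  assumes "C12 u" "0 < T1"
  obtains B where "\<And>t x. T1 \<le> t \<Longrightarrow> t \<le> T2 \<Longrightarrow> x \<in> {0..1} \<Longrightarrow> \<bar>u t x\<bar> \<le> B"
proof -
  have "compact ((\<lambda>(t, x). u t x) ` ({T1..T2} \<times> {0..1}))"
    by (rule compact_continuous_image[OF continuous_on_subset[OF C12_continuous(1)[OF assms(1)]]])
       (use assms(2) in \<open>auto intro: compact_Times\<close>)
  then have "bounded ((\<lambda>(t, x). u t x) ` ({T1..T2} \<times> {0..1}))" by (rule compact_imp_bounded)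
  then obtain B where B: "\<forall>y\<in>(\<lambda>(t, x). u t x) ` ({T1..T2} \<times> {0..1}). norm y \<le> B" unfolding bounded_iff
      by blast
  have "\<bar>u t x\<bar> \<le> B" if "T1 \<le> t" "t \<le> T2" "x \<in> {0..1}" for t x
  proof -
    have "u t x \<in> (\<lambda>(t, x). u t x) ` ({T1..T2} \<times> {0..1})" using that by force
    then show ?thesis using B by auto
  qed
  then show ?thesis using that by blast
qed

lemma U_space_bounded:
  assumes "u \<in> U_space"
  obtains B where "\<And>t x. 0 < t \<Longrightarrow> t \<le> 1 \<Longrightarrow> x \<in> {0..1} \<Longrightarrow> \<bar>u t x\<bar> \<le> B"
proof -
  have "bounded ((\<lambda>(t, x). u t x) ` ({0<..1} \<times> {0..1}))" using assms by (simp add: U_space_def)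
  then obtain B where B: "\<forall>y\<in>(\<lambda>(t, x). u t x) ` ({0<..1} \<times> {0..1}). norm y \<le> B" unfolding bounded_iff by blast
  have "\<bar>u t x\<bar> \<le> B" if "0 < t" "t \<le> 1" "x \<in> {0..1}" for t x
  proof -
    have "u t x \<in> (\<lambda>(t, x). u t x) ` ({0<..1} \<times> {0..1})" using that by force
    then show ?thesis using B by auto
  qed
  then show ?thesis using that by blast
qed

lemma C12_time_continuous:
  assumes "C12 u" "x \<in> {0..1}"
  shows "continuous_on {0<..} (\<lambda>t. u t x)"
  by (rule continuous_on_compose2[OF C12_continuous(1)[OF assms(1)], of _ "\<lambda>t. (t, x)", simplified])
     (use assms(2) in \<open>auto intro!: continuous_intros\<close>)

lemma C12_tendsto_back:
  assumes "C12 u" "x \<in> {0..1}" "0 < t"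
  shows "((\<lambda>r. u (t - r) x) \<longlongrightarrow> u t x) (at_right 0)"
proof -
  have "isCont (\<lambda>t. u t x) t"
    using C12_time_continuous[OF assms(1,2)] assms(3) by (simp add: continuous_on_eq_continuous_at)
  moreover have "((\<lambda>r. t - r) \<longlongrightarrow> t) (at_right 0)" by (auto intro!: tendsto_eq_intros)
  ultimately show ?thesis by (rule isCont_tendsto_compose)
qed

text \<open>As r decreases to 0 the times t - r stay between t / 2 and t, where \<open>u\<close> is
  bounded, and \<open>w\<close> is bounded near time 0 by membership in \<open>U_space\<close>.
  Convergence of \<open>w r\<close> is asked inside the interval only; this fits a solution whose
  end values are not yet known to converge.\<close>

lemma wint_tendsto:
  assumes w: "w \<in> U_space" and u: "u \<in> U_space" and t: "0 < t"
    and l: "\<And>x. 0 < x \<Longrightarrow> x < 1 \<Longrightarrow> ((\<lambda>r. w r x) \<longlongrightarrow> g x) (at_right 0)"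
  shows "((\<lambda>r. wint \<mu> (w r) (u (t - r))) \<longlongrightarrow> wint \<mu> g (u t)) (at_right 0)"
proof -
  obtain B where B: "\<And>r x. 0 < r \<Longrightarrow> r \<le> 1 \<Longrightarrow> x \<in> {0..1} \<Longrightarrow> \<bar>w r x\<bar> \<le> B" using U_space_bounded[OF w] by metis
  obtain C where C: "\<And>r x. t / 2 \<le> r \<Longrightarrow> r \<le> t \<Longrightarrow> x \<in> {0..1} \<Longrightarrow> \<bar>u r x\<bar> \<le> C"
    using C12_bounded[OF U_space_C12[OF u], of "t / 2" t] t by auto
  show ?thesis
    unfolding wint_def
  proof (rule tendsto_integral_unit_interval[where \<delta> = "min 1 (t / 2)" and B = "exp (2 * \<bar>\<mu>\<bar>) * (B * C)"])
  show "0 < min 1 (t / 2)" using t by simp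
  fix r :: real assume r: "0 < r" "r < min 1 (t / 2)"
  show "continuous_on {0..1} (\<lambda>x. exp (2 * \<mu> * x) * (w r x * u (t - r) x))"
    using r t
    by (intro continuous_intros slice_continuous[OF C12_continuous(1)[OF U_space_C12[OF w]]]
        slice_continuous[OF C12_continuous(1)[OF U_space_C12[OF u]]]) auto
  fix x :: real assume x: "x \<in> {0..1}"
  have "\<mu> * x \<le> \<bar>\<mu>\<bar>" using x mult_mono[of \<mu> "\<bar>\<mu>\<bar>" x 1] by auto
  then have e: "exp (2 * \<mu> * x) \<le> exp (2 * \<bar>\<mu>\<bar>)" by simp
  have p: "\<bar>w r x\<bar> * \<bar>u (t - r) x\<bar> \<le> B * C"
    using B[of r x] C[of "t - r" x] r x by (intro mult_mono) auto
  have "exp (2 * \<mu> * x) * (\<bar>w r x\<bar> * \<bar>u (t - r) x\<bar>) \<le> exp (2 * \<bar>\<mu>\<bar>) * (B * C)"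
    by (rule mult_mono[OF e p]) auto
  then show "\<bar>exp (2 * \<mu> * x) * (w r x * u (t - r) x)\<bar> \<le> exp (2 * \<bar>\<mu>\<bar>) * (B * C)"
    by (simp add: abs_mult)
next
  fix x :: real assume x: "0 < x" "x < 1"
  show "((\<lambda>r. exp (2 * \<mu> * x) * (w r x * u (t - r) x)) \<longlongrightarrow> exp (2 * \<mu> * x) * (g x * u t x)) (at_right 0)"
    by (intro tendsto_intros l x C12_tendsto_back[OF U_space_C12[OF u]] t) (use x in auto)
  qed
qed

lemma pairing_tendsto:
  assumes w: "w \<in> U_space" and u: "u \<in> U_space" and t: "0 < t" and l: "F_converges_at_0 w g"
  shows "((\<lambda>r. pairing \<mu> \<sigma> (w r) (u (t - r))) \<longlongrightarrow> pairing \<mu> \<sigma> g (u t)) (at_right 0)"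
proof -
  have l': "((\<lambda>r. w r x) \<longlongrightarrow> g x) (at_right 0)" if "x \<in> {0..1}" for x
    using l that by (simp add: F_converges_at_0_def)
  show ?thesis unfolding pairing_def
    by (intro tendsto_intros wint_tendsto[OF w u t] l' C12_tendsto_back[OF U_space_C12[OF u] _ t]) auto
qed

lemma wint_has_derivative:
  assumes u: "C12 u" and v: "C12 v" and s: "0 < s" "s < t"
  shows "((\<lambda>s. wint \<mu> (u s) (v (t - s))) has_real_derivative
    integral {0..1} (\<lambda>x. exp (2 * \<mu> * x) * (dt u s x * v (t - s) x - u s x * dt v (t - s) x))) (at s)"
proof -
  have pc: "continuous_on ({0<..<t} \<times> {0..1}) (\<lambda>p. y (fst p) (snd p))"
    if "continuous_on ({0<..} \<times> {0..1}) (\<lambda>(t, x). y t x)" for y :: "real \<Rightarrow> real \<Rightarrow> real"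
    by (rule continuous_on_subset[OF that[unfolded case_prod_beta]]) auto
  have qc: "continuous_on ({0<..<t} \<times> {0..1}) (\<lambda>p. y (t - fst p) (snd p))"
    if "continuous_on ({0<..} \<times> {0..1}) (\<lambda>(t, x). y t x)" for y :: "real \<Rightarrow> real \<Rightarrow> real"
    by (rule continuous_on_compose2[OF that, of _ "\<lambda>p. (t - fst p, snd p)", simplified])
       (auto intro!: continuous_intros)
  have "((\<lambda>s. integral (cbox 0 1) (\<lambda>x. exp (2 * \<mu> * x) * (u s x * v (t - s) x))) has_real_derivative
    integral (cbox 0 1) (\<lambda>x. exp (2 * \<mu> * x) * (dt u s x * v (t - s) x - u s x * dt v (t - s) x))) (at s
        within {0<..<t})"
  proof (rule leibniz_rule_field_derivative)
    fix r x :: real assume r: "r \<in> {0<..<t}" and x: "x \<in> cbox 0 1"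
    have 1: "((\<lambda>s. u s x) has_real_derivative dt u r x) (at r)"
      by (rule C12_derivs(1)[OF u]) (use r x in auto)
    have 2: "((\<lambda>s. v (t - s) x) has_real_derivative dt v (t - r) x * (- 1)) (at r)"
      by (rule DERIV_chain2[OF C12_derivs(1)[OF v]]) (use r x in \<open>auto intro!: derivative_eq_intros\<close>)
    have "((\<lambda>s. exp (2 * \<mu> * x) * (u s x * v (t - s) x)) has_real_derivative
        exp (2 * \<mu> * x) * (dt u r x * v (t - r) x - u r x * dt v (t - r) x)) (at r)"
      by (rule DERIV_cong[OF DERIV_cmult[OF DERIV_mult[OF 1 2]]]) (simp add: algebra_simps)
    then show "((\<lambda>s. exp (2 * \<mu> * x) * (u s x * v (t - s) x)) has_real_derivative
        exp (2 * \<mu> * x) * (dt u r x * v (t - r) x - u r x * dt v (t - r) x)) (at r within {0<..<t})"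
      by (rule has_field_derivative_at_within)
  next
    fix r :: real assume r: "r \<in> {0<..<t}"
    have "continuous_on {0..1} (\<lambda>x. exp (2 * \<mu> * x) * (u r x * v (t - r) x))"
      by (intro continuous_intros slice_continuous C12_continuous u v) (use r in auto)
    then show "(\<lambda>x. exp (2 * \<mu> * x) * (u r x * v (t - r) x)) integrable_on cbox 0 1"
      unfolding cbox_interval by (rule integrable_continuous_interval)
  next
    show "continuous_on ({0<..<t} \<times> cbox 0 1) (\<lambda>(s, x). exp (2 * \<mu> * x) * (dt u s x * v (t - s) x
        - u s x * dt v (t - s) x))"
      unfolding case_prod_beta cbox_interval
      by (intro continuous_intros pc qc C12_continuous u v)
  qed (use s in auto)
  then show ?thesis using s by (simp add: wint_def at_within_open[of s "{0<..<t}"])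
qed

lemma C12_interior_derivs:
  assumes "C12 u" "0 < t" "0 < x" "x < 1"
  shows "(u t has_real_derivative dx u t x) (at x)" "(dx u t has_real_derivative dxx u t x) (at x)"
    "((\<lambda>s. u s x) has_real_derivative dt u t x) (at t)"
  using C12_derivs[OF assms(1,2), of x] assms(3,4) by (simp_all add: at_within_Icc_at)

text \<open>Lagrange's identity: after insertion of the equation, the s-derivative of the weighted
  integrand is a total x-derivative, so only end terms in u' v - u v' survive. The boundary
  conditions express these through time derivatives, and they cancel against the boundary part of
  the pairing. For \<sigma> = 0 the conditions give no hold on u', and vanishing end values take
  over.\<close>

lemma pairing_const:
  assumes u: "u \<in> U_space" and v: "v \<in> U_space" and bu: "solves_bvp \<mu> \<sigma> u" and bv: "solves_bvp \<mu> \<sigma> v"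
    and z: "\<sigma> \<noteq> 0 \<or> (\<forall>s>0. u s 0 = 0 \<and> u s 1 = 0 \<and> v s 0 = 0 \<and> v s 1 = 0)"
  shows "\<exists>c. \<forall>s\<in>{0<..<t}. pairing \<mu> \<sigma> (u s) (v (t - s)) = c"
proof -
  note cu = U_space_C12[OF u] and cv = U_space_C12[OF v]
  have "((\<lambda>s. pairing \<mu> \<sigma> (u s) (v (t - s))) has_real_derivative 0) (at s)" if s: "0 < s" "s < t" for s
  proof -
    define r where "r = t - s"
    have r: "0 < r" using s by (simp add: r_def)
    \<comment> \<open>The flux in Lagrange's identity. The relative minus sign comes from
      \<open>v\<close> running backwards in time.\<close>
    define W where "W x = exp (2 * \<mu> * x) / 2 * (dx u s x * v r x - u s x * dx v r x)" for x
    have "((\<lambda>x. exp (2 * \<mu> * x) * (dt u s x * v r x - u s x * dt v r x)) has_integral W 1 - W 0) {0..1}"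
    proof (rule fundamental_theorem_of_calculus_interior)
      show "continuous_on {0..1} W"
        unfolding W_def
        by (intro continuous_intros slice_continuous[OF C12_continuous(1)[OF cu] s(1)] slice_continuous[OF
            C12_continuous(3)[OF cu] s(1)]
            slice_continuous[OF C12_continuous(1)[OF cv] r] slice_continuous[OF C12_continuous(3)[OF cv] r])
                auto
      fix x :: real assume x: "x \<in> {0<..<1}"
      have d: "(u s has_real_derivative dx u s x) (at x)" "(dx u s has_real_derivative dxx u s x) (at x)"
        "(v r has_real_derivative dx v r x) (at x)" "(dx v r has_real_derivative dxx v r x) (at x)"
        using x by (auto intro: C12_interior_derivs cu cv s r)
      have e: "((\<lambda>x. exp (2 * \<mu> * x) / 2) has_real_derivative \<mu> * exp (2 * \<mu> * x)) (at x)"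
        by (auto intro!: derivative_eq_intros)
      have eq: "dt u s x = 1 / 2 * dxx u s x + \<mu> * dx u s x" "dt v r x = 1 / 2 * dxx v r x + \<mu> * dx v r x"
        using bu bv s r x by (auto simp: solves_bvp_def)
      have "(W has_real_derivative exp (2 * \<mu> * x) * (dt u s x * v r x - u s x * dt v r x)) (at x)"
        unfolding W_def[abs_def] eq
        by (rule DERIV_cong[OF DERIV_mult[OF e DERIV_diff[OF DERIV_mult[OF d(2,3)] DERIV_mult[OF d(1,4)]]]])
           (simp add: algebra_simps)
      then show "(W has_vector_derivative exp (2 * \<mu> * x) * (dt u s x * v r x - u s x * dt v r x)) (at x)"
        by (simp only: has_real_derivative_iff_has_vector_derivative)
    qed simp
    then have I: "integral {0..1} (\<lambda>x. exp (2 * \<mu> * x) * (dt u s x * v r x - u s x * dt v r x)) = W 1 - W 0"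
      by (rule integral_unique)
    have bd: "((\<lambda>s. u s y * v (t - s) y) has_real_derivative dt u s y * v r y - u s y * dt v r y) (at s)"
        if "y \<in> {0..1}" for y
    proof -
      have 1: "((\<lambda>s. u s y) has_real_derivative dt u s y) (at s)" by (rule C12_derivs(1)[OF cu s(1) that])
      have 2: "((\<lambda>s. v (t - s) y) has_real_derivative dt v r y * (- 1)) (at s)"
        unfolding r_def
        by (rule DERIV_chain2[where f = "\<lambda>s. v s y" and g = "\<lambda>s. t - s", OF C12_derivs(1)[OF cv r[unfolded
            r_def] that]])
           (auto intro!: derivative_eq_intros)
      show ?thesis by (rule DERIV_cong[OF DERIV_mult[OF 1 2]]) (simp add: r_def algebra_simps)
    qed
    have "((\<lambda>s. pairing \<mu> \<sigma> (u s) (v (t - s))) has_real_derivative (W 1 - W 0) - 1 / (2 * \<sigma>) *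
        (exp (2 * \<mu>) * (dt u s 1 * v r 1 - u s 1 * dt v r 1) + (dt u s 0 * v r 0 - u s 0 * dt v r 0))) (at s)"
      unfolding pairing_def I[symmetric] r_def
      by (rule DERIV_diff[OF wint_has_derivative[OF cu cv s]
            DERIV_cmult[OF DERIV_add[OF DERIV_cmult[OF bd[unfolded r_def]] bd[unfolded r_def]]]]) auto
    moreover have "(W 1 - W 0) - 1 / (2 * \<sigma>) *
        (exp (2 * \<mu>) * (dt u s 1 * v r 1 - u s 1 * dt v r 1) + (dt u s 0 * v r 0 - u s 0 * dt v r 0)) = 0"
    proof (cases "\<sigma> = 0")
      case True
      then show ?thesis using z s r by (simp add: W_def)
    next
      case False
      have d: "dt u s 0 = - \<sigma> * dx u s 0" "dt u s 1 = \<sigma> * dx u s 1" "dt v r 0 = - \<sigma> * dx v r 0"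
          "dt v r 1 = \<sigma> * dx v r 1"
        using bu bv s r by (auto simp: solves_bvp_def)
      have "W 1 - W 0 = exp (2 * \<mu>) / 2 * (dx u s 1 * v r 1 - u s 1 * dx v r 1) - (dx u s 0 * v r 0
          - u s 0 * dx v r 0) / 2"
        by (simp add: W_def)
      moreover have "1 / (2 * \<sigma>) * (exp (2 * \<mu>) * ((\<sigma> * dx u s 1) * v r 1 - u s 1 * (\<sigma> * dx v r 1))
          + ((- \<sigma> * dx u s 0) * v r 0 - u s 0 * (- \<sigma> * dx v r 0)))
        = exp (2 * \<mu>) / 2 * (dx u s 1 * v r 1 - u s 1 * dx v r 1) - (dx u s 0 * v r 0 - u s 0 * dx v r 0) / 2"
        using False by (simp add: field_simps)
      ultimately show ?thesis unfolding d by linarith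
    qed
    ultimately show ?thesis by simp
  qed
  then have "\<exists>c. \<forall>s\<in>{0<..<t}. pairing \<mu> \<sigma> (u s) (v (t - s)) = c"
    by (intro has_field_derivative_zero_constant) (auto intro: has_field_derivative_at_within)
  then show ?thesis .
qed

lemma eventually_at_right_0_less: "0 < (t::real) \<Longrightarrow> \<forall>\<^sub>F r in at_right 0. 0 < r \<and> r < t"
  unfolding eventually_at_right[of 0 t] by (intro exI[of _ t]) auto

text \<open>The conserved quantity is evaluated at both ends of the time interval. The limit at the
  far end is the limit at the near end with the roles of \<open>u\<close> and \<open>v\<close>
  exchanged, by symmetry of the pairing.\<close>

lemma duality:
  assumes u: "solves_ivp \<mu> \<sigma> f u" and v: "solves_ivp \<mu> \<sigma> g v" and t: "0 < t"
    and z: "\<sigma> \<noteq> 0 \<or> (\<forall>s>0. u s 0 = 0 \<and> u s 1 = 0 \<and> v s 0 = 0 \<and> v s 1 = 0)"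
  shows "pairing \<mu> \<sigma> f (v t) = pairing \<mu> \<sigma> (u t) g"
proof -
  have U: "u \<in> U_space" "v \<in> U_space" using u v by (auto simp: solves_ivp_def)
  obtain c where c: "\<And>s. s \<in> {0<..<t} \<Longrightarrow> pairing \<mu> \<sigma> (u s) (v (t - s)) = c"
    using pairing_const[OF U _ _ z, of \<mu> t] u v unfolding solves_ivp_def by blast
  have ev: "\<forall>\<^sub>F r in at_right 0. r \<in> {0<..<t}"
    using eventually_at_right_0_less[OF t] by eventually_elim auto
  have "((\<lambda>r. pairing \<mu> \<sigma> (u r) (v (t - r))) \<longlongrightarrow> pairing \<mu> \<sigma> f (v t)) (at_right 0)"
    by (rule pairing_tendsto[OF U t]) (use u in \<open>simp add: solves_ivp_def\<close>)
  moreover have "((\<lambda>r. pairing \<mu> \<sigma> (u r) (v (t - r))) \<longlongrightarrow> c) (at_right 0)"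
  proof (rule tendsto_eventually)
    show "\<forall>\<^sub>F r in at_right 0. pairing \<mu> \<sigma> (u r) (v (t - r)) = c"
      using ev by eventually_elim (rule c)
  qed
  ultimately have 1: "pairing \<mu> \<sigma> f (v t) = c" by (intro tendsto_unique[of "at_right 0"]) auto
  have "((\<lambda>r. pairing \<mu> \<sigma> (v r) (u (t - r))) \<longlongrightarrow> pairing \<mu> \<sigma> g (u t)) (at_right 0)"
    by (rule pairing_tendsto[OF U(2,1) t]) (use v in \<open>simp add: solves_ivp_def\<close>)
  moreover have "((\<lambda>r. pairing \<mu> \<sigma> (v r) (u (t - r))) \<longlongrightarrow> c) (at_right 0)"
  proof (rule tendsto_eventually)
    show "\<forall>\<^sub>F r in at_right 0. pairing \<mu> \<sigma> (v r) (u (t - r)) = c"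
      using ev
    proof eventually_elim
      case (elim r)
      then show ?case using c[of "t - r"] by (simp add: pairing_commute[of \<mu> \<sigma> "v r"])
    qed
  qed
  ultimately have "pairing \<mu> \<sigma> g (u t) = c" by (intro tendsto_unique[of "at_right 0"]) auto
  with 1 show ?thesis by (simp add: pairing_commute[of \<mu> \<sigma> "u t"])
qed

lemma solves_ivp_linear:
  assumes u: "solves_ivp \<mu> \<sigma> f u" and v: "solves_ivp \<mu> \<sigma> g v"
  shows "solves_ivp \<mu> \<sigma> (\<lambda>x\<in>{0..1}. a * f x + b * g x) (\<lambda>t\<in>{0<..}. \<lambda>x\<in>{0..1}. a * u t x + b * v t x)"
    (is "solves_ivp _ _ ?h ?w")
proof -
  have U: "u \<in> U_space" "v \<in> U_space" and F: "f \<in> F_space" "g \<in> F_space"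
    using u v by (auto simp: solves_ivp_def F_converges_at_0_def)
  note cu = U_space_C12[OF U(1)] and cv = U_space_C12[OF U(2)]
  obtain B where B: "\<And>t x. 0 < t \<Longrightarrow> t \<le> 1 \<Longrightarrow> x \<in> {0..1} \<Longrightarrow> \<bar>u t x\<bar> \<le> B" using U_space_bounded[OF U(1)] by metis
  obtain C where C: "\<And>t x. 0 < t \<Longrightarrow> t \<le> 1 \<Longrightarrow> x \<in> {0..1} \<Longrightarrow> \<bar>v t x\<bar> \<le> C" using U_space_bounded[OF U(2)] by metis
  have cc: "continuous_on ({0<..} \<times> {0..1}) (\<lambda>(t, x). a * y t x + b * z t x)"
    if "continuous_on ({0<..} \<times> {0..1}) (\<lambda>(t, x). y t x)" "continuous_on ({0<..} \<times> {0..1}) (\<lambda>(t, x). z t x)"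
    for y z :: "real \<Rightarrow> real \<Rightarrow> real"
    using that unfolding case_prod_beta by (intro continuous_intros)
  have K: "\<bar>a * u t x + b * v t x\<bar> \<le> \<bar>a\<bar> * B + \<bar>b\<bar> * C" if "0 < t" "t \<le> 1" "x \<in> {0..1}" for t x
  proof -
    have "\<bar>a * u t x\<bar> \<le> \<bar>a\<bar> * B" "\<bar>b * v t x\<bar> \<le> \<bar>b\<bar> * C"
      unfolding abs_mult using B[OF that] C[OF that] by (auto intro: mult_left_mono)
    then show ?thesis by linarith
  qed
  have e: "?w \<in> {0<..} \<rightarrow>\<^sub>E extensional {0..1}" by auto
  have we: "?w t x = a * u t x + b * v t x" if "0 < t" "x \<in> {0..1}" for t x using that by simp
  note W = U_spaceI[OF cc[OF C12_continuous(1)[OF cu] C12_continuous(1)[OF cv]]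
      cc[OF C12_continuous(3)[OF cu] C12_continuous(3)[OF cv]]
      cc[OF C12_continuous(4)[OF cu] C12_continuous(4)[OF cv]]
      cc[OF C12_continuous(2)[OF cu] C12_continuous(2)[OF cv]]
      DERIV_add[OF DERIV_cmult[OF C12_interior_derivs(1)[OF cu]] DERIV_cmult[OF C12_interior_derivs(1)[OF
          cv]]]
      DERIV_add[OF DERIV_cmult[OF C12_interior_derivs(2)[OF cu]] DERIV_cmult[OF C12_interior_derivs(2)[OF
          cv]]]
      DERIV_add[OF DERIV_cmult[OF C12_interior_derivs(3)[OF cu]] DERIV_cmult[OF C12_interior_derivs(3)[OF
          cv]]]
      K e we]
  have wU: "?w \<in> U_space" by (rule W(1)) assumption+
  have wd: "dt ?w t x = a * dt u t x + b * dt v t x" "dx ?w t x = a * dx u t x + b * dx v t x"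
    "dxx ?w t x = a * dxx u t x + b * dxx v t x" if "0 < t" "x \<in> {0..1}" for t x
    using that by - (rule W(2) W(3) W(4); assumption)+
  have bvp: "solves_bvp \<mu> \<sigma> ?w"
    using u v unfolding solves_bvp_def solves_ivp_def by (simp add: wd algebra_simps)
  have hF: "?h \<in> F_space"
  proof -
    obtain M where M: "0 \<le> M" "\<And>x. x \<in> {0..1} \<Longrightarrow> \<bar>f x\<bar> \<le> M" using F_space_bound[OF F(1)] by metis
    obtain N where N: "0 \<le> N" "\<And>x. x \<in> {0..1} \<Longrightarrow> \<bar>g x\<bar> \<le> N" using F_space_bound[OF F(2)] by metis
    have "norm (a * f x + b * g x) \<le> \<bar>a\<bar> * M + \<bar>b\<bar> * N" if "x \<in> {0..1}" for x
    proof -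
      have "\<bar>a * f x\<bar> \<le> \<bar>a\<bar> * M" "\<bar>b * g x\<bar> \<le> \<bar>b\<bar> * N"
        unfolding abs_mult using M(2)[OF that] N(2)[OF that] by (auto intro: mult_left_mono)
      then show ?thesis unfolding real_norm_def by linarith
    qed
    then have "bounded (?h ` {0..1})" unfolding bounded_iff by (intro exI[of _ "\<bar>a\<bar> * M + \<bar>b\<bar> * N"]) auto
    moreover have "continuous_on {0<..<1} (\<lambda>x. a * f x + b * g x)"
      using F by (intro continuous_intros) (auto simp: F_space_def)
    then have "continuous_on {0<..<1} ?h" by (rule continuous_on_eq) auto
    ultimately show ?thesis by (simp add: F_space_def)
  qed
  have ev: "\<forall>\<^sub>F t in at_right (0::real). 0 < t" by (auto simp: eventually_at_filter)
  have pw: "((\<lambda>t. ?w t x) \<longlongrightarrow> ?h x) (at_right 0)" if x: "x \<in> {0..1}" for x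
  proof -
    have "((\<lambda>t. a * u t x + b * v t x) \<longlongrightarrow> a * f x + b * g x) (at_right 0)"
      using u v x by (intro tendsto_intros) (auto simp: solves_ivp_def F_converges_at_0_def)
    then have "((\<lambda>t. ?w t x) \<longlongrightarrow> a * f x + b * g x) (at_right 0)"
      by (rule Lim_transform_eventually) (use ev in eventually_elim, use x in auto)
    then show ?thesis using x by simp
  qed
  have "unif_conv_compacts ?w ?h (at_right 0)"
    unfolding unif_conv_compacts_def
  proof (intro allI impI)
    fix K assume K: "compact K \<and> K \<subseteq> {0<..<1::real}"
    have ul: "uniform_limit K u f (at_right 0)" "uniform_limit K v g (at_right 0)"
      using u v K by (auto simp: solves_ivp_def F_converges_at_0_def unif_conv_compacts_def)
    have "uniform_limit K (\<lambda>t x. a * u t x + b * v t x) (\<lambda>x. a * f x + b * g x) (at_right 0)"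
      by (intro uniform_limit_add bounded_linear.uniform_limit[OF bounded_linear_mult_right] ul)
    then show "uniform_limit K ?w ?h (at_right 0)"
    proof (rule uniform_limit_cong[THEN iffD1, rotated 2])
      show "\<forall>\<^sub>F t in at_right 0. \<forall>x\<in>K. a * u t x + b * v t x = ?w t x"
        using ev by eventually_elim (use K in force)
      show "a * f x + b * g x = ?h x" if "x \<in> K" for x
      proof -
        have "x \<in> {0..1}" using K that by force
        then show ?thesis by simp
      qed
    qed
  qed
  then have "F_converges_at_0 ?w ?h"
    by (intro F_converges_at_0I wU hF pw) auto
  then show ?thesis using wU bvp by (simp add: solves_ivp_def)
qed

text \<open>For \<sigma> = 0 the boundary condition says that the time derivative vanishes at both
  ends.\<close>

lemma bdry_const:
  assumes u: "u \<in> U_space" and b: "solves_bvp \<mu> 0 u" and y: "y \<in> {0, 1}"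
  shows "\<exists>c. \<forall>t>0. u t y = c"
proof -
  have "((\<lambda>s. u s y) has_real_derivative 0) (at t)" if "t > 0" for t
  proof -
    have "dt u t y = 0" using b that y by (auto simp: solves_bvp_def)
    moreover have "((\<lambda>s. u s y) has_real_derivative dt u t y) (at t)"
      by (rule C12_derivs(1)[OF U_space_C12[OF u] that]) (use y in auto)
    ultimately show ?thesis by simp
  qed
  then have "\<exists>c. \<forall>t\<in>{0<..}. u t y = c"
    by (intro has_field_derivative_zero_constant) (auto intro: has_field_derivative_at_within)
  then show ?thesis by auto
qed

lemma bdry_zero:
  assumes u: "solves_ivp \<mu> 0 f u" and y: "y \<in> {0, 1}" and f: "f y = 0" and t: "0 < t"
  shows "u t y = 0"
proof -
  obtain c where c: "\<And>t. t > 0 \<Longrightarrow> u t y = c"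
    using bdry_const[of u \<mu> y] u y unfolding solves_ivp_def by blast
  have "((\<lambda>t. u t y) \<longlongrightarrow> c) (at_right 0)"
    by (rule tendsto_eventually) (auto simp: eventually_at_filter c)
  moreover have "((\<lambda>t. u t y) \<longlongrightarrow> f y) (at_right 0)"
    using u y by (auto simp: solves_ivp_def F_converges_at_0_def)
  ultimately have "c = f y" by (intro tendsto_unique[of "at_right 0"]) auto
  then show ?thesis using c[OF t] f by simp
qed

text \<open>Duality with a datum made from \<open>u\<close> itself: equal to \<open>u t\<close>
  inside and 0 at the ends. The boundary terms drop out for either sign of \<sigma>, and what
  remains is the weighted integral of the square of \<open>u t\<close>.\<close>

lemma solves_ivp_zero:
  assumes u: "solves_ivp \<mu> \<sigma> (\<lambda>x\<in>{0..1}. 0) u" and t: "0 < t" and x: "x \<in> {0..1}"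
  shows "u t x = 0"
proof -
  have U: "u \<in> U_space" using u by (simp add: solves_ivp_def)
  have c: "continuous_on {0..1} (u t)" by (rule slice_continuous[OF C12_continuous(1)[OF U_space_C12[OF U]]
      t])
  \<comment> \<open>In general discontinuous at the ends, which \<open>F_space\<close>
    allows.\<close>
  define g where "g = (\<lambda>x\<in>{0..1}. if x \<in> {0<..<1} then u t x else 0)"
  have g: "g \<in> F_space"
  proof -
    have uF: "u t \<in> F_space" by (rule U_space_slice_F[OF U t])
    obtain M where M: "0 \<le> M" "\<And>x. x \<in> {0..1} \<Longrightarrow> \<bar>u t x\<bar> \<le> M" using F_space_bound[OF uF] by metis
    have "norm (g x) \<le> M" if "x \<in> {0..1}" for x using that M(1) M(2)[of x] by (auto simp: g_def)
    then have "bounded (g ` {0..1})" unfolding bounded_iff by blast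
    moreover have "continuous_on {0<..<1} g"
      by (rule continuous_on_eq[OF continuous_on_subset[OF c]]) (auto simp: g_def)
    ultimately show ?thesis by (simp add: F_space_def g_def)
  qed
  obtain v where v: "solves_ivp \<mu> \<sigma> g v" using solves_ivp_exists[of \<mu> \<sigma>] g by blast
  \<comment> \<open>For \<sigma> = 0 end values are constant in time, and both data vanish at the
    ends.\<close>
  have z: "\<sigma> \<noteq> 0 \<or> (\<forall>s>0. u s 0 = 0 \<and> u s 1 = 0 \<and> v s 0 = 0 \<and> v s 1 = 0)"
  proof (cases "\<sigma> = 0")
    case True
    then show ?thesis using u v
      by (auto intro!: bdry_zero[of \<mu> "\<lambda>x\<in>{0..1}. 0" u] bdry_zero[of \<mu> g v] simp: g_def)
  qed simp
  have "pairing \<mu> \<sigma> (\<lambda>x\<in>{0..1}. 0) (v t) = 0"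
  proof -
    have "wint \<mu> (\<lambda>x\<in>{0..1}. 0) (v t) = integral {0..1} (\<lambda>x::real. 0 :: real)"
      unfolding wint_def by (rule integral_cong) auto
    then show ?thesis by (simp add: pairing_def)
  qed
  then have "pairing \<mu> \<sigma> (u t) g = 0" using duality[OF u v t z] by simp
  moreover have "g 0 = 0" "g 1 = 0" by (auto simp: g_def)
  ultimately have "wint \<mu> (u t) g = 0" by (simp add: pairing_def)
  moreover have "wint \<mu> (u t) g = integral {0..1} (\<lambda>x. exp (2 * \<mu> * x) * (u t x * u t x))"
    unfolding wint_def by (rule integral_spike[of "{0, 1}"]) (auto simp: g_def)
  ultimately have i0: "integral {0..1} (\<lambda>x. exp (2 * \<mu> * x) * (u t x * u t x)) = 0" by simp
  have ce: "continuous_on {0..1} (\<lambda>x. exp (2 * \<mu> * x) * (u t x * u t x))" by (intro continuous_intros c)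
  then have "((\<lambda>x. exp (2 * \<mu> * x) * (u t x * u t x)) has_integral 0) (cbox 0 1)"
    using integrable_integral[OF integrable_continuous_interval[OF ce]] i0 by simp
  \<comment> \<open>A nonnegative continuous function with integral 0 vanishes on the whole closed
    interval, so the end values are covered too.\<close>
  from has_integral_0_cbox_imp_0[OF _ _ this, of x] ce x
  have "exp (2 * \<mu> * x) * (u t x * u t x) = 0" by (auto simp: box_real)
  then show ?thesis by simp
qed

lemma solves_ivp_unique:
  assumes u: "solves_ivp \<mu> \<sigma> f u" and v: "solves_ivp \<mu> \<sigma> f v"
  shows "u = v"
proof -
  let ?w = "\<lambda>t\<in>{0<..}. \<lambda>x\<in>{0..1}. 1 * u t x + (- 1) * v t x"
  have "solves_ivp \<mu> \<sigma> (\<lambda>x\<in>{0..1}. 1 * f x + (- 1) * f x) ?w" by (rule solves_ivp_linear[OF u v])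
  moreover have "(\<lambda>x\<in>{0..1}. 1 * f x + (- 1) * f x) = (\<lambda>x\<in>{0..1}. 0)" by auto
  ultimately have w: "solves_ivp \<mu> \<sigma> (\<lambda>x\<in>{0..1}. 0) ?w" by simp
  have e: "u \<in> {0<..} \<rightarrow>\<^sub>E extensional {0..1}" "v \<in> {0<..} \<rightarrow>\<^sub>E extensional {0..1}"
    using u v by (auto simp: solves_ivp_def U_space_def)
  show ?thesis
  \<comment> \<open>Equality of functions includes agreement off the domain, where both sides are
    \<open>undefined\<close>.\<close>
  proof (rule PiE_ext[OF e])
    fix t :: real assume t: "t \<in> {0<..}"
    show "u t = v t"
    proof (rule extensionalityI[of _ "{0..1}"])
      show "u t \<in> extensional {0..1}" "v t \<in> extensional {0..1}" using e t by auto
      fix x :: real assume x: "x \<in> {0..1}"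
      show "u t x = v t x" using solves_ivp_zero[OF w, of t x] t x by simp
    qed
  qed
qed

section \<open>The semigroup\<close>

lemma indicator_datum_F: "y \<in> {0, 1} \<Longrightarrow> (\<lambda>x\<in>{0..1}. if x = y then 1 else 0) \<in> F_space"
proof -
  assume y: "y \<in> {0, 1}"
  let ?f = "\<lambda>x\<in>{0..1}. if x = y then 1 else 0 :: real"
  have "norm (?f x) \<le> 1" if "x \<in> {0..1}" for x using that by auto
  then have "bounded (?f ` {0..1})" unfolding bounded_iff by blast
  moreover have "continuous_on {0<..<1} ?f"
    by (rule continuous_on_eq[where f = "\<lambda>_. 0"]) (use y in auto)
  ultimately show ?thesis by (simp add: F_space_def)
qed

text \<open>Pairing \<open>u\<close> with the solutions started from the indicators of the two endpoints gives two
  linear equations for \<open>u(s, 0)\<close> and \<open>u(s, 1)\<close>, nonsingular for small times.\<close>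

lemma bdry_values_converge:
  assumes u: "u \<in> U_space" and bvp: "solves_bvp \<mu> \<sigma> u"
    and l: "\<And>x. 0 < x \<Longrightarrow> x < 1 \<Longrightarrow> ((\<lambda>t. u t x) \<longlongrightarrow> g x) (at_right 0)"
  shows "\<exists>a b. ((\<lambda>t. u t 0) \<longlongrightarrow> a) (at_right 0) \<and> ((\<lambda>t. u t 1) \<longlongrightarrow> b) (at_right 0)"
proof (cases "\<sigma> = 0")
  case True
  have "\<exists>c. ((\<lambda>t. u t y) \<longlongrightarrow> c) (at_right 0)" if y: "y \<in> {0, 1}" for y
  proof -
    obtain c where c: "\<And>t. t > 0 \<Longrightarrow> u t y = c"
      using bdry_const[OF u _ y, of \<mu>] bvp True by blast
    have "((\<lambda>t. u t y) \<longlongrightarrow> c) (at_right 0)"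
      by (rule tendsto_eventually) (auto simp: eventually_at_filter c)
    then show ?thesis ..
  qed
  then show ?thesis by blast
next
  case False
  obtain v where v: "solves_ivp \<mu> \<sigma> (\<lambda>x\<in>{0..1}. if x = 0 then 1 else 0) v"
    using solves_ivp_exists[of \<mu> \<sigma>] indicator_datum_F[of 0] by blast
  obtain w where w: "solves_ivp \<mu> \<sigma> (\<lambda>x\<in>{0..1}. if x = 1 then 1 else 0) w"
    using solves_ivp_exists[of \<mu> \<sigma>] indicator_datum_F[of 1] by blast
  have vU: "v \<in> U_space" and wU: "w \<in> U_space" using v w by (auto simp: solves_ivp_def)
  have lim: "((\<lambda>t. v t 0) \<longlongrightarrow> 1) (at_right 0)" "((\<lambda>t. v t 1) \<longlongrightarrow> 0) (at_right 0)"
    "((\<lambda>t. w t 0) \<longlongrightarrow> 0) (at_right 0)" "((\<lambda>t. w t 1) \<longlongrightarrow> 1) (at_right 0)"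
  proof -
    have "((\<lambda>t. v t x) \<longlongrightarrow> (\<lambda>x\<in>{0..1}. if x = 0 then 1 else 0) x) (at_right 0)"
      "((\<lambda>t. w t x) \<longlongrightarrow> (\<lambda>x\<in>{0..1}. if x = 1 then 1 else 0) x) (at_right 0)" if "x \<in> {0..1}" for x
      using v w that unfolding solves_ivp_def F_converges_at_0_def by blast+
    from this[of 0] this[of 1] show "((\<lambda>t. v t 0) \<longlongrightarrow> 1) (at_right 0)" "((\<lambda>t. v t 1) \<longlongrightarrow> 0) (at_right 0)"
      "((\<lambda>t. w t 0) \<longlongrightarrow> 0) (at_right 0)" "((\<lambda>t. w t 1) \<longlongrightarrow> 1) (at_right 0)" by simp_all
  qed
  \<comment> \<open>The matrix of end values of \<open>v\<close> and \<open>w\<close> tends to the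
    identity, so its determinant is positive at some time \<open>t\<close>, which is fixed from here
    on.\<close>
  have "((\<lambda>t. v t 0 * w t 1 - v t 1 * w t 0) \<longlongrightarrow> 1 * 1 - 0 * 0) (at_right 0)"
    by (intro tendsto_intros lim)
  then have "\<forall>\<^sub>F t in at_right 0. v t 0 * w t 1 - v t 1 * w t 0 > 0"
    by (rule order_tendstoD) simp
  moreover have "\<forall>\<^sub>F t in at_right (0::real). t > 0" by (auto simp: eventually_at_filter)
  ultimately have "\<forall>\<^sub>F t in at_right 0. v t 0 * w t 1 - v t 1 * w t 0 > 0 \<and> t > 0"
    by eventually_elim simp
  from eventually_happens'[OF _ this] obtain t where t: "t > 0" and det: "v t 0 * w t 1 - v t 1 * w t 0 > 0"
    by auto
  \<comment> \<open>Conservation of the pairing expresses the boundary combination through the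
    weighted integral, and the latter converges by interior convergence of \<open>u\<close> alone.
    Multiplying by 2 \<sigma> uses that \<sigma> is not 0.\<close>
  have eqn: "\<exists>d. ((\<lambda>r. exp (2 * \<mu>) * (u r 1 * y (t - r) 1) + u r 0 * y (t - r) 0) \<longlongrightarrow> d) (at_right 0)"
    if y: "y \<in> U_space" "solves_bvp \<mu> \<sigma> y" for y
  proof -
    obtain c where c: "\<And>r. r \<in> {0<..<t} \<Longrightarrow> pairing \<mu> \<sigma> (u r) (y (t - r)) = c"
      using pairing_const[OF u y(1) bvp y(2), of t] False by blast
    have "((\<lambda>r. wint \<mu> (u r) (y (t - r))) \<longlongrightarrow> wint \<mu> g (y t)) (at_right 0)"
      by (rule wint_tendsto[OF u y(1) t l])
    then have "((\<lambda>r. (wint \<mu> (u r) (y (t - r)) - c) * (2 * \<sigma>)) \<longlongrightarrow> (wint \<mu> g (y t) - c) * (2 * \<sigma>)) (at_right 0)"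
      by (intro tendsto_intros)
    moreover have "\<forall>\<^sub>F r in at_right 0. (wint \<mu> (u r) (y (t - r)) - c) * (2 * \<sigma>) =
        exp (2 * \<mu>) * (u r 1 * y (t - r) 1) + u r 0 * y (t - r) 0"
      using eventually_at_right_0_less[OF t]
    proof eventually_elim
      case (elim r)
      define X where "X = exp (2 * \<mu>) * (u r 1 * y (t - r) 1) + u r 0 * y (t - r) 0"
      have "wint \<mu> (u r) (y (t - r)) - c = 1 / (2 * \<sigma>) * X"
        using c[of r] elim by (simp add: pairing_def X_def)
      then show ?case using False by (simp add: X_def[symmetric])
    qed
    ultimately show ?thesis by (intro exI) (rule Lim_transform_eventually)
  qed
  have bv: "solves_bvp \<mu> \<sigma> v" "solves_bvp \<mu> \<sigma> w" using v w by (auto simp: solves_ivp_def)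
  obtain d where d: "((\<lambda>r. exp (2 * \<mu>) * (u r 1 * v (t - r) 1) + u r 0 * v (t - r) 0) \<longlongrightarrow> d) (at_right 0)"
    using eqn[OF vU bv(1)] by blast
  obtain e where e: "((\<lambda>r. exp (2 * \<mu>) * (u r 1 * w (t - r) 1) + u r 0 * w (t - r) 0) \<longlongrightarrow> e) (at_right 0)"
    using eqn[OF wU bv(2)] by blast
  define D where "D r = v (t - r) 0 * w (t - r) 1 - v (t - r) 1 * w (t - r) 0" for r
  have rev: "((\<lambda>r. y (t - r) x) \<longlongrightarrow> y t x) (at_right 0)" if "y \<in> U_space" "x \<in> {0..1}" for y x
    by (rule C12_tendsto_back[OF U_space_C12[OF that(1)] that(2) t])
  have D: "(D \<longlongrightarrow> v t 0 * w t 1 - v t 1 * w t 0) (at_right 0)"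
    unfolding D_def by (intro tendsto_intros rev vU wU) auto
  have Dpos: "\<forall>\<^sub>F r in at_right 0. D r > 0" by (rule order_tendstoD(1)[OF D det])
  let ?P = "\<lambda>r. exp (2 * \<mu>) * (u r 1 * v (t - r) 1) + u r 0 * v (t - r) 0"
  let ?R = "\<lambda>r. exp (2 * \<mu>) * (u r 1 * w (t - r) 1) + u r 0 * w (t - r) 0"
  \<comment> \<open>Cramer's rule, here for \<open>u r 0\<close> and below for \<open>u r 1\<close>,
    where the factor exp (2 \<mu>) of the weight is divided out as well. The coefficients are end
    values at time t - r and converge to those at \<open>t\<close>.\<close>
  have "((\<lambda>r. (?P r * w (t - r) 1 - ?R r * v (t - r) 1) / D r) \<longlongrightarrow>
      (d * w t 1 - e * v t 1) / (v t 0 * w t 1 - v t 1 * w t 0)) (at_right 0)"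
    by (intro tendsto_divide tendsto_diff tendsto_mult d e D rev vU wU) (use det in auto)
  moreover have "\<forall>\<^sub>F r in at_right 0. (?P r * w (t - r) 1 - ?R r * v (t - r) 1) / D r = u r 0"
    using Dpos
  proof eventually_elim
    case (elim r)
    have "?P r * w (t - r) 1 - ?R r * v (t - r) 1 = u r 0 * D r" by (simp add: D_def algebra_simps)
    then show ?case using elim by simp
  qed
  ultimately have 1: "((\<lambda>r. u r 0) \<longlongrightarrow> (d * w t 1 - e * v t 1) / (v t 0 * w t 1 - v t 1 * w t 0)) (at_right 0)"
    by (rule Lim_transform_eventually)
  have "((\<lambda>r. exp (- 2 * \<mu>) * ((?R r * v (t - r) 0 - ?P r * w (t - r) 0) / D r)) \<longlongrightarrow>
      exp (- 2 * \<mu>) * ((e * v t 0 - d * w t 0) / (v t 0 * w t 1 - v t 1 * w t 0))) (at_right 0)"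
    by (intro tendsto_divide tendsto_diff tendsto_mult tendsto_const d e D rev vU wU) (use det in auto)
  moreover have "\<forall>\<^sub>F r in at_right 0. exp (- 2 * \<mu>) * ((?R r * v (t - r) 0 - ?P r * w (t - r) 0) / D r)
      = u r 1"
    using Dpos
  proof eventually_elim
    case (elim r)
    have "?R r * v (t - r) 0 - ?P r * w (t - r) 0 = exp (2 * \<mu>) * u r 1 * D r"
        by (simp add: D_def algebra_simps)
    then have "(?R r * v (t - r) 0 - ?P r * w (t - r) 0) / D r = exp (2 * \<mu>) * u r 1" using elim by simp
    moreover have "exp (- 2 * \<mu>) * (exp (2 * \<mu>) * u r 1) = u r 1" by (simp flip: mult.assoc exp_add)
    ultimately show ?case by simp
  qed
  ultimately have 2: "((\<lambda>r. u r 1) \<longlongrightarrow>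
      exp (- 2 * \<mu>) * ((e * v t 0 - d * w t 0) / (v t 0 * w t 1 - v t 1 * w t 0))) (at_right 0)"
    by (rule Lim_transform_eventually)
  from 1 2 show ?thesis by blast
qed

text \<open>The given limit \<open>g\<close> is meaningful only in the interior, so a member of
  \<open>F_space\<close> is assembled from it and the two end limits. Its continuity is local:
  around each interior point there is a compact interval on which the convergence is
  uniform.\<close>

lemma limit_in_F:
  assumes u: "u \<in> U_space" and c: "unif_conv_compacts u g (at_right 0)"
    and 0: "((\<lambda>t. u t 0) \<longlongrightarrow> a) (at_right 0)" and 1: "((\<lambda>t. u t 1) \<longlongrightarrow> b) (at_right 0)"
  shows "\<exists>f\<in>F_space. F_converges_at_0 u f"
proof -
  define f where "f = (\<lambda>x\<in>{0..1}. if x = 0 then a else if x = 1 then b else g x)"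
  have ev: "\<forall>\<^sub>F t in at_right (0::real). 0 < t \<and> t < 1" by (rule eventually_at_right_0_less) simp
  have ul: "uniform_limit K u g (at_right 0)" if "compact K" "K \<subseteq> {0<..<1}" for K
    using c that by (auto simp: unif_conv_compacts_def)
  have gl: "((\<lambda>t. u t x) \<longlongrightarrow> g x) (at_right 0)" if "0 < x" "x < 1" for x
    by (rule tendsto_uniform_limitI[OF ul[of "{x}"]]) (use that in auto)
  have fl: "((\<lambda>t. u t x) \<longlongrightarrow> f x) (at_right 0)" if "x \<in> {0..1}" for x
    using that 0 1 gl[of x] by (auto simp: f_def)
  have fg: "f x = g x" if "0 < x" "x < 1" for x using that by (simp add: f_def)
  obtain B where B: "\<And>t x. 0 < t \<Longrightarrow> t \<le> 1 \<Longrightarrow> x \<in> {0..1} \<Longrightarrow> \<bar>u t x\<bar> \<le> B" using U_space_bounded[OF u] by metis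
  have "norm (f x) \<le> B" if x: "x \<in> {0..1}" for x
  proof (rule tendsto_upperbound[OF tendsto_norm[OF fl[OF x]]])
    show "\<forall>\<^sub>F t in at_right 0. norm (u t x) \<le> B"
      using ev by eventually_elim (use B x in auto)
  qed simp
  then have "bounded (f ` {0..1})" unfolding bounded_iff by blast
  moreover have "continuous_on {0<..<1} f"
  proof (rule continuous_on_eq)
    show "continuous_on {0<..<1} g"
    proof (rule continuous_at_imp_continuous_on, rule ballI)
      fix x :: real assume x: "x \<in> {0<..<1}"
      define K where "K = {x / 2..(x + 1) / 2}"
      have K: "K \<subseteq> {0<..<1}" "x \<in> interior K" using x by (auto simp: K_def)
      have "continuous_on K g"
      proof (rule uniform_limit_theorem[OF _ ul])
        show "\<forall>\<^sub>F t in at_right 0. continuous_on K (u t)"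
          using ev
        proof eventually_elim
          case (elim t)
          show ?case
            by (rule continuous_on_subset[OF slice_continuous[OF C12_continuous(1)[OF U_space_C12[OF u]]]])
               (use elim x in \<open>auto simp: K_def\<close>)
        qed
      qed (use K(1) in \<open>auto simp: K_def\<close>)
      then show "isCont g x" using K(2) by (rule continuous_on_interior)
    qed
  qed (simp add: fg)
  ultimately have f: "f \<in> F_space" by (simp add: F_space_def f_def)
  have "F_converges_at_0 u f"
  proof (rule F_converges_at_0I[OF u f fl fl])
    show "unif_conv_compacts u f (at_right 0)"
      unfolding unif_conv_compacts_def
    proof (intro allI impI)
      fix K assume K: "compact K \<and> K \<subseteq> {0<..<1::real}"
      show "uniform_limit K u f (at_right 0)"
      proof (rule uniform_limit_cong[THEN iffD1, OF _ _ ul])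
        show "\<forall>\<^sub>F t in at_right 0. \<forall>x\<in>K. u t x = u t x" by simp
        show "g x = f x" if "x \<in> K" for x using K that fg[of x] by force
      qed (use K in auto)
    qed
  qed auto
  then show ?thesis using f by blast
qed

text \<open>Restarting at a positive time; with uniqueness this gives the semigroup law. The datum
  \<open>u t\<close> is continuous on the closed interval, so the convergence is even uniform on
  \<open>{0..1}\<close>.\<close>

lemma solves_ivp_shift:
  assumes u: "solves_ivp \<mu> \<sigma> f u" and t: "0 < t"
  shows "solves_ivp \<mu> \<sigma> (u t) (\<lambda>s\<in>{0<..}. u (s + t))"
    (is "solves_ivp _ _ _ ?w")
proof -
  have U: "u \<in> U_space" and b: "solves_bvp \<mu> \<sigma> u" using u by (auto simp: solves_ivp_def)
  note cu = U_space_C12[OF U]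
  have e: "u \<in> {0<..} \<rightarrow>\<^sub>E extensional {0..1}" using U by (simp add: U_space_def)
  have cc: "continuous_on ({0<..} \<times> {0..1}) (\<lambda>(s, x). y (s + t) x)"
    if "continuous_on ({0<..} \<times> {0..1}) (\<lambda>(t, x). y t x)" for y :: "real \<Rightarrow> real \<Rightarrow> real"
    unfolding case_prod_beta
    by (rule continuous_on_compose2[OF that, of _ "\<lambda>p. (fst p + t, snd p)", simplified])
       (use t in \<open>auto intro!: continuous_intros\<close>)
  obtain B where B: "\<And>s x. t \<le> s \<Longrightarrow> s \<le> 1 + t \<Longrightarrow> x \<in> {0..1} \<Longrightarrow> \<bar>u s x\<bar> \<le> B"
    using C12_bounded[OF cu t, of "1 + t"] by metis
  have d1: "(u (s + t) has_real_derivative dx u (s + t) x) (at x)"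
    and d2: "(dx u (s + t) has_real_derivative dxx u (s + t) x) (at x)"
    if "0 < s" "0 < x" "x < 1" for s x
    using C12_interior_derivs(1,2)[OF cu, of "s + t" x] that t by auto
  have d3: "((\<lambda>s. u (s + t) x) has_real_derivative dt u (s + t) x) (at s)" if "0 < s" "0 < x" "x < 1" for s x
    using C12_interior_derivs(3)[OF cu, of "s + t" x] that t
    by (subst DERIV_shift[of "\<lambda>s. u s x" _ s t, symmetric]) auto
  have bd: "\<bar>u (s + t) x\<bar> \<le> B" if "0 < s" "s \<le> 1" "x \<in> {0..1}" for s x
    using B[of "s + t" x] that by simp
  have we: "?w \<in> {0<..} \<rightarrow>\<^sub>E extensional {0..1}" using e t by auto
  have wv: "?w s x = u (s + t) x" if "0 < s" "x \<in> {0..1}" for s x using that by simp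
  note W = U_spaceI[OF cc[OF C12_continuous(1)[OF cu]] cc[OF C12_continuous(3)[OF cu]] cc[OF
      C12_continuous(4)[OF cu]]
      cc[OF C12_continuous(2)[OF cu]] d1 d2 d3 bd we wv]
  have wU: "?w \<in> U_space" by (rule W(1)) assumption+
  have wd: "dt ?w s x = dt u (s + t) x" "dx ?w s x = dx u (s + t) x" "dxx ?w s x = dxx u (s + t) x"
    if "0 < s" "x \<in> {0..1}" for s x
    using that by - (rule W(2) W(3) W(4); assumption)+
  have bvp: "solves_bvp \<mu> \<sigma> ?w" using b t unfolding solves_bvp_def by (simp add: wd)
  have utF: "u t \<in> F_space" by (rule U_space_slice_F[OF U t])
  have ev: "\<forall>\<^sub>F s in at_right (0::real). 0 < s \<and> s < 1" by (rule eventually_at_right_0_less) simp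
  have ul: "uniform_limit {0..1} ?w (u t) (at_right 0)"
  proof (rule uniform_limitI)
    fix e :: real assume e: "e > 0"
    have "uniformly_continuous_on ({t..t + 1} \<times> {0..1}) (\<lambda>(t, x). u t x)"
      by (intro compact_uniformly_continuous continuous_on_subset[OF C12_continuous(1)[OF cu]] compact_Times)
         (use t in auto)
    then obtain d where d: "d > 0" "\<And>p q. p \<in> {t..t + 1} \<times> {0..1} \<Longrightarrow> q \<in> {t..t + 1} \<times> {0..1} \<Longrightarrow> dist q p < d \<Longrightarrow>
        dist (case q of (t, x) \<Rightarrow> u t x) (case p of (t, x) \<Rightarrow> u t x) < e"
      using e unfolding uniformly_continuous_on_def by metis
    have "\<forall>\<^sub>F s in at_right (0::real). 0 < s \<and> s < d" by (rule eventually_at_right_0_less[OF d(1)])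
    then show "\<forall>\<^sub>F s in at_right 0. \<forall>x\<in>{0..1}. dist (?w s x) (u t x) < e"
      using ev
    proof eventually_elim
      case (elim s)
      show ?case
      proof
        fix x :: real assume x: "x \<in> {0..1}"
        have "dist (u (s + t) x) (u t x) < e"
          using d(2)[of "(t, x)" "(s + t, x)"] elim x by (simp add: dist_Pair_Pair dist_real_def)
        then show "dist (?w s x) (u t x) < e" using elim by simp
      qed
    qed
  qed
  have "F_converges_at_0 ?w (u t)"
  proof (rule F_converges_at_0I[OF wU utF])
    show "unif_conv_compacts ?w (u t) (at_right 0)"
      unfolding unif_conv_compacts_def
    proof (intro allI impI)
      fix K assume "compact K \<and> K \<subseteq> {0<..<1::real}"
      then show "uniform_limit K ?w (u t) (at_right 0)"
        by (intro uniform_limit_on_subset[OF ul]) force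
    qed
  qed (rule tendsto_uniform_limitI[OF ul], simp)+
  then show ?thesis using wU bvp by (simp add: solves_ivp_def)
qed

section \<open>The solution operators and their continuity\<close>

lemma Q_eq:
  assumes "solves_ivp \<mu> \<sigma> f u" "0 < t"
  shows "Q \<mu> \<sigma> t f = u t"
proof -
  have "(THE u. solves_ivp \<mu> \<sigma> f u) = u"
    by (rule the_equality[where P = "solves_ivp \<mu> \<sigma> f", OF assms(1)]) (rule solves_ivp_unique[OF _ assms(1)])
  then show ?thesis using assms(2) by (simp add: Q_def)
qed

lemma Q_0: "Q \<mu> \<sigma> 0 f = f"
  by (simp add: Q_def)

lemma ex_solution: "f \<in> F_space \<Longrightarrow> \<exists>u. solves_ivp \<mu> \<sigma> f u"
  using solves_ivp_exists[of \<mu> \<sigma>] by blast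

lemma Q_in_F:
  assumes f: "f \<in> F_space" and t: "0 \<le> t"
  shows "Q \<mu> \<sigma> t f \<in> F_space"
proof (cases "t = 0")
  case False
  obtain u where u: "solves_ivp \<mu> \<sigma> f u" using ex_solution[OF f] by blast
  then show ?thesis using False t by (simp add: Q_eq[OF u] U_space_slice_F solves_ivp_def)
qed (simp add: Q_0 f)

lemma Q_add:
  assumes f: "f \<in> F_space" and s: "0 \<le> s" and t: "0 \<le> t"
  shows "Q \<mu> \<sigma> (s + t) f = Q \<mu> \<sigma> s (Q \<mu> \<sigma> t f)"
proof -
  consider "s = 0" | "t = 0" | "0 < s" "0 < t" using s t by linarith
  then show ?thesis
  proof cases
    case 3
    obtain u where u: "solves_ivp \<mu> \<sigma> f u" using ex_solution[OF f] by blast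
    have "Q \<mu> \<sigma> s (u t) = u (s + t)" using Q_eq[OF solves_ivp_shift[OF u 3(2)] 3(1)] 3 by simp
    then show ?thesis using 3 by (simp add: Q_eq[OF u])
  qed (simp_all add: Q_0)
qed

lemma Q_linear:
  assumes f: "f \<in> F_space" and g: "g \<in> F_space" and t: "0 \<le> t"
  shows "Q \<mu> \<sigma> t (\<lambda>x\<in>{0..1}. a * f x + b * g x) = (\<lambda>x\<in>{0..1}. a * Q \<mu> \<sigma> t f x + b * Q \<mu> \<sigma> t g x)"
proof (cases "t = 0")
  case False
  obtain u where u: "solves_ivp \<mu> \<sigma> f u" using ex_solution[OF f] by blast
  obtain v where v: "solves_ivp \<mu> \<sigma> g v" using ex_solution[OF g] by blast
  show ?thesis using Q_eq[OF solves_ivp_linear[OF u v, of a b], of t] False t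
      by (simp add: Q_eq[OF u] Q_eq[OF v])
qed (simp add: Q_0)

text \<open>Membership in \<open>F_space\<close> is part of \<open>F_converges_at_0\<close>, so
  closure under linear combinations is read off the linearity of the initial value problem, taken
  with both parameters 0.\<close>

lemma F_space_linear:
  assumes f: "f \<in> F_space" and g: "g \<in> F_space"
  shows "(\<lambda>x\<in>{0..1}. a * f x + b * g x) \<in> F_space"
proof -
  obtain u where u: "solves_ivp 0 0 f u" using ex_solution[OF f] by blast
  obtain v where v: "solves_ivp 0 0 g v" using ex_solution[OF g] by blast
  show ?thesis using solves_ivp_linear[OF u v, of a b] by (simp add: solves_ivp_def F_converges_at_0_def)
qed

text \<open>By uniqueness the estimate for the constructed solution holds for \<open>Q\<close>, with
  one constant for all data at the given time.\<close>

lemma Q_F_mass_bound: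
  assumes t: "0 < t"
  obtains K where "0 \<le> K" "\<And>f x. f \<in> F_space \<Longrightarrow> x \<in> {0..1} \<Longrightarrow> \<bar>Q \<mu> \<sigma> t f x\<bar> \<le> K * F_mass f"
proof -
  from solves_ivp_exists[of \<mu> \<sigma>] obtain K where K: "\<forall>f\<in>F_space. \<exists>u. solves_ivp \<mu> \<sigma> f u \<and>
      (\<forall>t>0. \<forall>x\<in>{0..1}. \<bar>u t x\<bar> \<le> K t * F_mass f)"
    by (rule exE)
  have "\<bar>Q \<mu> \<sigma> t f x\<bar> \<le> \<bar>K t\<bar> * F_mass f" if f: "f \<in> F_space" and x: "x \<in> {0..1}" for f x
  proof -
    obtain u where u: "solves_ivp \<mu> \<sigma> f u" "\<bar>u t x\<bar> \<le> K t * F_mass f" using K f x t by blast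
    have "0 \<le> (\<integral>y. indicator {0<..<1} y * \<bar>f y\<bar> \<partial>lborel)" by (rule integral_nonneg_AE) simp
    then have "0 \<le> F_mass f" by (simp add: F_mass_def)
    then have "K t * F_mass f \<le> \<bar>K t\<bar> * F_mass f" by (intro mult_right_mono) auto
    then show ?thesis using u(2) by (simp add: Q_eq[OF u(1) t])
  qed
  then show ?thesis using that[of "\<bar>K t\<bar>"] by simp
qed

text \<open>The integral over the unit interval and the two end values contribute one supremum
  each.\<close>

lemma F_mass_le_unif_norm:
  assumes f: "f \<in> F_space"
  shows "F_mass f \<le> 3 * unif_norm f"
proof -
  have "norm (\<integral>y. indicator {0<..<1} y * \<bar>f y\<bar> \<partial>lborel) \<le> (\<integral>y. unif_norm f * indicator {0..1::real} y
      \<partial>lborel)"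
  proof (rule norm_integral_le_AE)
    show "integrable lborel (\<lambda>y. unif_norm f * indicator {0..1::real} y)"
      by (intro integrable_mult_right integrable_real_indicator) (auto simp: emeasure_lborel_Icc_eq)
    show "AE y in lborel. norm (indicator {0<..<1} y * \<bar>f y\<bar>) \<le> unif_norm f * indicator {0..1::real} y"
      using F_space_unif_norm[OF f] unif_norm_nonneg[OF f] by (intro AE_I2) (simp add: indicator_def)
  qed
  also have "\<dots> = unif_norm f" by simp
  finally show ?thesis using F_space_unif_norm[OF f, of 0] F_space_unif_norm[OF f, of 1]
      by (simp add: F_mass_def)
qed

text \<open>The norms of a convergent sequence are bounded, so dominated convergence with the
  constant \<open>M + N\<close> handles the integral; the end values converge pointwise.\<close>

lemma F_mass_diff_tendsto_0:
  assumes h: "F_seq_converges h f"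
  shows "(\<lambda>n. F_mass (\<lambda>x\<in>{0..1}. 1 * h n x + (- 1) * f x)) \<longlonglongrightarrow> 0"
proof -
  have hF: "h n \<in> F_space" and fF: "f \<in> F_space" for n using h by (auto simp: F_seq_converges_def)
  have lim: "(\<lambda>n. h n x) \<longlonglongrightarrow> f x" if "x \<in> {0..1}" for x using h that by (simp add: F_seq_converges_def)
  have "bounded (range (\<lambda>n. unif_norm (h n)))" using h by (simp add: F_seq_converges_def)
  then obtain M where M: "\<And>n. norm (unif_norm (h n)) \<le> M" unfolding bounded_iff by blast
  have hM: "\<bar>h n x\<bar> \<le> M" if "x \<in> {0..1}" for n x
    using F_space_unif_norm[OF hF that, of n] M[of n] by simp
  obtain N where N: "0 \<le> N" "\<And>x. x \<in> {0..1} \<Longrightarrow> \<bar>f x\<bar> \<le> N" using F_space_bound[OF fF] by metis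
  have M0: "0 \<le> M" by (rule order_trans[OF norm_ge_zero M])
  define k where "k n x = indicator {0<..<1} x * \<bar>h n x - f x\<bar>" for n and x :: real
  have km: "k n \<in> borel_measurable borel" for n
  proof -
    have "(\<lambda>x. \<bar>indicator {0<..<1} x * h n x - indicator {0<..<1} x * f x\<bar>) \<in> borel_measurable borel"
      using F_space_measurable[OF hF[of n]] F_space_measurable[OF fF] by measurable
    also have "(\<lambda>x. \<bar>indicator {0<..<1} x * h n x - indicator {0<..<1} x * f x\<bar>) = k n"
      by (auto simp: k_def indicator_def fun_eq_iff)
    finally show ?thesis .
  qed
  have "(\<lambda>n. \<integral>x. k n x \<partial>lborel) \<longlonglongrightarrow> (\<integral>x. 0 \<partial>(lborel :: real measure))"
  proof (rule integral_dominated_convergence[where w = "\<lambda>x. (M + N) * indicator {0..1} x"])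
    show "integrable lborel (\<lambda>x. (M + N) * indicator {0..1::real} x)"
      by (intro integrable_mult_right integrable_real_indicator) (auto simp: emeasure_lborel_Icc_eq)
    show "k n \<in> borel_measurable lborel" for n using km by simp
    show "AE x in lborel. norm (k n x) \<le> (M + N) * indicator {0..1} x" for n
    proof (rule AE_I2)
      fix x show "norm (k n x) \<le> (M + N) * indicator {0..1} x"
        using hM[where n = n and x = x] N(2)[of x] N(1) M0 by (auto simp: k_def indicator_def)
    qed
    show "AE x in lborel. (\<lambda>n. k n x) \<longlonglongrightarrow> 0"
    proof (rule AE_I2)
      fix x
      show "(\<lambda>n. k n x) \<longlonglongrightarrow> 0"
      proof (cases "x \<in> {0<..<1}")
        case True
        then have "(\<lambda>n. \<bar>h n x - f x\<bar>) \<longlonglongrightarrow> \<bar>f x - f x\<bar>" by (intro tendsto_intros lim) auto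
        then show ?thesis using True by (simp add: k_def)
      qed (simp add: k_def)
    qed
  qed simp
  moreover have "(\<lambda>n. \<bar>h n 0 - f 0\<bar>) \<longlonglongrightarrow> \<bar>f 0 - f 0\<bar>" "(\<lambda>n. \<bar>h n 1 - f 1\<bar>) \<longlonglongrightarrow> \<bar>f 1 - f 1\<bar>"
    by (intro tendsto_intros lim; simp)+
  ultimately have "(\<lambda>n. (\<integral>x. k n x \<partial>lborel) + \<bar>h n 0 - f 0\<bar> + \<bar>h n 1
      - f 1\<bar>) \<longlonglongrightarrow> (\<integral>x. 0 \<partial>(lborel :: real measure)) + \<bar>f 0 - f 0\<bar> + \<bar>f 1 - f 1\<bar>"
    by (intro tendsto_add)
  moreover have "F_mass (\<lambda>x\<in>{0..1}. 1 * h n x + (- 1) * f x) = (\<integral>x. k n x \<partial>lborel) + \<bar>h n 0 - f 0\<bar> + \<bar>h n 1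
      - f 1\<bar>" for n
  proof -
    have "(\<integral>y. indicator {0<..<1} y * \<bar>(\<lambda>x\<in>{0..1}. 1 * h n x + (- 1) * f x) y\<bar> \<partial>lborel) = (\<integral>x. k n x \<partial>lborel)"
      by (rule Bochner_Integration.integral_cong) (auto simp: k_def indicator_def)
    then show ?thesis by (simp add: F_mass_def)
  qed
  ultimately show ?thesis by simp
qed

lemma Q_bounded_operator:
  assumes t: "0 \<le> t"
  shows "F_bounded_operator (Q \<mu> \<sigma> t)"
proof -
  have "F_linear (Q \<mu> \<sigma> t)"
    unfolding F_linear_def using Q_in_F[OF _ t] Q_linear[OF _ _ t] by blast
  moreover have "\<exists>C. \<forall>f\<in>F_space. unif_norm (Q \<mu> \<sigma> t f) \<le> C * unif_norm f"
  proof (cases "t = 0")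
    case True
    then show ?thesis by (intro exI[of _ 1]) (simp add: Q_0)
  next
    case False
    obtain K where K: "0 \<le> K" "\<And>f x. f \<in> F_space \<Longrightarrow> x \<in> {0..1} \<Longrightarrow> \<bar>Q \<mu> \<sigma> t f x\<bar> \<le> K * F_mass f"
      using Q_F_mass_bound[of t \<mu> \<sigma>] False t by (metis less_eq_real_def)
    have "unif_norm (Q \<mu> \<sigma> t f) \<le> (3 * K) * unif_norm f" if f: "f \<in> F_space" for f
    proof (rule unif_norm_le)
      fix x :: real assume "x \<in> {0..1}"
      then have "\<bar>Q \<mu> \<sigma> t f x\<bar> \<le> K * F_mass f" by (rule K(2)[OF f])
      also have "\<dots> \<le> K * (3 * unif_norm f)" by (intro mult_left_mono F_mass_le_unif_norm f K)
      finally show "\<bar>Q \<mu> \<sigma> t f x\<bar> \<le> (3 * K) * unif_norm f" by simp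
    qed
    then show ?thesis by blast
  qed
  ultimately show ?thesis by (simp add: F_bounded_operator_def)
qed

lemma Q_continuous_operator:
  assumes t: "0 \<le> t"
  shows "F_continuous_operator (Q \<mu> \<sigma> t)"
  unfolding F_continuous_operator_def
proof (intro allI impI)
  fix h f assume h: "F_seq_converges h f"
  show "F_seq_converges (\<lambda>n. Q \<mu> \<sigma> t (h n)) (Q \<mu> \<sigma> t f)"
  proof (cases "t = 0")
    case True
    then show ?thesis using h by (simp add: Q_0)
  next
    case False
    have hF: "h n \<in> F_space" and fF: "f \<in> F_space" for n using h by (auto simp: F_seq_converges_def)
    obtain K where K: "0 \<le> K" "\<And>f x. f \<in> F_space \<Longrightarrow> x \<in> {0..1} \<Longrightarrow> \<bar>Q \<mu> \<sigma> t f x\<bar> \<le> K * F_mass f"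
      using Q_F_mass_bound[of t \<mu> \<sigma>] False t by (metis less_eq_real_def)
    let ?m = "\<lambda>n. F_mass (\<lambda>x\<in>{0..1}. 1 * h n x + (- 1) * f x)"
    have le: "\<bar>Q \<mu> \<sigma> t (h n) x - Q \<mu> \<sigma> t f x\<bar> \<le> K * ?m n" if "x \<in> {0..1}" for n x
      using K(2)[OF F_space_linear[OF hF[of n] fF, where a = 1 and b = "-1"] that] that
        fun_cong[OF Q_linear[OF hF[of n] fF t, of \<mu> \<sigma> 1 "-1"], of x] by simp
    have "(\<lambda>n. K * ?m n) \<longlonglongrightarrow> K * 0" by (intro tendsto_intros F_mass_diff_tendsto_0 h)
    then have m0: "(\<lambda>n. K * ?m n) \<longlonglongrightarrow> 0" by simp
    \<comment> \<open>For t > 0 the operator improves the convergence: by linearity and the L1 bound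
      it is uniform on the whole closed interval, which yields the pointwise limits and those on
      compact sets together.\<close>
    have ul: "uniform_limit {0..1} (\<lambda>n. Q \<mu> \<sigma> t (h n)) (Q \<mu> \<sigma> t f) sequentially"
    proof (rule uniform_limitI)
      fix e :: real assume "e > 0"
      from order_tendstoD(2)[OF m0 this]
      show "\<forall>\<^sub>F n in sequentially. \<forall>x\<in>{0..1}. dist (Q \<mu> \<sigma> t (h n) x) (Q \<mu> \<sigma> t f x) < e"
      proof eventually_elim
        case (elim n)
        show ?case
        proof
          fix x :: real assume x: "x \<in> {0..1}"
          show "dist (Q \<mu> \<sigma> t (h n) x) (Q \<mu> \<sigma> t f x) < e"
            unfolding dist_real_def by (rule le_less_trans[OF le[OF x] elim])
        qed
      qed
    qed
    have "bounded (range (\<lambda>n. unif_norm (Q \<mu> \<sigma> t (h n))))"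
    proof -
      obtain C where C: "\<And>f. f \<in> F_space \<Longrightarrow> unif_norm (Q \<mu> \<sigma> t f) \<le> C * unif_norm f"
        using Q_bounded_operator[OF t, of \<mu> \<sigma>] unfolding F_bounded_operator_def by blast
      have "bounded (range (\<lambda>n. unif_norm (h n)))" using h by (simp add: F_seq_converges_def)
      then obtain M where M: "\<And>n. norm (unif_norm (h n)) \<le> M" unfolding bounded_iff by blast
      have "norm (unif_norm (Q \<mu> \<sigma> t (h n))) \<le> \<bar>C\<bar> * M" for n
      proof -
        have "unif_norm (Q \<mu> \<sigma> t (h n)) \<le> C * unif_norm (h n)" by (rule C[OF hF])
        also have "\<dots> \<le> \<bar>C\<bar> * M" using M[of n] unif_norm_nonneg[OF hF[of n]] by (intro mult_mono) auto
        finally show ?thesis using unif_norm_nonneg[OF Q_in_F[OF hF t], of \<mu> \<sigma> n] by simp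
      qed
      then show ?thesis unfolding bounded_iff by blast
    qed
    moreover have "unif_conv_compacts (\<lambda>n. Q \<mu> \<sigma> t (h n)) (Q \<mu> \<sigma> t f) sequentially"
      unfolding unif_conv_compacts_def
    proof (intro allI impI)
      fix K assume "compact K \<and> K \<subseteq> {0<..<1::real}"
      then show "uniform_limit K (\<lambda>n. Q \<mu> \<sigma> t (h n)) (Q \<mu> \<sigma> t f) sequentially"
        by (intro uniform_limit_on_subset[OF ul]) force
    qed
    ultimately show ?thesis
      unfolding F_seq_converges_def using Q_in_F[OF hF t] Q_in_F[OF fF t] tendsto_uniform_limitI[OF ul]
          by blast
  qed
qed

theorem theorem1p1:
  fixes \<mu> \<sigma> :: real
  shows
    "(\<forall>u\<in>U_space. solves_bvp \<mu> \<sigma> u \<longrightarrow>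
        (\<exists>g. unif_conv_compacts u g (at_right 0)) \<longrightarrow>
        (\<exists>a. ((\<lambda>t. u t 0) \<longlongrightarrow> a) (at_right 0)) \<and>
        (\<exists>b. ((\<lambda>t. u t 1) \<longlongrightarrow> b) (at_right 0)) \<and>
        (\<exists>f\<in>F_space. F_converges_at_0 u f)) \<and>
     (\<forall>f\<in>F_space. \<exists>!u. u \<in> U_space \<and> solves_bvp \<mu> \<sigma> u \<and> F_converges_at_0 u f) \<and>
     F_semigroup (Q \<mu> \<sigma>) \<and>
     (\<forall>t\<ge>0. F_bounded_operator (Q \<mu> \<sigma> t) \<and> F_continuous_operator (Q \<mu> \<sigma> t))"
proof (intro conjI)
  show "\<forall>u\<in>U_space. solves_bvp \<mu> \<sigma> u \<longrightarrow>
        (\<exists>g. unif_conv_compacts u g (at_right 0)) \<longrightarrow>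
        (\<exists>a. ((\<lambda>t. u t 0) \<longlongrightarrow> a) (at_right 0)) \<and>
        (\<exists>b. ((\<lambda>t. u t 1) \<longlongrightarrow> b) (at_right 0)) \<and>
        (\<exists>f\<in>F_space. F_converges_at_0 u f)"
  proof (intro ballI impI, elim exE)
    fix u g assume u: "u \<in> U_space" "solves_bvp \<mu> \<sigma> u" and c: "unif_conv_compacts u g (at_right 0)"
    have l: "((\<lambda>t. u t x) \<longlongrightarrow> g x) (at_right 0)" if "0 < x" "x < 1" for x
    proof -
      have "compact {x} \<and> {x} \<subseteq> {0<..<1}" using that by simp
      then have "uniform_limit {x} u g (at_right 0)" using c unfolding unif_conv_compacts_def by blast
      then show ?thesis by (rule tendsto_uniform_limitI) simp
    qed
    from bdry_values_converge[OF u l] obtain a b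
      where ab: "((\<lambda>t. u t 0) \<longlongrightarrow> a) (at_right 0)" "((\<lambda>t. u t 1) \<longlongrightarrow> b) (at_right 0)" by blast
    with limit_in_F[OF u(1) c ab]
    show "(\<exists>a. ((\<lambda>t. u t 0) \<longlongrightarrow> a) (at_right 0)) \<and> (\<exists>b. ((\<lambda>t. u t 1) \<longlongrightarrow> b) (at_right 0)) \<and>
        (\<exists>f\<in>F_space. F_converges_at_0 u f)" by blast
  qed
  show "\<forall>f\<in>F_space. \<exists>!u. u \<in> U_space \<and> solves_bvp \<mu> \<sigma> u \<and> F_converges_at_0 u f"
  proof
    fix f assume "f \<in> F_space"
    then obtain u where "solves_ivp \<mu> \<sigma> f u" using ex_solution by blast
    then have "\<exists>!u. solves_ivp \<mu> \<sigma> f u" using solves_ivp_unique by blast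
    then show "\<exists>!u. u \<in> U_space \<and> solves_bvp \<mu> \<sigma> u \<and> F_converges_at_0 u f"
      by (simp only: solves_ivp_def)
  qed
  show "F_semigroup (Q \<mu> \<sigma>)"
    unfolding F_semigroup_def using Q_in_F Q_0 Q_add by blast
  show "\<forall>t\<ge>0. F_bounded_operator (Q \<mu> \<sigma> t) \<and> F_continuous_operator (Q \<mu> \<sigma> t)"
    using Q_bounded_operator Q_continuous_operator by blast
qed

end
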